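(* Let $(H,\lambda)$ be a fixed non-bipartite, non-trivial weighted graph. There exists $\beta>0$ such that for every even $m\ge2$, any $\beta$-local ergodic Markov chain $\mathcal{M}$ on $\mathrm{Hom}(\mathbb{Z}_m^n,H)$ with stationary distribution $\mu_{H,\lambda}$ satisfies $$\tau_{\mathcal{M}}= e^{\Omega(m^n/n^2)}.$$ For $(H,\lambda)$ a fixed connected, bipartite, non-trivial weighted graph, the analogous statement holds with $\mathrm{Hom}(\mathbb{Z}_m^n,H)$ replaced by $\mathrm{Hom}^{+}(\mathbb{Z}_m^n,H)$ (respectively $\mathrm{Hom}^{-}(\mathbb{Z}_m^n,H)$) and $\mu_{H,\lambda}$ replaced by $\mu^{+}_{H,\lambda}$ (respectively $\mu^{-}_{H,\lambda}$). Here $e^{\Omega(m^n/n^2)}$ is a lower bound as $n\to\infty$, with implicit constant depending only on $(H,\lambda)$ and $m$.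
   Context: **Weighted graphs.** A weighted graph $(H,\lambda)$ is a finite graph $H$ (loops allowed, at least one edge) with $\lambda:V(H)\to\mathbb{R}_{>0}$; $\lambda_X=\sum_{v\in X}\lambda_v$. For $A,B\subseteq V(H)$, $A\sim B$ means $\{a,b\}\in E(H)$ for all $a\in A,b\in B$. $\eta_\lambda(H)=\max\{\lambda_A\lambda_B:A\sim B\}$, and a dominant pattern is an ordered pair $(A,B)$ with $A\sim B$ and $\lambda_A\lambda_B=\eta_\lambda(H)$. A non-bipartite $(H,\lambda)$ is trivial if it has only one dominant pattern; a bipartite $(H,\lambda)$ is trivial if it has only two dominant patterns; otherwise it is non-trivial. **Torus and measures.** For even $m$, $\mathbb{Z}_m^n$ is the graph on $V=\{0,\dots,m-1\}^n$ in which $x\sim y$ iff there is $i$ with $x_i= y_i\pm1\pmod m$ and $x_j=y_j$ for $j\ne i$; it is bipartite with classes $\mathcal{E}$ (even coordinate sum) and $\mathcal{O}$ (odd coordinate sum). $\mathrm{Hom}(\mathbb{Z}_m^n,H)$ is the set of graph homomorphisms, and $\mu_{H,\lambda}$ is the probability measure on it with $\mu_{H,\lambda}(f)\propto\prod_{v\in V}\lambda_{f(v)}$. If $H$ is connected and bipartite with vertex classes $V^+,V^-$, then $\mathrm{Hom}^+(\mathbb{Z}_m^n,H)$ is the set of homomorphisms $f$ with $f(\mathcal{O})\subseteq V^+$, $f(\mathcal{E})\subseteq V^-$; $\mathrm{Hom}^-(\mathbb{Z}_m^n,H)$ is the set of those with $f(\mathcal{E})\subseteq V^+$, $f(\mathcal{O})\subseteq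 V^-$; $\mu^{\pm}_{H,\lambda}$ is $\mu_{H,\lambda}$ conditioned on $\mathrm{Hom}^{\pm}(\mathbb{Z}_m^n,H)$. **Markov chains.** Let $\mathcal{M}$ be a Markov chain on a finite state space $\Omega$ with transition probabilities $P(\cdot,\cdot)$ and stationary distribution $\pi$; ergodic means connected (irreducible) and aperiodic. $P_{t,\omega_0}$ is the law at time $t$ started from $\omega_0$. The mixing time is $\tau_{\mathcal{M}}=\min\{t_0:\max_{\omega_0\in\Omega}\|P_{t,\omega_0}-\pi\|_{TV}\le 1/e\ \ \forall t>t_0\}$. A chain with state space $\Omega\subseteq\mathrm{Hom}(\mathbb{Z}_m^n,H)$ is $\beta$-local if $f_1,f_2$ differ at no more than $\beta m^n$ vertices whenever $P(f_1,f_2)\ne0$. *)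

theory Defs
  imports "HOL-Probability.Probability" "HOL-Number_Theory.Cong"
begin

section \<open>Weighted graphs\<close>

text \<open>An edge is a set \<open>{u, v}\<close>; a loop at \<open>v\<close> is the singleton \<open>{v, v} = {v}\<close>.\<close>

definition weighted_graph :: "'a set \<Rightarrow> 'a set set \<Rightarrow> ('a \<Rightarrow> real) \<Rightarrow> bool" where
  "weighted_graph V E lam \<longleftrightarrow>
     finite V \<and> (\<forall>e\<in>E. \<exists>u\<in>V. \<exists>v\<in>V. e = {u, v}) \<and> E \<noteq> {} \<and> (\<forall>v\<in>V. lam v > 0)"

definition complete_between :: "'a set set \<Rightarrow> 'a set \<Rightarrow> 'a set \<Rightarrow> bool" where
  "complete_between E A B \<longleftrightarrow> (\<forall>a\<in>A. \<forall>b\<in>B. {a, b} \<in> E)"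

definition eta :: "'a set \<Rightarrow> 'a set set \<Rightarrow> ('a \<Rightarrow> real) \<Rightarrow> real" where
  "eta V E lam = Max {sum lam A * sum lam B | A B. A \<subseteq> V \<and> B \<subseteq> V \<and> complete_between E A B}"

definition dominant_patterns ::
    "'a set \<Rightarrow> 'a set set \<Rightarrow> ('a \<Rightarrow> real) \<Rightarrow> ('a set \<times> 'a set) set" where
  "dominant_patterns V E lam =
     {(A, B). A \<subseteq> V \<and> B \<subseteq> V \<and> complete_between E A B \<and> sum lam A * sum lam B = eta V E lam}"

definition bipartition :: "'a set \<Rightarrow> 'a set set \<Rightarrow> 'a set \<Rightarrow> 'a set \<Rightarrow> bool" where
  "bipartition V E Vp Vm \<longleftrightarrow>
     Vp \<union> Vm = V \<and> Vp \<inter> Vm = {} \<and> (\<forall>e\<in>E. \<exists>u\<in>Vp. \<exists>v\<in>Vm. e = {u, v})"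

definition bipartite :: "'a set \<Rightarrow> 'a set set \<Rightarrow> bool" where
  "bipartite V E \<longleftrightarrow> (\<exists>Vp Vm. bipartition V E Vp Vm)"

definition graph_connected :: "'a set \<Rightarrow> 'a set set \<Rightarrow> bool" where
  "graph_connected V E \<longleftrightarrow> V \<noteq> {} \<and> (\<forall>u\<in>V. \<forall>v\<in>V. (u, v) \<in> {(x, y). {x, y} \<in> E}\<^sup>*)"

definition trivial_graph :: "'a set \<Rightarrow> 'a set set \<Rightarrow> ('a \<Rightarrow> real) \<Rightarrow> bool" where
  "trivial_graph V E lam \<longleftrightarrow>
     card (dominant_patterns V E lam) = (if bipartite V E then 2 else 1)"


section \<open>The torus and its homomorphisms\<close>

definition torus :: "nat \<Rightarrow> nat \<Rightarrow> (nat \<Rightarrow> nat) set" where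
  "torus m n = {..<n} \<rightarrow>\<^sub>E {..<m}"

definition torus_adj :: "nat \<Rightarrow> nat \<Rightarrow> (nat \<Rightarrow> nat) \<Rightarrow> (nat \<Rightarrow> nat) \<Rightarrow> bool" where
  "torus_adj m n x y \<longleftrightarrow>
     (\<exists>i<n. ([int (x i) = int (y i) + 1] (mod int m) \<or> [int (x i) = int (y i) - 1] (mod int m))
            \<and> (\<forall>j<n. j \<noteq> i \<longrightarrow> x j = y j))"

definition even_class :: "nat \<Rightarrow> nat \<Rightarrow> (nat \<Rightarrow> nat) set" where
  "even_class m n = {x \<in> torus m n. even (\<Sum>i<n. x i)}"

definition odd_class :: "nat \<Rightarrow> nat \<Rightarrow> (nat \<Rightarrow> nat) set" where
  "odd_class m n = {x \<in> torus m n. odd (\<Sum>i<n. x i)}"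

definition Homs :: "nat \<Rightarrow> nat \<Rightarrow> 'a set \<Rightarrow> 'a set set \<Rightarrow> ((nat \<Rightarrow> nat) \<Rightarrow> 'a) set" where
  "Homs m n V E =
     {f \<in> torus m n \<rightarrow>\<^sub>E V. \<forall>x\<in>torus m n. \<forall>y\<in>torus m n. torus_adj m n x y \<longrightarrow> {f x, f y} \<in> E}"

definition Homs_plus ::
    "nat \<Rightarrow> nat \<Rightarrow> 'a set \<Rightarrow> 'a set set \<Rightarrow> 'a set \<Rightarrow> 'a set \<Rightarrow> ((nat \<Rightarrow> nat) \<Rightarrow> 'a) set" where
  "Homs_plus m n V E Vp Vm =
     {f \<in> Homs m n V E. f ` odd_class m n \<subseteq> Vp \<and> f ` even_class m n \<subseteq> Vm}"

definition Homs_minus ::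
    "nat \<Rightarrow> nat \<Rightarrow> 'a set \<Rightarrow> 'a set set \<Rightarrow> 'a set \<Rightarrow> 'a set \<Rightarrow> ((nat \<Rightarrow> nat) \<Rightarrow> 'a) set" where
  "Homs_minus m n V E Vp Vm =
     {f \<in> Homs m n V E. f ` even_class m n \<subseteq> Vp \<and> f ` odd_class m n \<subseteq> Vm}"

definition hom_weight :: "nat \<Rightarrow> nat \<Rightarrow> ('a \<Rightarrow> real) \<Rightarrow> ((nat \<Rightarrow> nat) \<Rightarrow> 'a) \<Rightarrow> real" where
  "hom_weight m n lam f = (\<Prod>v\<in>torus m n. lam (f v))"

text \<open>\<open>embed_pmf\<close> and \<open>cond_pmf\<close> are only meaningful under side conditions; these hold
  by \<open>pmf_mu\<close>, \<open>set_pmf_mu\<close>, \<open>Homs_plus_nonempty\<close> and \<open>Homs_minus_nonempty\<close> below.\<close>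

definition mu ::
    "nat \<Rightarrow> nat \<Rightarrow> 'a set \<Rightarrow> 'a set set \<Rightarrow> ('a \<Rightarrow> real) \<Rightarrow> ((nat \<Rightarrow> nat) \<Rightarrow> 'a) pmf" where
  "mu m n V E lam =
     embed_pmf (\<lambda>f. if f \<in> Homs m n V E
                    then hom_weight m n lam f / (\<Sum>g\<in>Homs m n V E. hom_weight m n lam g) else 0)"

definition mu_plus :: "nat \<Rightarrow> nat \<Rightarrow> 'a set \<Rightarrow> 'a set set \<Rightarrow> ('a \<Rightarrow> real) \<Rightarrow>
    'a set \<Rightarrow> 'a set \<Rightarrow> ((nat \<Rightarrow> nat) \<Rightarrow> 'a) pmf" where
  "mu_plus m n V E lam Vp Vm = cond_pmf (mu m n V E lam) (Homs_plus m n V E Vp Vm)"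

definition mu_minus :: "nat \<Rightarrow> nat \<Rightarrow> 'a set \<Rightarrow> 'a set set \<Rightarrow> ('a \<Rightarrow> real) \<Rightarrow>
    'a set \<Rightarrow> 'a set \<Rightarrow> ((nat \<Rightarrow> nat) \<Rightarrow> 'a) pmf" where
  "mu_minus m n V E lam Vp Vm = cond_pmf (mu m n V E lam) (Homs_minus m n V E Vp Vm)"


section \<open>Markov chains\<close>

text \<open>A chain is given by its kernel \<open>K\<close>, with \<open>P(x, y) = pmf (K x) y\<close>; the values of \<open>K\<close>
  outside the state space are irrelevant.\<close>

definition markov_chain_on :: "'s set \<Rightarrow> ('s \<Rightarrow> 's pmf) \<Rightarrow> bool" where
  "markov_chain_on \<Omega> K \<longleftrightarrow> finite \<Omega> \<and> \<Omega> \<noteq> {} \<and> (\<forall>x\<in>\<Omega>. set_pmf (K x) \<subseteq> \<Omega>)"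

primrec law :: "('s \<Rightarrow> 's pmf) \<Rightarrow> nat \<Rightarrow> 's \<Rightarrow> 's pmf" where
  "law K 0 x = return_pmf x"
| "law K (Suc t) x = bind_pmf (law K t x) K"

definition irreducible_chain :: "'s set \<Rightarrow> ('s \<Rightarrow> 's pmf) \<Rightarrow> bool" where
  "irreducible_chain \<Omega> K \<longleftrightarrow> (\<forall>x\<in>\<Omega>. \<forall>y\<in>\<Omega>. \<exists>t. pmf (law K t x) y > 0)"

definition aperiodic_chain :: "'s set \<Rightarrow> ('s \<Rightarrow> 's pmf) \<Rightarrow> bool" where
  "aperiodic_chain \<Omega> K \<longleftrightarrow> (\<forall>x\<in>\<Omega>. Gcd {t. t > 0 \<and> pmf (law K t x) x > 0} = 1)"

definition ergodic_chain :: "'s set \<Rightarrow> ('s \<Rightarrow> 's pmf) \<Rightarrow> bool" where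
  "ergodic_chain \<Omega> K \<longleftrightarrow> markov_chain_on \<Omega> K \<and> irreducible_chain \<Omega> K \<and> aperiodic_chain \<Omega> K"

definition stationary :: "'s set \<Rightarrow> ('s \<Rightarrow> 's pmf) \<Rightarrow> 's pmf \<Rightarrow> bool" where
  "stationary \<Omega> K p \<longleftrightarrow> set_pmf p \<subseteq> \<Omega> \<and> bind_pmf p K = p"

definition tv_dist :: "'s pmf \<Rightarrow> 's pmf \<Rightarrow> real" where
  "tv_dist p q = (SUP A. \<bar>measure_pmf.prob p A - measure_pmf.prob q A\<bar>)"

definition mixing_time :: "'s set \<Rightarrow> ('s \<Rightarrow> 's pmf) \<Rightarrow> 's pmf \<Rightarrow> nat" where
  "mixing_time \<Omega> K p =
     (LEAST t0. \<forall>t>t0. Max ((\<lambda>x. tv_dist (law K t x) p) ` \<Omega>) \<le> 1 / exp 1)"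

definition local_chain :: "real \<Rightarrow> nat \<Rightarrow> nat \<Rightarrow> ((nat \<Rightarrow> nat) \<Rightarrow> 'a) set \<Rightarrow>
    (((nat \<Rightarrow> nat) \<Rightarrow> 'a) \<Rightarrow> ((nat \<Rightarrow> nat) \<Rightarrow> 'a) pmf) \<Rightarrow> bool" where
  "local_chain \<beta> m n \<Omega> K \<longleftrightarrow>
     (\<forall>f1\<in>\<Omega>. \<forall>f2\<in>\<Omega>. pmf (K f1) f2 \<noteq> 0 \<longrightarrow>
        real (card {v \<in> torus m n. f1 v \<noteq> f2 v}) \<le> \<beta> * real m ^ n)"


section \<open>The measures are well defined\<close>

lemma finite_Homs: "finite V \<Longrightarrow> finite (Homs m n V E)"
  unfolding Homs_def torus_def
  by (rule finite_subset[of _ "({..<n} \<rightarrow>\<^sub>E {..<m}) \<rightarrow>\<^sub>E V"]) (auto intro!: finite_PiE)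

lemma torus_adj_parity:
  assumes "even m" "torus_adj m n x y"
  shows "even (\<Sum>i<n. x i) \<longleftrightarrow> odd (\<Sum>i<n. y i)"
proof -
  obtain i where i: "i < n"
    "[int (x i) = int (y i) + 1] (mod int m) \<or> [int (x i) = int (y i) - 1] (mod int m)"
    "\<And>j. j < n \<Longrightarrow> j \<noteq> i \<Longrightarrow> x j = y j"
    using assms(2) unfolding torus_adj_def by blast
  have two: "(2::int) dvd int m" using assms(1) by simp
  have "[int (x i) = int (y i) + 1] (mod 2) \<or> [int (x i) = int (y i) - 1] (mod 2)"
    using i(2) cong_dvd_modulus[OF _ two] by blast
  then have par: "even (x i) \<longleftrightarrow> odd (y i)"
    unfolding cong_iff_dvd_diff by presburger
  have split: "(\<Sum>j<n. z j) = z i + (\<Sum>j\<in>{..<n} - {i}. z j)" for z :: "nat \<Rightarrow> nat"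
    using i(1) by (simp add: sum.remove)
  have "(\<Sum>j\<in>{..<n} - {i}. x j) = (\<Sum>j\<in>{..<n} - {i}. y j)"
    using i(3) by (intro sum.cong) auto
  then show ?thesis
    using par by (simp add: split[of x] split[of y]) blast
qed

lemma two_valued_Homs:
  assumes "even m" "u \<in> V" "v \<in> V" "{u, v} \<in> E"
  shows "(\<lambda>x\<in>torus m n. if even (\<Sum>i<n. x i) then u else v) \<in> Homs m n V E"
proof -
  let ?f = "\<lambda>x\<in>torus m n. if even (\<Sum>i<n. x i) then u else v"
  have "{?f x, ?f y} \<in> E"
    if "x \<in> torus m n" "y \<in> torus m n" "torus_adj m n x y" for x y
    using that(1,2) torus_adj_parity[OF assms(1) that(3)] assms(4)
    by (cases "even (\<Sum>i<n. x i)") (simp_all add: insert_commute[of v u])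
  moreover have "?f \<in> torus m n \<rightarrow>\<^sub>E V"
    using assms(2,3) by (intro PiE_I) auto
  ultimately show ?thesis unfolding Homs_def by blast
qed

lemma Homs_nonempty:
  assumes "weighted_graph V E lam" "even m"
  shows "Homs m n V E \<noteq> {}"
proof -
  obtain e where e: "e \<in> E"
    using assms(1) by (auto simp: weighted_graph_def)
  then have "\<exists>u\<in>V. \<exists>v\<in>V. e = {u, v}"
    using assms(1) by (simp add: weighted_graph_def)
  then obtain u v where uv: "u \<in> V" "v \<in> V" "{u, v} \<in> E"
    using e by metis
  show ?thesis using two_valued_Homs[OF assms(2) uv] by (rule ex_in_conv[THEN iffD1, OF exI])
qed

lemma Homs_plus_nonempty:
  assumes "weighted_graph V E lam" "even m" "bipartition V E Vp Vm"
  shows "Homs_plus m n V E Vp Vm \<noteq> {}"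
proof -
  obtain e where e: "e \<in> E"
    using assms(1) by (auto simp: weighted_graph_def)
  then have "\<exists>u\<in>Vp. \<exists>v\<in>Vm. e = {u, v}"
    using assms(3) by (simp add: bipartition_def)
  then obtain u v where uv: "u \<in> Vp" "v \<in> Vm" "{u, v} \<in> E"
    using e by metis
  then have vu: "{v, u} \<in> E" by (simp add: insert_commute)
  have V: "u \<in> V" "v \<in> V" using uv assms(3) by (auto simp: bipartition_def)
  have "(\<lambda>x\<in>torus m n. if even (\<Sum>i<n. x i) then v else u) \<in> Homs m n V E"
    using two_valued_Homs[OF assms(2) V(2,1) vu] .
  then have "(\<lambda>x\<in>torus m n. if even (\<Sum>i<n. x i) then v else u) \<in> Homs_plus m n V E Vp Vm"
    using uv by (auto simp: Homs_plus_def odd_class_def even_class_def)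
  then show ?thesis by blast
qed

lemma Homs_minus_nonempty:
  assumes "weighted_graph V E lam" "even m" "bipartition V E Vp Vm"
  shows "Homs_minus m n V E Vp Vm \<noteq> {}"
proof -
  obtain e where e: "e \<in> E"
    using assms(1) by (auto simp: weighted_graph_def)
  then have "\<exists>u\<in>Vp. \<exists>v\<in>Vm. e = {u, v}"
    using assms(3) by (simp add: bipartition_def)
  then obtain u v where uv: "u \<in> Vp" "v \<in> Vm" "{u, v} \<in> E"
    using e by metis
  have V: "u \<in> V" "v \<in> V" using uv assms(3) by (auto simp: bipartition_def)
  have "(\<lambda>x\<in>torus m n. if even (\<Sum>i<n. x i) then u else v) \<in> Homs m n V E"
    using two_valued_Homs[OF assms(2) V uv(3)] .
  then have "(\<lambda>x\<in>torus m n. if even (\<Sum>i<n. x i) then u else v) \<in> Homs_minus m n V E Vp Vm"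
    using uv by (auto simp: Homs_minus_def odd_class_def even_class_def)
  then show ?thesis by blast
qed

lemma hom_weight_pos:
  assumes "weighted_graph V E lam" "f \<in> Homs m n V E"
  shows "hom_weight m n lam f > 0"
  using assms unfolding weighted_graph_def hom_weight_def Homs_def
  by (auto intro!: prod_pos dest: PiE_mem)

lemma pmf_mu:
  assumes "weighted_graph V E lam" "even m"
  shows "pmf (mu m n V E lam) f =
    (if f \<in> Homs m n V E
     then hom_weight m n lam f / (\<Sum>g\<in>Homs m n V E. hom_weight m n lam g) else 0)"
proof -
  let ?H = "Homs m n V E" and ?w = "hom_weight m n lam"
  let ?p = "\<lambda>f. if f \<in> ?H then ?w f / sum ?w ?H else 0"
  have fin: "finite ?H"
    using assms(1) by (intro finite_Homs) (simp add: weighted_graph_def)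
  have Z: "sum ?w ?H > 0"
    using fin Homs_nonempty[OF assms] hom_weight_pos[OF assms(1)] by (intro sum_pos) auto
  have nn: "?p f \<ge> 0" for f
    using Z hom_weight_pos[OF assms(1), of f m n] by auto
  have "(\<integral>\<^sup>+ f. ennreal (?p f) \<partial>count_space UNIV) = (\<integral>\<^sup>+ f. ennreal (?p f) \<partial>count_space ?H)"
    by (subst nn_integral_count_space_indicator) (auto intro!: nn_integral_cong simp: indicator_def)
  also have "\<dots> = (\<Sum>f\<in>?H. ennreal (?p f))"
    by (rule nn_integral_count_space_finite[OF fin])
  also have "\<dots> = ennreal (\<Sum>f\<in>?H. ?p f)"
    by (rule sum_ennreal) (rule nn)
  also have "(\<Sum>f\<in>?H. ?p f) = 1"
    using Z by (simp add: sum_divide_distrib[symmetric])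
  finally show ?thesis
    unfolding mu_def by (subst pmf_embed_pmf) (use nn in auto)
qed

lemma set_pmf_mu:
  assumes "weighted_graph V E lam" "even m"
  shows "set_pmf (mu m n V E lam) = Homs m n V E"
proof -
  have "finite (Homs m n V E)"
    using assms(1) by (intro finite_Homs) (simp add: weighted_graph_def)
  then have "(\<Sum>g\<in>Homs m n V E. hom_weight m n lam g) > 0"
    using Homs_nonempty[OF assms] hom_weight_pos[OF assms(1)] by (intro sum_pos) auto
  then have "pmf (mu m n V E lam) f \<noteq> 0 \<longleftrightarrow> f \<in> Homs m n V E" for f
    using hom_weight_pos[OF assms(1), of f m n] by (cases "f \<in> Homs m n V E") (simp_all add: pmf_mu[OF assms])
  then show ?thesis by (auto simp: set_pmf_eq)
qed

end

theory Submission
  imports Defs "HOL-Real_Asymp.Real_Asymp"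
begin

text \<open>Write \<open>g\<close> for the colouring of the even class. Summing out the odd class, each odd
  vertex \<open>v\<close> contributes a weight depending only on the colour set \<open>g ` N v\<close> of its
  neighbourhood, so a partition function restricted by a condition on \<open>g\<close> is a sum over \<open>g\<close>
  alone. The bottleneck separates two dominant patterns: the states whose colour frequencies on the
  even class are close to those of the first pattern can only be left through states close to no
  pattern at all, and the point is that the latter have total weight at most
  \<open>\<eta> ^ (m ^ n / 2) * exp (- c * m ^ n / n)\<close>, whereas each pattern alone contributes about
  \<open>\<eta> ^ (m ^ n / 2)\<close>.

  In such a state no colour set occurs at almost all odd vertices, so by the Poincare inequality of
  the torus a fraction of order \<open>1 / n\<close> of the pairs of odd vertices at distance two have different
  colour sets. To turn this disagreement into a loss of weight, reveal \<open>g\<close> on a random half \<open>E0\<close> of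
  the even class. This determines nearly all the colour sets, and a vertex outside \<open>E0\<close> must
  take its colour from the intersection of the sets of its neighbours, which costs a factor
  proportional to their disagreement. The sum over the colours on \<open>E0\<close> is bounded by Finner's
  inequality. That inequality pays for one free choice of a colour set per \<open>n\<close> vertices, which
  would cancel the gain. But the disagreement is small, so the colour sets are predicted,
  up to few errors, by their values on a coordinate subtorus of negligible size, and only the
  choice of these values has to be paid for.\<close>

section \<open>Mixing times and bottlenecks\<close>

text \<open>The orders of magnitude dictate the choices. Disagreement gains a constant over
  \<open>n\<close> per odd vertex, so every competing cost must be a smaller constant over
  \<open>n\<close> or of lower order. With \<open>\<tau> = 4 * ln n\<close> the error of the local
  gain is of order \<open>1 / n ^ 2\<close>, and \<open>\<tau>\<close> times the frequency of missed
  colours only of order \<open>ln n / n ^ 2\<close>. A penalty \<open>\<sigma> / deg\<close> per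
  wrongly predicted colour set reduces the free choice to a cost proportional to
  \<open>exp (- \<sigma>) / n\<close>, which a large constant \<open>\<sigma>\<close> beats. The
  disagreement itself pays the penalty: on average the number of wrong predictions is at most
  \<open>8 * m * n / L\<close> times the disagreement, so \<open>L\<close> is taken large compared
  with \<open>\<sigma> * m / \<kappa>\<close>. As \<open>L\<close> does not grow with
  \<open>n\<close>, freezing a block of about \<open>n / L\<close> coordinates still shrinks the
  torus exponentially. The resulting exponent is of order \<open>m ^ n / n\<close>. The locality
  constant comes only from the distance between the colour frequencies of different dominant
  patterns, hence does not depend on \<open>m\<close>.\<close>

lemma prob_finite_support:
  assumes "finite \<Omega>" "set_pmf p \<subseteq> \<Omega>"
  shows "measure_pmf.prob p A = (\<Sum>x\<in>\<Omega>. pmf p x * indicator A x)"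
proof -
  have "measure_pmf.prob p A = measure_pmf.expectation p (indicator A)" by simp
  also have "\<dots> = (\<Sum>x\<in>\<Omega>. indicator A x * pmf p x)"
    using assms by (intro integral_measure_pmf_real) auto
  finally show ?thesis by (simp add: mult.commute)
qed

lemma prob_bind_finite:
  assumes "finite \<Omega>" "set_pmf p \<subseteq> \<Omega>"
  shows "measure_pmf.prob (bind_pmf p f) A = (\<Sum>x\<in>\<Omega>. pmf p x * measure_pmf.prob (f x) A)"
proof -
  have "measure_pmf.prob (bind_pmf p f) A = measure_pmf.expectation p (\<lambda>x. measure_pmf.prob (f x) A)"
    by (subst measure_pmf_bind) (subst measure_pmf.measure_bind[where N = "count_space UNIV"],
        auto simp: measure_pmf_in_subprob_algebra)
  also have "\<dots> = (\<Sum>x\<in>\<Omega>. measure_pmf.prob (f x) A * pmf p x)"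
    using assms by (intro integral_measure_pmf_real) auto
  finally show ?thesis by (simp add: mult.commute)
qed

section \<open>Laws at time \<open>t\<close> and convergence of ergodic chains\<close>

lemma law_add: "law K (s + t) x = bind_pmf (law K s x) (law K t)"
proof (induction t)
  case 0
  have "law K 0 = return_pmf" by (simp add: fun_eq_iff)
  then show ?case by (simp add: bind_return_pmf')
next
  case (Suc t)
  have "law K (Suc t) = (\<lambda>y. bind_pmf (law K t y) K)" by (simp add: fun_eq_iff)
  then show ?case by (simp add: Suc bind_assoc_pmf)
qed

lemma set_law:
  assumes "markov_chain_on \<Omega> K" "x \<in> \<Omega>"
  shows "set_pmf (law K t x) \<subseteq> \<Omega>"
  using assms by (induction t) (auto simp: markov_chain_on_def)

lemma stationary_law:
  assumes "stationary \<Omega> K p"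
  shows "bind_pmf p (law K t) = p"
proof (induction t)
  case 0
  have "law K 0 = return_pmf" by (simp add: fun_eq_iff)
  then show ?case by (simp add: bind_return_pmf')
next
  case (Suc t)
  have "law K (Suc t) = (\<lambda>y. bind_pmf (law K t y) K)" by (simp add: fun_eq_iff)
  then have "bind_pmf p (law K (Suc t)) = bind_pmf (bind_pmf p (law K t)) K"
    by (simp only: bind_assoc_pmf)
  also have "\<dots> = p" unfolding Suc using assms by (simp add: stationary_def)
  finally show ?case .
qed

text \<open>The least positive difference of two elements of the semigroup divides every element.\<close>

lemma numerical_semigroup:
  fixes S :: "nat set"
  assumes add: "\<And>a b. a \<in> S \<Longrightarrow> b \<in> S \<Longrightarrow> a + b \<in> S" and gcd: "Gcd S = 1"
  shows "\<exists>n0. \<forall>n\<ge>n0. n \<in> S"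
proof -
  define S' where "S' = insert 0 S"
  have add': "a + b \<in> S'" if "a \<in> S'" "b \<in> S'" for a b using that add by (auto simp: S'_def)
  have mult': "k * a \<in> S'" if "a \<in> S'" for k a
  proof (induction k)
    case (Suc k) then show ?case using add'[OF that Suc] by simp
  qed (simp add: S'_def)
  define P where "P d \<longleftrightarrow> d > 0 \<and> (\<exists>a\<in>S'. a + d \<in> S')" for d
  obtain s where s: "s \<in> S" "s > 0"
  proof -
    have "\<not> S \<subseteq> {0}" using gcd by (metis Gcd_0_iff zero_neq_one)
    then show ?thesis using that by auto
  qed
  then have "P s" by (auto simp: P_def S'_def)
  define g where "g = (LEAST d. P d)"
  have Pg: "P g" unfolding g_def using \<open>P s\<close> by (rule LeastI)
  have least: "\<not> P d" if "d < g" for d using that not_less_Least unfolding g_def by blast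
  obtain a where a: "a \<in> S'" "a + g \<in> S'" using Pg by (auto simp: P_def)
  have "g dvd x" if x: "x \<in> S" for x
  proof -
    have "(x div g) * (a + g) + x mod g = x + (x div g) * a"
    proof -
      have "(x div g) * (a + g) + x mod g = (x div g) * a + ((x div g) * g + x mod g)"
        by (simp only: distrib_left add.assoc)
      then show ?thesis by simp
    qed
    moreover have "x + (x div g) * a \<in> S'"
      using x by (intro add' mult' a(1)) (simp add: S'_def)
    ultimately have "(x div g) * (a + g) + x mod g \<in> S'" "(x div g) * (a + g) \<in> S'"
      using mult'[OF a(2)] by auto
    then have "x mod g = 0 \<or> P (x mod g)" by (auto simp: P_def)
    moreover have "x mod g < g" using Pg by (simp add: P_def)
    ultimately show ?thesis using least by auto
  qed
  then have "g dvd Gcd S" by (rule Gcd_greatest)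
  then have g1: "g = 1" using gcd by simp
  have all: "n \<in> S'" if "n \<ge> a * a" for n
  proof (cases "a = 0")
    case True
    then show ?thesis using mult'[of 1 n] a(2) g1 by simp
  next
    case False
    have "n mod a < a" using False by simp
    moreover have "a \<le> n div a" using div_le_mono[OF that, of a] False by simp
    ultimately have le: "n mod a \<le> n div a" by linarith
    have "n = (n div a - n mod a) * a + (n mod a) * (a + 1)"
    proof -
      have "(n div a - n mod a) * a + (n mod a) * (a + 1)
          = ((n div a - n mod a) + n mod a) * a + n mod a" by (simp add: algebra_simps)
      then show ?thesis using le by simp
    qed
    moreover have "(n div a - n mod a) * a + (n mod a) * (a + 1) \<in> S'"
      using add'[OF mult'[OF a(1)] mult'[of "a + 1"]] a(2) g1 by simp
    ultimately show ?thesis by simp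
  qed
  have "n \<in> S" if "n \<ge> Suc (a * a)" for n using all[of n] that by (auto simp: S'_def)
  then show ?thesis by blast
qed

text \<open>The return times of a state are closed under addition, and aperiodicity gives them gcd
  one, so they contain all large integers. The finitely many pairs of states then share one
  \<open>T\<close>.\<close>

lemma ergodic_positive:
  assumes "ergodic_chain \<Omega> K"
  obtains T where "\<And>x y. x \<in> \<Omega> \<Longrightarrow> y \<in> \<Omega> \<Longrightarrow> pmf (law K T x) y > 0"
proof -
  have mc: "markov_chain_on \<Omega> K" and irr: "irreducible_chain \<Omega> K" and ap: "aperiodic_chain \<Omega> K"
    using assms by (auto simp: ergodic_chain_def)
  have fin: "finite \<Omega>" using mc by (simp add: markov_chain_on_def)
  have comp: "pmf (law K (s + t) x) z > 0"
    if "pmf (law K s x) y > 0" "pmf (law K t y) z > 0" for s t x y z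
    using that unfolding law_add pmf_positive_iff by auto
  have ex: "\<exists>n0. \<forall>n\<ge>n0. pmf (law K n x) y > 0" if xy: "x \<in> \<Omega>" "y \<in> \<Omega>" for x y
  proof -
    obtain s where s: "pmf (law K s x) y > 0" using irr xy by (auto simp: irreducible_chain_def)
    let ?S = "{t. t > 0 \<and> pmf (law K t y) y > 0}"
    have "\<exists>n0. \<forall>n\<ge>n0. n \<in> ?S"
      using ap xy comp by (intro numerical_semigroup) (auto simp: aperiodic_chain_def)
    then obtain n0 where n0: "\<And>n. n \<ge> n0 \<Longrightarrow> pmf (law K n y) y > 0" by auto
    have "pmf (law K n x) y > 0" if "n \<ge> s + n0" for n
      using comp[OF s n0[of "n - s"]] that by simp
    then show ?thesis by blast
  qed
  obtain n0 where n0: "\<And>x y n. x \<in> \<Omega> \<Longrightarrow> y \<in> \<Omega> \<Longrightarrow> n \<ge> n0 x y \<Longrightarrow> pmf (law K n x) y > 0"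
    using ex by metis
  define T where "T = Max (insert 0 ((\<lambda>(x, y). n0 x y) ` (\<Omega> \<times> \<Omega>)))"
  have "n0 x y \<le> T" if "x \<in> \<Omega>" "y \<in> \<Omega>" for x y
    unfolding T_def using that fin by (intro Max_ge) auto
  then show ?thesis using n0 that by blast
qed

text \<open>\<open>mixing_time\<close> is a \<open>LEAST\<close>, which carries information only
  once some threshold exists. Existence is Doeblin's argument: the oscillation, over starting
  states, of the probability of an event shrinks by a fixed factor every \<open>T\<close>
  steps.\<close>

lemma ergodic_converges:
  assumes erg: "ergodic_chain \<Omega> K" and st: "stationary \<Omega> K p"
  shows "\<exists>t0. \<forall>t>t0. Max ((\<lambda>x. tv_dist (law K t x) p) ` \<Omega>) \<le> 1 / exp 1"
proof -
  have mc: "markov_chain_on \<Omega> K" using erg by (simp add: ergodic_chain_def)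
  then have fin: "finite \<Omega>" and ne: "\<Omega> \<noteq> {}" by (auto simp: markov_chain_on_def)
  obtain T where T: "\<And>x y. x \<in> \<Omega> \<Longrightarrow> y \<in> \<Omega> \<Longrightarrow> pmf (law K T x) y > 0"
    by (rule ergodic_positive[OF erg]) blast
  define h where "h t x A = measure_pmf.prob (law K t x) A" for t x A
  have hadd: "h (s + t) x A = (\<Sum>y\<in>\<Omega>. pmf (law K s x) y * h t y A)" if "x \<in> \<Omega>" for s t x A
    unfolding h_def law_add using fin set_law[OF mc that] by (rule prob_bind_finite)
  have sum1: "(\<Sum>y\<in>\<Omega>. pmf (law K s x) y) = 1" if "x \<in> \<Omega>" for s x
    using fin set_law[OF mc that] by (rule sum_pmf_eq_1)
  define \<epsilon> where "\<epsilon> = Min ((\<lambda>(x, y). pmf (law K T x) y) ` (\<Omega> \<times> \<Omega>))"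
  have \<epsilon>: "\<epsilon> > 0" unfolding \<epsilon>_def using fin ne T by (subst Min_gr_iff) auto
  have \<epsilon>le: "\<epsilon> \<le> pmf (law K T x) y" if "x \<in> \<Omega>" "y \<in> \<Omega>" for x y
    unfolding \<epsilon>_def using fin that by (intro Min_le) auto
  have \<epsilon>1: "\<epsilon> \<le> 1" using ne \<epsilon>le pmf_le_1 by (metis ex_in_conv order.trans)
  define B where "B t c \<longleftrightarrow> (\<forall>A. \<forall>x\<in>\<Omega>. \<forall>x'\<in>\<Omega>. h t x A - h t x' A \<le> c)" for t c
  have B0: "B 0 1"
    unfolding B_def h_def by (auto simp: indicator_def)
  have avg_le: "(\<Sum>y\<in>\<Omega>. pmf (law K s x) y * f y) \<le> c"
    if "x \<in> \<Omega>" "\<And>y. y \<in> \<Omega> \<Longrightarrow> f y \<le> c" for s x f c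
  proof -
    have "(\<Sum>y\<in>\<Omega>. pmf (law K s x) y * f y) \<le> (\<Sum>y\<in>\<Omega>. pmf (law K s x) y * c)"
      using that by (intro sum_mono mult_left_mono) auto
    also have "\<dots> = c" using sum1[OF that(1)] by (simp add: sum_distrib_right[symmetric])
    finally show ?thesis .
  qed
  \<comment> \<open>The row of \<open>x\<close> puts at least \<open>\<epsilon>\<close> on the
    minimiser \<open>y0\<close>, where the excess over the minimum vanishes; only the remaining mass
    sees the oscillation.\<close>
  have step: "B (T + t) ((1 - \<epsilon>) * c)" if Bc: "B t c" for t c
    unfolding B_def
  proof (intro allI ballI)
    fix A x x' assume x: "x \<in> \<Omega>" "x' \<in> \<Omega>"
    obtain y0 where y0: "y0 \<in> \<Omega>" "\<And>y. y \<in> \<Omega> \<Longrightarrow> h t y0 A \<le> h t y A"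
      using ex_is_arg_min_if_finite[OF fin ne, of "\<lambda>y. h t y A"] by (auto simp: is_arg_min_linorder)
    have low: "h t y0 A \<le> h (T + t) x' A"
    proof -
      have "(\<Sum>y\<in>\<Omega>. pmf (law K T x') y * (- h t y A)) \<le> - h t y0 A"
        using x(2) y0 by (intro avg_le) auto
      then show ?thesis using hadd[OF x(2)] by (simp add: sum_negf)
    qed
    have "h (T + t) x A - h t y0 A = (\<Sum>y\<in>\<Omega>. pmf (law K T x) y * (h t y A - h t y0 A))"
      using hadd[OF x(1)] sum1[OF x(1)]
      by (simp add: right_diff_distrib sum_subtractf sum_distrib_right[symmetric])
    also have "\<dots> \<le> (\<Sum>y\<in>\<Omega>. (pmf (law K T x) y - \<epsilon> * of_bool (y = y0)) * c)"
    proof (intro sum_mono)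
      fix y assume y: "y \<in> \<Omega>"
      have c: "h t y A - h t y0 A \<le> c" "0 \<le> c" using Bc y y0 by (force simp: B_def)+
      show "pmf (law K T x) y * (h t y A - h t y0 A) \<le> (pmf (law K T x) y - \<epsilon> * of_bool (y = y0)) * c"
        using c \<epsilon>le[OF x(1) y] by (cases "y = y0") (auto intro!: mult_left_mono mult_nonneg_nonneg)
    qed
    also have "\<dots> = (1 - \<epsilon>) * c"
    proof -
      have "(\<Sum>y\<in>\<Omega>. of_bool (y = y0)) = (1::real)" using fin y0(1) by (simp add: of_bool_def)
      then show ?thesis using sum1[OF x(1)]
        by (simp add: sum_distrib_right[symmetric] sum_subtractf sum_distrib_left[symmetric] del: sum_of_bool_eq)
    qed
    finally show "h (T + t) x A - h (T + t) x' A \<le> (1 - \<epsilon>) * c" using low by simp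
  qed
  have mono: "B (s + t) c" if "B t c" for s t c
    unfolding B_def
  proof (intro allI ballI)
    fix A x x' assume x: "x \<in> \<Omega>" "x' \<in> \<Omega>"
    have "h t y A - h (s + t) x' A \<le> c" if y: "y \<in> \<Omega>" for y
    proof -
      have "(\<Sum>z\<in>\<Omega>. pmf (law K s x') z * (h t y A - h t z A)) \<le> c"
        using \<open>B t c\<close> x y by (intro avg_le) (auto simp: B_def)
      then show ?thesis using hadd[OF x(2)] sum1[OF x(2)]
        by (simp add: right_diff_distrib sum_subtractf sum_distrib_right[symmetric])
    qed
    then have "(\<Sum>y\<in>\<Omega>. pmf (law K s x) y * (h t y A - h (s + t) x' A)) \<le> c"
      by (intro avg_le x)
    then show "h (s + t) x A - h (s + t) x' A \<le> c" using hadd[OF x(1)] sum1[OF x(1)]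
      by (simp add: right_diff_distrib sum_subtractf sum_distrib_right[symmetric])
  qed
  have pow: "B (k * T) ((1 - \<epsilon>) ^ k)" for k
    by (induction k) (use B0 step in auto)
  obtain k where k: "(1 - \<epsilon>) ^ k < 1 / exp 1"
    using real_arch_pow_inv[of "1 / exp 1" "1 - \<epsilon>"] \<epsilon> by auto
  have "Max ((\<lambda>x. tv_dist (law K t x) p) ` \<Omega>) \<le> 1 / exp 1" if t: "t > k * T" for t
  proof -
    have Bt: "B t ((1 - \<epsilon>) ^ k)" using mono[OF pow, of "t - k * T" k] t by simp
    have sp: "set_pmf p \<subseteq> \<Omega>" using st by (simp add: stationary_def)
    have "tv_dist (law K t x) p \<le> 1 / exp 1" if x: "x \<in> \<Omega>" for x
      unfolding tv_dist_def
    proof (rule cSUP_least)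
      fix A :: "'a set"
      have pA: "measure_pmf.prob p A = (\<Sum>y\<in>\<Omega>. pmf p y * h t y A)"
        unfolding h_def by (subst stationary_law[OF st, of t, symmetric]) (rule prob_bind_finite[OF fin sp])
      have p1: "(\<Sum>y\<in>\<Omega>. pmf p y) = 1" using fin sp by (rule sum_pmf_eq_1)
      have "(\<Sum>y\<in>\<Omega>. pmf p y * (h t x A - h t y A)) \<le> (\<Sum>y\<in>\<Omega>. pmf p y * (1 - \<epsilon>) ^ k)"
        using Bt x by (intro sum_mono mult_left_mono) (auto simp: B_def)
      moreover have "(\<Sum>y\<in>\<Omega>. pmf p y * (h t y A - h t x A)) \<le> (\<Sum>y\<in>\<Omega>. pmf p y * (1 - \<epsilon>) ^ k)"
        using Bt x by (intro sum_mono mult_left_mono) (auto simp: B_def)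
      ultimately have "\<bar>h t x A - measure_pmf.prob p A\<bar> \<le> (1 - \<epsilon>) ^ k"
        unfolding pA using p1
        by (simp add: right_diff_distrib sum_subtractf sum_distrib_right[symmetric])
      then show "\<bar>measure_pmf.prob (law K t x) A - measure_pmf.prob p A\<bar> \<le> 1 / exp 1"
        using k by (simp add: h_def)
    qed auto
    then show ?thesis using fin ne by (subst Max_le_iff) auto
  qed
  then show ?thesis by blast
qed

text \<open>Started from \<open>p\<close> restricted to \<open>S\<close>, the chain is dominated by
  the stationary one. It therefore visits \<open>D\<close>, its only way out, with mass at most that
  of \<open>D\<close> under \<open>p\<close> at each time, so the escaped mass grows at most
  linearly. After the mixing time every state of \<open>S\<close> must have sent a fixed fraction of
  its mass outside \<open>S\<close>.\<close>

lemma mixing_time_bottleneck: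
  assumes erg: "ergodic_chain \<Omega> K" and st: "stationary \<Omega> K p"
    and S: "S \<subseteq> \<Omega>" "measure_pmf.prob p S > 0" "measure_pmf.prob p S \<le> 1 / 2"
    and bd: "\<And>x. x \<in> S \<Longrightarrow> x \<notin> D \<Longrightarrow> set_pmf (K x) \<subseteq> S"
  shows "(1 / 2 - 1 / exp 1) * measure_pmf.prob p S
           \<le> real (mixing_time \<Omega> K p + 1) * measure_pmf.prob p D"
proof -
  have mc: "markov_chain_on \<Omega> K" using erg by (simp add: ergodic_chain_def)
  then have fin: "finite \<Omega>" and ne: "\<Omega> \<noteq> {}" by (auto simp: markov_chain_on_def)
  have sp: "set_pmf p \<subseteq> \<Omega>" using st by (simp add: stationary_def)
  \<comment> \<open>The distance is controlled only at times strictly after the mixing time.\<close>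
  define T where "T = mixing_time \<Omega> K p + 1"
  have mix: "\<forall>t>mixing_time \<Omega> K p. Max ((\<lambda>x. tv_dist (law K t x) p) ` \<Omega>) \<le> 1 / exp 1"
    unfolding mixing_time_def using ergodic_converges[OF erg st] by (rule LeastI_ex)
  have tv: "tv_dist (law K T x) p \<le> 1 / exp 1" if "x \<in> \<Omega>" for x
  proof -
    have "tv_dist (law K T x) p \<le> Max ((\<lambda>x. tv_dist (law K T x) p) ` \<Omega>)"
      using fin that by (intro Max_ge) auto
    also have "\<dots> \<le> 1 / exp 1"
    proof -
      have "mixing_time \<Omega> K p < T" by (simp add: T_def)
      then show ?thesis by (rule mix[rule_format])
    qed
    finally show ?thesis .
  qed
  let ?P = "measure_pmf.prob"
  have esc: "(\<Sum>x\<in>S. pmf p x * ?P (law K t x) (- S)) \<le> real t * ?P p D" for t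
  proof (induction t)
    case 0
    then show ?case by (auto simp: indicator_def intro!: sum_nonpos)
  next
    case (Suc t)
    have st1: "?P (law K (Suc t) x) (- S) \<le> ?P (law K t x) (- S) + ?P (law K t x) D" if x: "x \<in> S" for x
    proof -
      have xO: "x \<in> \<Omega>" using x S by auto
      have "?P (law K (Suc t) x) (- S) = (\<Sum>y\<in>\<Omega>. pmf (law K t x) y * ?P (K y) (- S))"
        using prob_bind_finite[OF fin set_law[OF mc xO]] by simp
      also have "\<dots> \<le> (\<Sum>y\<in>\<Omega>. pmf (law K t x) y * (indicator (- S) y + indicator D y))"
      proof (intro sum_mono mult_left_mono)
        fix y
        show "?P (K y) (- S) \<le> indicator (- S) y + indicator D y"
        proof (cases "y \<in> S \<and> y \<notin> D")
          case True
          then have "?P (K y) (- S) = 0" using bd[of y] by (subst measure_pmf_zero_iff) auto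
          then show ?thesis by simp
        next
          case False
          then have "1 \<le> indicator (- S) y + (indicator D y :: real)" by (auto simp: indicator_def)
          then show ?thesis using measure_pmf.prob_le_1[of "K y" "- S"] by linarith
        qed
      qed auto
      also have "\<dots> = ?P (law K t x) (- S) + ?P (law K t x) D"
        using prob_finite_support[OF fin set_law[OF mc xO]]
        by (simp add: distrib_left sum.distrib)
      finally show ?thesis .
    qed
    have "(\<Sum>x\<in>S. pmf p x * ?P (law K (Suc t) x) (- S))
       \<le> (\<Sum>x\<in>S. pmf p x * (?P (law K t x) (- S) + ?P (law K t x) D))"
      using st1 by (intro sum_mono mult_left_mono) auto
    also have "\<dots> = (\<Sum>x\<in>S. pmf p x * ?P (law K t x) (- S)) + (\<Sum>x\<in>S. pmf p x * ?P (law K t x) D)"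
      by (simp add: distrib_left sum.distrib)
    also have "(\<Sum>x\<in>S. pmf p x * ?P (law K t x) D) \<le> (\<Sum>x\<in>\<Omega>. pmf p x * ?P (law K t x) D)"
      using fin S by (intro sum_mono2) auto
    also have "\<dots> = ?P p D"
      by (subst (2) stationary_law[OF st, of t, symmetric]) (rule prob_bind_finite[OF fin sp, symmetric])
    finally show ?case using Suc by (simp add: algebra_simps)
  qed
  have pS: "?P p S = (\<Sum>x\<in>S. pmf p x)"
    using finite_subset[OF S(1) fin] by (simp add: measure_measure_pmf_finite)
  have bdd: "bdd_above (range (\<lambda>A. \<bar>?P (law K T x) A - ?P p A\<bar>))" for x
  proof (rule bdd_aboveI2)
    fix A show "\<bar>?P (law K T x) A - ?P p A\<bar> \<le> 1"
      using measure_pmf.prob_le_1[of "law K T x" A] measure_pmf.prob_le_1[of p A]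
        measure_nonneg[of "law K T x" A] measure_nonneg[of p A] by linarith
  qed
  have "1 / 2 - 1 / exp 1 \<le> ?P (law K T x) (- S)" if x: "x \<in> S" for x
  proof -
    have "?P p (- S) - ?P (law K T x) (- S) \<le> \<bar>?P (law K T x) (- S) - ?P p (- S)\<bar>" by simp
    also have "\<dots> \<le> tv_dist (law K T x) p"
      unfolding tv_dist_def by (rule cSUP_upper[OF _ bdd]) auto
    also have "\<dots> \<le> 1 / exp 1" using tv x S by auto
    finally have "?P p (- S) - 1 / exp 1 \<le> ?P (law K T x) (- S)" by simp
    moreover have "?P p (- S) = 1 - ?P p S"
      using measure_pmf.prob_compl[of S p] by (simp add: Compl_eq_Diff_UNIV)
    ultimately show ?thesis using S(3) by simp
  qed
  then have "(\<Sum>x\<in>S. pmf p x * (1 / 2 - 1 / exp 1)) \<le> (\<Sum>x\<in>S. pmf p x * ?P (law K T x) (- S))"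
    by (intro sum_mono mult_left_mono) auto
  also have "\<dots> \<le> real T * ?P p D" by (rule esc)
  finally show ?thesis by (simp add: pS T_def sum_distrib_right[symmetric] mult.commute)
qed

section \<open>Finner's inequality\<close>

lemma prod_le_avg_power:
  fixes x :: "'b \<Rightarrow> real"
  assumes fin: "finite D" and ne: "D \<noteq> {}" and nn: "\<And>v. v \<in> D \<Longrightarrow> x v \<ge> 0"
  shows "(\<Prod>v\<in>D. x v) \<le> (\<Sum>v\<in>D. x v ^ card D) / card D"
proof (cases "\<exists>v\<in>D. x v = 0")
  case True
  then have "(\<Prod>v\<in>D. x v) = 0" using fin by (auto intro: prod_zero)
  then show ?thesis using nn by (auto intro!: divide_nonneg_nonneg sum_nonneg)
next
  case False
  then have pos: "x v > 0" if "v \<in> D" for v using nn[OF that] that by force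
  let ?d = "card D"
  have d: "?d > 0" using fin ne by (simp add: card_gt_0_iff)
  have "(\<Prod>v\<in>D. x v) = exp (\<Sum>v\<in>D. (1 / ?d) *\<^sub>R ln (x v ^ ?d))"
    using pos d fin ne by (simp add: exp_sum ln_realpow)
  also have "\<dots> \<le> (\<Sum>v\<in>D. (1 / ?d) * exp (ln (x v ^ ?d)))"
    using d fin ne by (intro convex_on_sum[OF _ _ exp_convex]) auto
  also have "\<dots> = (\<Sum>v\<in>D. x v ^ ?d) / ?d"
    using pos by (simp add: sum_divide_distrib)
  finally show ?thesis .
qed

text \<open>Each factor is divided by its norm \<open>s v\<close>, and the arithmetic-geometric mean
  inequality is applied pointwise. A factor of norm zero cannot be normalised, but then the left
  hand side vanishes.\<close>

lemma Hoelder_prod: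
  fixes h :: "'b \<Rightarrow> 'c \<Rightarrow> real"
  assumes fin: "finite D" and ne: "D \<noteq> {}" and finC: "finite C"
    and lam: "\<And>c. c \<in> C \<Longrightarrow> lam c \<ge> 0"
    and h: "\<And>v c. v \<in> D \<Longrightarrow> c \<in> C \<Longrightarrow> h v c \<ge> 0"
  shows "(\<Sum>c\<in>C. lam c * (\<Prod>v\<in>D. h v c)) \<le>
         (\<Prod>v\<in>D. root (card D) (\<Sum>c\<in>C. lam c * h v c ^ card D))"
proof -
  let ?d = "card D"
  define S where "S v = (\<Sum>c\<in>C. lam c * h v c ^ ?d)" for v
  define s where "s v = root ?d (S v)" for v
  have d: "?d > 0" using fin ne by (simp add: card_gt_0_iff)
  have S0: "S v \<ge> 0" if "v \<in> D" for v
    unfolding S_def using lam h that by (auto intro!: sum_nonneg)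
  have s0: "s v \<ge> 0" if "v \<in> D" for v using S0[OF that] d by (simp add: s_def)
  have sd: "s v ^ ?d = S v" if "v \<in> D" for v
    using S0[OF that] d by (simp add: s_def)
  show ?thesis
  proof (cases "\<exists>v\<in>D. s v = 0")
    case True
    then obtain v where v: "v \<in> D" "s v = 0" by blast
    then have "S v = 0" using sd[OF v(1)] d v(2) by (metis zero_power)
    then have z: "lam c * h v c ^ ?d = 0" if "c \<in> C" for c
      using that lam h v(1) finC unfolding S_def
      by (subst (asm) sum_nonneg_eq_0_iff) auto
    have "lam c * (\<Prod>v\<in>D. h v c) = 0" if "c \<in> C" for c
      using z[OF that] v(1) fin by (auto intro: prod_zero)
    then have "(\<Sum>c\<in>C. lam c * (\<Prod>v\<in>D. h v c)) = 0" by (intro sum.neutral) auto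
    also have "\<dots> \<le> (\<Prod>v\<in>D. s v)" using s0 by (intro prod_nonneg) auto
    finally show ?thesis by (simp add: s_def S_def)
  next
    case False
    then have pos: "s v > 0" if "v \<in> D" for v using s0[OF that] that by force
    have P: "(\<Prod>v\<in>D. s v) > 0" using pos by (intro prod_pos) auto
    have "(\<Sum>c\<in>C. lam c * (\<Prod>v\<in>D. h v c)) / (\<Prod>v\<in>D. s v)
        = (\<Sum>c\<in>C. lam c * (\<Prod>v\<in>D. h v c / s v))"
      by (simp add: sum_divide_distrib prod_dividef)
    also have "\<dots> \<le> (\<Sum>c\<in>C. lam c * ((\<Sum>v\<in>D. (h v c / s v) ^ ?d) / ?d))"
      using lam h pos fin ne
      by (intro sum_mono mult_left_mono prod_le_avg_power) (auto intro!: divide_nonneg_pos)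
    also have "\<dots> = (\<Sum>c\<in>C. \<Sum>v\<in>D. lam c * h v c ^ ?d / s v ^ ?d) / ?d"
      by (simp add: sum_divide_distrib sum_distrib_left power_divide)
    also have "\<dots> = (\<Sum>v\<in>D. \<Sum>c\<in>C. lam c * h v c ^ ?d / s v ^ ?d) / ?d"
      by (subst sum.swap) simp
    also have "\<dots> = (\<Sum>v\<in>D. 1) / ?d"
    proof -
      have "(\<Sum>c\<in>C. lam c * h v c ^ ?d / s v ^ ?d) = 1" if "v \<in> D" for v
      proof -
        have "S v > 0" using pos[OF that] sd[OF that] by (metis zero_less_power)
        then show ?thesis using sd[OF that] by (simp add: sum_divide_distrib[symmetric] S_def)
      qed
      then show ?thesis by simp
    qed
    also have "\<dots> = 1" using d by simp
    finally show ?thesis using P by (simp add: s_def S_def)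
  qed
qed

lemma sum_PiE_insert:
  fixes F :: "('u \<Rightarrow> 'c) \<Rightarrow> real"
  assumes "u \<notin> U"
  shows "(\<Sum>g\<in>insert u U \<rightarrow>\<^sub>E C. F g) = (\<Sum>g\<in>U \<rightarrow>\<^sub>E C. \<Sum>c\<in>C. F (g(u := c)))"
proof -
  have "(\<Sum>g\<in>insert u U \<rightarrow>\<^sub>E C. F g) = (\<Sum>p\<in>C \<times> (U \<rightarrow>\<^sub>E C). F ((\<lambda>(y, g). g(u := y)) p))"
    unfolding PiE_insert_eq by (subst sum.reindex[OF inj_combinator[OF assms]]) (simp add: o_def)
  also have "\<dots> = (\<Sum>c\<in>C. \<Sum>g\<in>U \<rightarrow>\<^sub>E C. F (g(u := c)))"
    by (simp add: sum.cartesian_product case_prod_beta)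
  also have "\<dots> = (\<Sum>g\<in>U \<rightarrow>\<^sub>E C. \<Sum>c\<in>C. F (g(u := c)))" by (rule sum.swap)
  finally show ?thesis .
qed

text \<open>One coordinate is summed out at a time, each step being Hoelder's inequality for the
  \<open>d\<close> factors that depend on it.\<close>

lemma Finner:
  fixes phi :: "'v \<Rightarrow> ('u \<Rightarrow> 'c) \<Rightarrow> real"
  assumes finU: "finite U" and finO: "finite Od" and finC: "finite C" and d: "d > 0"
    and lam: "\<And>c. c \<in> C \<Longrightarrow> lam c \<ge> (0::real)"
    and cov: "\<And>u. u \<in> U \<Longrightarrow> card {v\<in>Od. u \<in> S v} = d"
    and sub: "\<And>v. v \<in> Od \<Longrightarrow> S v \<subseteq> U"
    and phi: "\<And>v x. v \<in> Od \<Longrightarrow> x \<in> S v \<rightarrow>\<^sub>E C \<Longrightarrow> phi v x \<ge> 0"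
  shows "(\<Sum>g\<in>U \<rightarrow>\<^sub>E C. (\<Prod>u\<in>U. lam (g u)) * (\<Prod>v\<in>Od. phi v (restrict g (S v)))) \<le>
         (\<Prod>v\<in>Od. root d (\<Sum>x\<in>S v \<rightarrow>\<^sub>E C. (\<Prod>u\<in>S v. lam (x u)) * phi v x ^ d))"
  using finU cov sub phi
proof (induction U arbitrary: S phi rule: finite_induct)
  case empty
  have "S v = {}" if "v \<in> Od" for v using empty.prems(2)[OF that] by simp
  moreover have "phi v (\<lambda>_. undefined) \<ge> 0" if "v \<in> Od" for v
    using empty.prems(3)[OF that, of "\<lambda>_. undefined"] calculation[OF that] by simp
  ultimately show ?case using d by (simp add: real_root_power_cancel)
next
  case (insert u U)
  define D where "D = {v\<in>Od. u \<in> S v}"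
  have cD: "card D = d" using insert.prems(1)[of u] by (simp add: D_def)
  have finD: "finite D" using finO by (simp add: D_def)
  have neD: "D \<noteq> {}" using cD d by auto
  define S' where "S' v = S v - {u}" for v
  \<comment> \<open>\<open>phi'\<close> is the \<open>d\<close>-norm of \<open>phi v\<close> in the
    colour of \<open>u\<close>. Its \<open>d\<close>-th power restores the sum over that colour, so
    the induction hypothesis for \<open>S'\<close> and \<open>phi'\<close> has the wanted right hand
    side.\<close>
  define phi' where "phi' v x = (if u \<in> S v then root d (\<Sum>c\<in>C. lam c * phi v (x(u := c)) ^ d)
                                 else phi v x)" for v x
  have upd: "x(u := c) \<in> S v \<rightarrow>\<^sub>E C" if "x \<in> S' v \<rightarrow>\<^sub>E C" "c \<in> C" "u \<in> S v" for x c v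
    using that by (auto simp: S'_def PiE_iff extensional_def)
  have S'S: "S' v = S v" if "u \<notin> S v" for v using that by (simp add: S'_def)
  have nn: "(\<Sum>c\<in>C. lam c * phi v (x(u := c)) ^ d) \<ge> 0"
    if "v \<in> Od" "x \<in> S' v \<rightarrow>\<^sub>E C" "u \<in> S v" for v x
    using that lam insert.prems(3)[OF that(1) upd[OF that(2) _ that(3)]]
    by (intro sum_nonneg mult_nonneg_nonneg zero_le_power) (auto simp: fun_upd_def)
  have phi'0: "phi' v x \<ge> 0" if "v \<in> Od" "x \<in> S' v \<rightarrow>\<^sub>E C" for v x
    using that nn[OF that] insert.prems(3)[OF that(1), of x] d by (auto simp: phi'_def S'S)
  have IH: "(\<Sum>g\<in>U \<rightarrow>\<^sub>E C. (\<Prod>u\<in>U. lam (g u)) * (\<Prod>v\<in>Od. phi' v (restrict g (S' v)))) \<le>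
         (\<Prod>v\<in>Od. root d (\<Sum>x\<in>S' v \<rightarrow>\<^sub>E C. (\<Prod>u\<in>S' v. lam (x u)) * phi' v x ^ d))"
  proof (rule insert.IH)
    fix w assume w: "w \<in> U"
    then have "w \<noteq> u" using insert.hyps by auto
    then have "{v\<in>Od. w \<in> S' v} = {v\<in>Od. w \<in> S v}" by (auto simp: S'_def)
    then show "card {v\<in>Od. w \<in> S' v} = d" using insert.prems(1)[of w] w by simp
  next
    fix v assume "v \<in> Od" then show "S' v \<subseteq> U" using insert.prems(2)[of v] by (auto simp: S'_def)
  qed (rule phi'0)
  have step: "(\<Sum>c\<in>C. lam c * (\<Prod>v\<in>Od. phi v (restrict (g(u := c)) (S v))))
     \<le> (\<Prod>v\<in>Od. phi' v (restrict g (S' v)))" if g: "g \<in> U \<rightarrow>\<^sub>E C" for g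
  proof -
    have r: "restrict g (S' v) \<in> S' v \<rightarrow>\<^sub>E C" if "v \<in> Od" for v
      using g insert.prems(2)[OF that] by (auto simp: S'_def PiE_iff)
    have split: "(\<Prod>v\<in>Od. F v) = (\<Prod>v\<in>D. F v) * (\<Prod>v\<in>Od - D. F v)" for F :: "'v \<Rightarrow> real"
      using finO by (subst prod.subset_diff[of D Od]) (auto simp: D_def mult.commute)
    have e1: "restrict (g(u := c)) (S v) = (restrict g (S' v))(u := c)" if "v \<in> D" for v c
      using that by (auto simp: D_def S'_def restrict_def fun_eq_iff)
    have e2: "restrict (g(u := c)) (S v) = restrict g (S' v)" if "v \<in> Od - D" for v c
      using that by (auto simp: D_def S'_def restrict_def fun_eq_iff)
    let ?R = "\<Prod>v\<in>Od - D. phi' v (restrict g (S' v))"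
    have R: "?R \<ge> 0" using phi'0 r by (intro prod_nonneg) auto
    have "(\<Sum>c\<in>C. lam c * (\<Prod>v\<in>Od. phi v (restrict (g(u := c)) (S v))))
       = (\<Sum>c\<in>C. lam c * (\<Prod>v\<in>D. phi v ((restrict g (S' v))(u := c)))) * ?R"
    proof -
      have "(\<Prod>v\<in>Od - D. phi v (restrict (g(u := c)) (S v))) = ?R" for c
        by (intro prod.cong refl, subst e2) (auto simp: phi'_def D_def)
      moreover have "(\<Prod>v\<in>D. phi v (restrict (g(u := c)) (S v)))
          = (\<Prod>v\<in>D. phi v ((restrict g (S' v))(u := c)))" for c
        by (intro prod.cong refl) (simp add: e1)
      ultimately show ?thesis by (simp add: split sum_distrib_right mult.assoc)
    qed
    also have "\<dots> \<le> (\<Prod>v\<in>D. root (card D) (\<Sum>c\<in>C. lam c * phi v ((restrict g (S' v))(u := c)) ^ card D)) * ?R"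
    proof (rule mult_right_mono[OF _ R])
      show "(\<Sum>c\<in>C. lam c * (\<Prod>v\<in>D. phi v ((restrict g (S' v))(u := c))))
        \<le> (\<Prod>v\<in>D. root (card D) (\<Sum>c\<in>C. lam c * phi v ((restrict g (S' v))(u := c)) ^ card D))"
      proof (rule Hoelder_prod[OF finD neD finC lam])
        fix v c assume "v \<in> D" "c \<in> C"
        then show "phi v ((restrict g (S' v))(u := c)) \<ge> 0"
          using r[of v] by (intro insert.prems(3) upd) (auto simp: D_def)
      qed
    qed
    also have "\<dots> = (\<Prod>v\<in>D. phi' v (restrict g (S' v))) * ?R"
      by (intro arg_cong[where f="\<lambda>x. x * ?R"] prod.cong refl)
         (auto simp: phi'_def D_def cD[unfolded D_def])
    finally show ?thesis by (simp only: split)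
  qed
  have "(\<Sum>g\<in>insert u U \<rightarrow>\<^sub>E C. (\<Prod>u\<in>insert u U. lam (g u)) * (\<Prod>v\<in>Od. phi v (restrict g (S v))))
      = (\<Sum>g\<in>U \<rightarrow>\<^sub>E C. (\<Prod>w\<in>U. lam (g w)) *
           (\<Sum>c\<in>C. lam c * (\<Prod>v\<in>Od. phi v (restrict (g(u := c)) (S v)))))"
  proof -
    have "(\<Prod>w\<in>U. lam ((g(u := c)) w)) = (\<Prod>w\<in>U. lam (g w))" for g c
      using insert.hyps by (intro prod.cong) auto
    then show ?thesis
      using insert.hyps by (subst sum_PiE_insert) (auto simp: sum_distrib_left mult_ac intro!: sum.cong)
  qed
  also have "\<dots> \<le> (\<Sum>g\<in>U \<rightarrow>\<^sub>E C. (\<Prod>w\<in>U. lam (g w)) * (\<Prod>v\<in>Od. phi' v (restrict g (S' v))))"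
    using step lam by (intro sum_mono mult_left_mono prod_nonneg) (auto simp: PiE_iff)
  also note IH
  also have "(\<Prod>v\<in>Od. root d (\<Sum>x\<in>S' v \<rightarrow>\<^sub>E C. (\<Prod>u\<in>S' v. lam (x u)) * phi' v x ^ d))
     = (\<Prod>v\<in>Od. root d (\<Sum>x\<in>S v \<rightarrow>\<^sub>E C. (\<Prod>u\<in>S v. lam (x u)) * phi v x ^ d))"
  proof (intro prod.cong refl arg_cong[where f="root d"])
    fix v assume v: "v \<in> Od"
    show "(\<Sum>x\<in>S' v \<rightarrow>\<^sub>E C. (\<Prod>u\<in>S' v. lam (x u)) * phi' v x ^ d)
        = (\<Sum>x\<in>S v \<rightarrow>\<^sub>E C. (\<Prod>u\<in>S v. lam (x u)) * phi v x ^ d)"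
    proof (cases "u \<in> S v")
      case False then show ?thesis by (simp add: S'S phi'_def)
    next
      case True
      have Sv: "S v = insert u (S' v)" "u \<notin> S' v" using True by (auto simp: S'_def)
      have finS': "finite (S' v)"
        using insert.prems(2)[OF v] insert.hyps(1) by (auto simp: S'_def intro: finite_subset)
      have "(\<Sum>x\<in>S v \<rightarrow>\<^sub>E C. (\<Prod>u\<in>S v. lam (x u)) * phi v x ^ d)
         = (\<Sum>x\<in>S' v \<rightarrow>\<^sub>E C. \<Sum>c\<in>C. (\<Prod>w\<in>S v. lam ((x(u := c)) w)) * phi v (x(u := c)) ^ d)"
        unfolding Sv(1) by (rule sum_PiE_insert[OF Sv(2)])
      also have "\<dots> = (\<Sum>x\<in>S' v \<rightarrow>\<^sub>E C. (\<Prod>u\<in>S' v. lam (x u)) * phi' v x ^ d)"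
      proof (intro sum.cong refl)
        fix x assume x: "x \<in> S' v \<rightarrow>\<^sub>E C"
        have "(\<Prod>w\<in>S' v. lam ((x(u := c)) w)) = (\<Prod>w\<in>S' v. lam (x w))" for c
          using Sv(2) by (intro prod.cong) auto
        then have "(\<Prod>w\<in>S v. lam ((x(u := c)) w)) = lam c * (\<Prod>w\<in>S' v. lam (x w))" for c
          using Sv(2) finS' unfolding Sv(1) by simp
        moreover have "phi' v x ^ d = (\<Sum>c\<in>C. lam c * phi v (x(u := c)) ^ d)"
          using True d nn[OF v x True] by (simp add: phi'_def)
        ultimately show "(\<Sum>c\<in>C. (\<Prod>w\<in>S v. lam ((x(u := c)) w)) * phi v (x(u := c)) ^ d)
            = (\<Prod>u\<in>S' v. lam (x u)) * phi' v x ^ d"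
          by (simp add: sum_distrib_left mult_ac)
      qed
      finally show ?thesis by simp
    qed
  qed
  finally show ?case .
qed

section \<open>The gain from disagreeing neighbours\<close>

definition freq :: "'v set \<Rightarrow> ('v \<Rightarrow> bool) \<Rightarrow> real" where
  "freq D P = card {w\<in>D. P w} / card D"

lemma freq_eq_sum: "finite D \<Longrightarrow> freq D P = (\<Sum>w\<in>D. of_bool (P w)) / card D"
  by (simp add: freq_def Int_def)

lemma freq_nonneg: "freq D P \<ge> 0"
  by (simp add: freq_def)

lemma freq_le_1: "finite D \<Longrightarrow> freq D P \<le> 1"
  by (cases "card D = 0") (auto simp: freq_def divide_le_eq intro!: card_mono)

lemma freq_mono: "finite D \<Longrightarrow> (\<And>w. w \<in> D \<Longrightarrow> P w \<Longrightarrow> Q w) \<Longrightarrow> freq D P \<le> freq D Q"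
  unfolding freq_def by (intro divide_right_mono of_nat_mono card_mono) auto

lemma freq_add:
  assumes "finite D" "\<And>w. w \<in> D \<Longrightarrow> R w \<longleftrightarrow> P w \<or> Q w" "\<And>w. w \<in> D \<Longrightarrow> \<not> (P w \<and> Q w)"
  shows "freq D R = freq D P + freq D Q"
proof -
  have "(\<Sum>w\<in>D. of_bool (R w)) = (\<Sum>w\<in>D. of_bool (P w) + of_bool (Q w) :: real)"
    using assms by (intro sum.cong) auto
  then show ?thesis using assms(1) by (simp add: freq_eq_sum sum.distrib add_divide_distrib)
qed

lemma freq_union_le:
  assumes "finite D" "finite I" "\<And>w. w \<in> D \<Longrightarrow> P w \<Longrightarrow> \<exists>i\<in>I. Q i w"
  shows "freq D P \<le> (\<Sum>i\<in>I. freq D (Q i))"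
proof -
  have "(\<Sum>w\<in>D. of_bool (P w)) \<le> (\<Sum>w\<in>D. \<Sum>i\<in>I. of_bool (Q i w) :: real)"
  proof (intro sum_mono)
    fix w assume w: "w \<in> D"
    show "of_bool (P w) \<le> (\<Sum>i\<in>I. of_bool (Q i w) :: real)"
    proof (cases "P w")
      case True
      then obtain i where i: "i \<in> I" "Q i w" using assms(3) w by blast
      then have "(1::real) = of_bool (Q i w)" by simp
      also have "\<dots> \<le> (\<Sum>i\<in>I. of_bool (Q i w))"
        using i assms(2) by (intro member_le_sum) auto
      finally show ?thesis using True by simp
    qed (auto intro: sum_nonneg)
  qed
  also have "\<dots> = (\<Sum>i\<in>I. \<Sum>w\<in>D. of_bool (Q i w))" by (rule sum.swap)
  finally show ?thesis
    using assms(1) by (simp add: freq_eq_sum sum_divide_distrib[symmetric] divide_right_mono del: sum_of_bool_eq)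
qed

lemma freq_compl: "finite D \<Longrightarrow> D \<noteq> {} \<Longrightarrow> freq D (\<lambda>w. \<not> P w) = 1 - freq D P"
  using freq_add[of D "\<lambda>_. True" P "\<lambda>w. \<not> P w"] by (auto simp: freq_def[of _ "\<lambda>_. True"])

text \<open>The chord over \<open>[0, \<delta>]\<close> falls by at least one half, so the rate
  obtained depends on \<open>\<delta>\<close> but not on \<open>\<tau>\<close>. This allows
  \<open>\<delta>\<close> to be fixed before \<open>\<tau>\<close> grows.\<close>

lemma exp_le_chord:
  fixes p :: real
  assumes "0 \<le> p" "p \<le> \<delta>" "\<delta> > 0" "exp (- \<tau> * \<delta>) \<le> 1 / 2"
  shows "exp (- \<tau> * p) \<le> 1 - p / (2 * \<delta>)"
proof -
  let ?t = "p / \<delta>"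
  have t: "0 \<le> ?t" "?t \<le> 1" using assms by auto
  have "exp ((1 - ?t) *\<^sub>R 0 + ?t *\<^sub>R (- \<tau> * \<delta>)) \<le> (1 - ?t) * exp 0 + ?t * exp (- \<tau> * \<delta>)"
    using t by (intro convex_onD[OF exp_convex]) auto
  also have "\<dots> \<le> (1 - ?t) + ?t * (1 / 2)"
    using mult_left_mono[OF assms(4) t(1)] by simp
  also have "\<dots> = 1 - p / (2 * \<delta>)" by simp
  also have "(1 - ?t) *\<^sub>R 0 + ?t *\<^sub>R (- \<tau> * \<delta>) = - \<tau> * p" using assms(3) by simp
  finally show ?thesis .
qed

text \<open>The entropy gained at a vertex whose neighbours carry different colour sets.
  Letting \<open>\<tau>\<close> tend to infinity turns the left hand side into the weight of the intersection of the
  \<open>A w\<close>, which is smaller than the geometric mean of their weights unless they all agree. If a single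
  set is dominant, the chord bound on \<open>exp\<close> makes the loss on the left beat the loss on the right;
  otherwise the intersection is replaced by the colours missing from few of the \<open>A w\<close>.\<close>

lemma interface_gain:
  fixes C :: "'c set" and lam :: "'c \<Rightarrow> real" and Lam :: "'c set \<Rightarrow> real"
  assumes finC: "finite C" and neC: "C \<noteq> {}" and lam: "\<And>c. c \<in> C \<Longrightarrow> lam c > 0"
    and Lam: "\<And>A. A \<subseteq> C \<Longrightarrow> A \<noteq> {} \<Longrightarrow> Lam A = sum lam A"
    and Lam0: "Lam {} > 0" "\<And>c. c \<in> C \<Longrightarrow> Lam {} < lam c"
  obtains \<kappa> C0 \<tau>0 :: real where "\<kappa> > 0" "C0 \<ge> 0"
    "\<And>\<tau> (D :: 'v set) A. \<tau> \<ge> \<tau>0 \<Longrightarrow> finite D \<Longrightarrow> D \<noteq> {} \<Longrightarrow> (\<And>w. w \<in> D \<Longrightarrow> A w \<subseteq> C) \<Longrightarrow>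
       (\<Sum>a\<in>C. lam a * exp (- \<tau> * freq D (\<lambda>w. a \<notin> A w)))
       \<le> exp ((\<Sum>w\<in>D. ln (Lam (A w))) / card D
              - \<kappa> * freq (D \<times> D) (\<lambda>(w, w'). A w \<noteq> A w') + C0 * exp (- \<tau> / 2))"
proof -
  define l where "l = Min (lam ` C)"
  define T where "T = sum lam C"
  have l: "l > 0" "\<And>c. c \<in> C \<Longrightarrow> l \<le> lam c"
    using finC neC lam by (auto simp: l_def)
  obtain c0 where c0: "c0 \<in> C" using neC by blast
  have lT: "l \<le> T"
  proof -
    have "l \<le> lam c0" using l(2) c0 .
    also have "\<dots> \<le> T" unfolding T_def using c0 finC lam by (intro member_le_sum) (auto intro: less_imp_le)
    finally show ?thesis .
  qed
  have T: "T > 0" using l lT by simp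
  have fin: "finite A" if "A \<subseteq> C" for A using that finC by (rule finite_subset)
  have strict: "Lam A < Lam B" if AB: "A \<subset> B" "B \<subseteq> C" for A B
  proof (cases "A = {}")
    case True
    then obtain b where b: "b \<in> B" using AB by auto
    have "Lam {} < lam b" using b that Lam0 by blast
    also have "lam b \<le> sum lam B"
      using b that fin[OF that(2)] lam by (intro member_le_sum) (auto intro: less_imp_le)
    finally show ?thesis using True that Lam[of B] by auto
  next
    case False
    have "sum lam A < sum lam B"
    proof -
      obtain b where b: "b \<in> B" "b \<notin> A" using AB by blast
      show ?thesis using that b lam fin[OF that(2)]
        by (intro sum_strict_mono2[of B A b]) (auto intro: less_imp_le)
    qed
    moreover have "A \<subseteq> C" "B \<noteq> {}" using AB by auto
    ultimately show ?thesis using False AB(2) Lam[of A] Lam[of B] by simp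
  qed
  have Lpos: "Lam A \<ge> Lam {}" if "A \<subseteq> C" for A
    using strict[of "{}" A] that by (cases "A = {}") (simp_all add: psubset_eq less_imp_le)
  have Lpos': "Lam A > 0" if "A \<subseteq> C" for A using Lpos[OF that] Lam0(1) by simp
  have sumLam: "sum lam A \<le> Lam A" if "A \<subseteq> C" for A
    using Lam[of A] that Lam0 by (cases "A = {}") auto
  have sumT: "sum lam A \<le> T" if "A \<subseteq> C" for A
    unfolding T_def using that finC lam by (intro sum_mono2) (auto intro: less_imp_le)
  have LamT: "Lam A \<le> T" if "A \<subseteq> C" for A
  proof (cases "A = {}")
    case True
    have "Lam {} < lam c0" using Lam0 c0 by simp
    also have "\<dots> \<le> T" unfolding T_def using c0 finC lam by (intro member_le_sum) (auto intro: less_imp_le)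
    finally show ?thesis using True by simp
  next
    case False then show ?thesis using Lam[of A] that sumT by simp
  qed
  \<comment> \<open>The least increase of \<open>ln Lam\<close> along a strict inclusion; the
    hypotheses on \<open>Lam {}\<close> make it positive for the empty set as well.\<close>
  obtain \<gamma> where \<gamma>: "\<gamma> > 0" "\<And>A B. A \<subset> B \<Longrightarrow> B \<subseteq> C \<Longrightarrow> ln (Lam B) - ln (Lam A) \<ge> \<gamma>"
  proof -
    define G where "G = (\<lambda>(A, B). ln (Lam B) - ln (Lam A)) ` {(A, B). A \<subset> B \<and> B \<subseteq> C}"
    have "{(A, B). A \<subset> B \<and> B \<subseteq> C} \<subseteq> Pow C \<times> Pow C" by auto
    then have fG: "finite G" unfolding G_def using finC by (intro finite_imageI finite_subset[of "{(A, B). A \<subset> B \<and> B \<subseteq> C}" "Pow C \<times> Pow C"]) auto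
    have "x > 0" if xG: "x \<in> G" for x
    proof -
      obtain A B where AB: "A \<subset> B" "B \<subseteq> C" "x = ln (Lam B) - ln (Lam A)"
        using xG by (auto simp: G_def)
      then show ?thesis using strict[OF AB(1,2)] Lpos'[of A] by (simp add: psubset_imp_subset)
    qed
    then have "Min (insert 1 G) > 0" using fG by (subst Min_gr_iff) auto
    moreover have "ln (Lam B) - ln (Lam A) \<ge> Min (insert 1 G)" if "A \<subset> B" "B \<subseteq> C" for A B
      using fG that by (intro Min_le) (auto simp: G_def)
    ultimately show ?thesis using that by blast
  qed
  define M where "M = ln T - ln (Lam {})"
  have M: "ln (Lam A) - ln (Lam B) \<le> M" if "A \<subseteq> C" "B \<subseteq> C" for A B
    using LamT[OF that(1)] Lpos[OF that(2)] Lpos'[OF that(1)] Lam0(1) T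
    unfolding M_def by (intro diff_mono) auto
  have M0: "M \<ge> 0" using M[of "{}" "{}"] by simp
  \<comment> \<open>Small enough that the chord rate \<open>l / (2 * \<delta> * T)\<close> covers,
    for every set not containing the dominant \<open>B\<close>, both its deficit \<open>M\<close> in
    the average of logarithms and the disagreement it causes.\<close>
  define \<delta> where "\<delta> = min (1/2) (l / (2 * T * (M + \<gamma>)))"
  have \<delta>: "\<delta> > 0" "\<delta> \<le> 1/2"
    using l T M0 \<gamma>(1) unfolding \<delta>_def by (simp, intro min.cobounded1)
  have \<delta>M: "M + \<gamma> \<le> l / (2 * \<delta> * T)"
  proof -
    have "\<delta> \<le> l / (2 * T * (M + \<gamma>))" by (simp add: \<delta>_def)
    then have "\<delta> * (2 * T * (M + \<gamma>)) \<le> l"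
      using T M0 \<gamma>(1) by (subst (asm) pos_le_divide_eq) auto
    then show ?thesis using \<delta>(1) T by (subst pos_le_divide_eq) (auto simp: mult_ac)
  qed
  define k where "k = real (card C)"
  have k: "k \<ge> 1" using finC neC by (simp add: k_def Suc_leI card_gt_0_iff)
  \<comment> \<open>Solves
    \<open>(\<gamma> + M) * (k * \<delta>2) = \<gamma> * \<delta> / 2\<close>: in the case without a
    dominant set, ignoring rarely missing colours costs at most half of the gain
    \<open>\<gamma> * \<delta>\<close>.\<close>
  define \<delta>2 where "\<delta>2 = \<gamma> * \<delta> / (2 * (\<gamma> + M) * k)"
  have \<delta>2: "\<delta>2 > 0" using \<gamma> \<delta> M0 k by (simp add: \<delta>2_def)
  define \<kappa> where "\<kappa> = \<gamma> * \<delta> / 4"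
  have \<kappa>: "\<kappa> > 0" "2 * \<kappa> \<le> \<gamma>" using \<gamma>(1) \<delta> by (simp_all add: \<kappa>_def)
  define C0 where "C0 = 2 * T / Lam {}"
  have C0: "C0 \<ge> 0" using T Lam0 by (simp add: C0_def)
  \<comment> \<open>The entries secure \<open>\<tau> \<ge> 0\<close>, the hypothesis of the chord
    bound, and that colours missing with frequency at least \<open>\<delta>2\<close> add at most a
    fraction \<open>\<kappa>\<close>.\<close>
  define \<tau>0 where "\<tau>0 = max 0 (max (ln 2 / \<delta>) (ln (T / (\<kappa> * Lam {})) / \<delta>2))"
  have main: "(\<Sum>a\<in>C. lam a * exp (- \<tau> * freq D (\<lambda>w. a \<notin> A w)))
       \<le> exp ((\<Sum>w\<in>D. ln (Lam (A w))) / card D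
              - \<kappa> * freq (D \<times> D) (\<lambda>(w, w'). A w \<noteq> A w') + C0 * exp (- \<tau> / 2))"
    if \<tau>: "\<tau> \<ge> \<tau>0" and D: "finite D" "D \<noteq> {}" and A: "\<And>w. w \<in> D \<Longrightarrow> A w \<subseteq> C"
    for \<tau> and D :: "'v set" and A
  proof -
    define p where "p a = freq D (\<lambda>w. a \<notin> A w)" for a
    define avg where "avg = (\<Sum>w\<in>D. ln (Lam (A w))) / card D"
    define dis where "dis = freq (D \<times> D) (\<lambda>(w, w'). A w \<noteq> A w')"
    have cD: "card D > 0" using D by (simp add: card_gt_0_iff)
    have \<tau>': "\<tau> \<ge> 0" "exp (- \<tau> * \<delta>) \<le> 1 / 2" "T / Lam {} * exp (- \<tau> * \<delta>2) \<le> \<kappa>"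
    proof -
      show "\<tau> \<ge> 0" using \<tau> by (simp add: \<tau>0_def)
      have "ln 2 / \<delta> \<le> \<tau>" using \<tau> by (simp add: \<tau>0_def)
      then have "ln 2 \<le> \<tau> * \<delta>" using \<delta> by (simp add: field_simps)
      then have "exp (- \<tau> * \<delta>) \<le> exp (- ln 2)" by simp
      then show "exp (- \<tau> * \<delta>) \<le> 1 / 2" by (simp add: exp_minus)
      have "ln (T / (\<kappa> * Lam {})) / \<delta>2 \<le> \<tau>" using \<tau> by (simp add: \<tau>0_def)
      then have "ln (T / (\<kappa> * Lam {})) \<le> \<tau> * \<delta>2" using \<delta>2 by (simp add: field_simps)
      then have "exp (ln (T / (\<kappa> * Lam {}))) \<le> exp (\<tau> * \<delta>2)" by (subst exp_le_cancel_iff)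
      then have "T / (\<kappa> * Lam {}) \<le> exp (\<tau> * \<delta>2)" using T \<kappa> Lam0 by simp
      then show "T / Lam {} * exp (- \<tau> * \<delta>2) \<le> \<kappa>"
        using \<kappa> Lam0 by (simp add: exp_minus field_simps)
    qed
    have p: "0 \<le> p a" "p a \<le> 1" for a using D by (auto simp: p_def freq_nonneg freq_le_1)
    have lower: "avg \<ge> ln (Lam B) - M * freq D (\<lambda>w. \<not> B \<subseteq> A w) + \<gamma> * freq D (\<lambda>w. B \<subset> A w)"
      if B: "B \<subseteq> C" for B
    proof -
      have "(\<Sum>w\<in>D. ln (Lam B) - M * of_bool (\<not> B \<subseteq> A w) + \<gamma> * of_bool (B \<subset> A w))
         \<le> (\<Sum>w\<in>D. ln (Lam (A w)))"
      proof (intro sum_mono)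
        fix w assume w: "w \<in> D"
        show "ln (Lam B) - M * of_bool (\<not> B \<subseteq> A w) + \<gamma> * of_bool (B \<subset> A w) \<le> ln (Lam (A w))"
          using \<gamma>(2)[of B "A w"] M[OF B A[OF w]] A[OF w] by (cases "B \<subseteq> A w"; cases "B = A w") (simp_all add: psubset_eq)
      qed
      then have "((\<Sum>w\<in>D. ln (Lam B)) - M * (\<Sum>w\<in>D. of_bool (\<not> B \<subseteq> A w))
           + \<gamma> * (\<Sum>w\<in>D. of_bool (B \<subset> A w))) / card D \<le> avg"
        unfolding avg_def by (intro divide_right_mono) (auto simp: sum.distrib sum_subtractf sum_distrib_left)
      then show ?thesis using cD D by (simp add: freq_eq_sum add_divide_distrib diff_divide_distrib del: sum_of_bool_eq)
    qed
    have Lexp: "Lam B = exp (ln (Lam B))" if "B \<subseteq> C" for B using Lpos'[OF that] by simp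
    have ratio: "T \<le> Lam B * (T / Lam {})" if "B \<subseteq> C" for B
      using Lpos[OF that] Lam0 T by (simp add: field_simps)
    have split: "(\<Sum>a\<in>C. F a) = (\<Sum>a\<in>B. F a) + (\<Sum>a\<in>C - B. F a)" if "B \<subseteq> C" for B and F :: "'c \<Rightarrow> real"
      using that finC by (metis add.commute sum.subset_diff)
    have "(\<Sum>a\<in>C. lam a * exp (- \<tau> * p a)) \<le> exp (avg - \<kappa> * dis + C0 * exp (- \<tau> / 2))"
    proof (cases "\<exists>B\<subseteq>C. freq D (\<lambda>w. A w \<noteq> B) \<le> \<delta>")
      case True
      then obtain B where B: "B \<subseteq> C" "freq D (\<lambda>w. A w \<noteq> B) \<le> \<delta>" by blast
      define P where "P = freq D (\<lambda>w. \<not> B \<subseteq> A w)"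
      define Q where "Q = freq D (\<lambda>w. B \<subset> A w)"
      have PQ: "freq D (\<lambda>w. A w \<noteq> B) = P + Q"
        unfolding P_def Q_def using D by (intro freq_add) auto
      have P0: "P \<ge> 0" "Q \<ge> 0" by (simp_all add: P_def Q_def freq_nonneg)
      have dis: "dis \<le> 2 * (P + Q)"
      proof -
        have "dis \<le> (\<Sum>b\<in>{True, False}. freq (D \<times> D) (\<lambda>(w, w'). (if b then A w else A w') \<noteq> B))"
          unfolding dis_def using D by (intro freq_union_le) auto
        moreover have "{p \<in> D \<times> D. case p of (w, w') \<Rightarrow> A w \<noteq> B} = {w\<in>D. A w \<noteq> B} \<times> D"
          "{p \<in> D \<times> D. case p of (w, w') \<Rightarrow> A w' \<noteq> B} = D \<times> {w\<in>D. A w \<noteq> B}" by auto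
        then have "freq (D \<times> D) (\<lambda>(w, w'). A w \<noteq> B) = P + Q" "freq (D \<times> D) (\<lambda>(w, w'). A w' \<noteq> B) = P + Q"
          using cD by (auto simp: PQ[symmetric] freq_def card_cartesian_product)
        ultimately show ?thesis by simp
      qed
      have pB: "p a \<le> \<delta>" if "a \<in> B" for a
        using that D B(2) unfolding p_def by (intro order.trans[OF freq_mono B(2)]) auto
      have pnB: "p a \<ge> 1 / 2" if "a \<notin> B" for a
      proof -
        have "p a \<ge> freq D (\<lambda>w. \<not> (A w \<noteq> B))" unfolding p_def using that D by (intro freq_mono) auto
        then show ?thesis using B(2) \<delta>(2) D by (simp add: freq_compl del: not_not)
      qed
      define L where "L = l / (2 * \<delta> * T)"
      have L: "L \<ge> M + \<gamma>" "L \<ge> 0" using \<delta>M M0 \<gamma> by (auto simp: L_def)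
      have LP: "L * P \<le> 1 / 2"
      proof -
        have "L * P \<le> L * \<delta>" using L(2) B(2) PQ P0 by (intro mult_left_mono) auto
        also have "\<dots> = l / (2 * T)" using \<delta> by (simp add: L_def)
        also have "\<dots> \<le> 1 / 2" using lT T by simp
        finally show ?thesis .
      qed
      have s1: "(\<Sum>a\<in>B. lam a * exp (- \<tau> * p a)) \<le> Lam B * exp (- L * P)"
      proof (cases "B = {}")
        case True then show ?thesis using Lam0 by simp
      next
        case False
        have PB: "P \<le> (\<Sum>a\<in>B. p a)"
          unfolding P_def p_def using D fin[OF B(1)] by (intro freq_union_le) auto
        have "(\<Sum>a\<in>B. lam a * exp (- \<tau> * p a)) \<le> (\<Sum>a\<in>B. lam a * (1 - p a / (2 * \<delta>)))"
          using B lam p pB \<delta> \<tau>'(2)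
          by (intro sum_mono mult_left_mono exp_le_chord) (auto intro: less_imp_le)
        also have "\<dots> = sum lam B - (\<Sum>a\<in>B. lam a * p a) / (2 * \<delta>)"
          by (simp add: right_diff_distrib sum_subtractf sum_divide_distrib)
        also have "\<dots> \<le> sum lam B - (\<Sum>a\<in>B. l * p a) / (2 * \<delta>)"
          using l B p \<delta> by (intro diff_left_mono divide_right_mono sum_mono mult_right_mono) auto
        also have "\<dots> \<le> sum lam B - l * P / (2 * \<delta>)"
          using PB l \<delta> by (auto simp: sum_distrib_left[symmetric] intro!: divide_right_mono)
        also have "\<dots> \<le> Lam B - Lam B * L * P"
        proof -
          have "Lam B * (L * P) \<le> T * (L * P)"
            using LamT[OF B(1)] L P0 by (intro mult_right_mono) auto
          also have "\<dots> = l * P / (2 * \<delta>)" using T by (simp add: L_def)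
          finally show ?thesis using Lam[OF B(1) False] by (simp add: mult.assoc)
        qed
        also have "\<dots> = Lam B * (1 + (- L * P))" by (simp add: algebra_simps)
        also have "\<dots> \<le> Lam B * exp (- L * P)"
          using Lpos'[OF B(1)] by (intro mult_left_mono exp_ge_add_one_self) auto
        finally show ?thesis .
      qed
      \<comment> \<open>A colour outside \<open>B\<close> is missing from at least half of the sets
        since \<open>\<delta> \<le> 1 / 2\<close>. The factor two in \<open>C0\<close> compensates
        for \<open>exp (- L * P)\<close>, which is at least one half.\<close>
      have s2: "(\<Sum>a\<in>C - B. lam a * exp (- \<tau> * p a)) \<le> Lam B * exp (- L * P) * (C0 * exp (- \<tau> / 2))"
      proof -
        have "(\<Sum>a\<in>C - B. lam a * exp (- \<tau> * p a)) \<le> (\<Sum>a\<in>C - B. lam a * exp (- \<tau> / 2))"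
        proof (intro sum_mono mult_left_mono)
          fix a assume a: "a \<in> C - B"
          then show "0 \<le> lam a" using lam[of a] by auto
          show "exp (- \<tau> * p a) \<le> exp (- \<tau> / 2)"
            using mult_left_mono[OF pnB \<tau>'(1), of a] a by simp
        qed
        also have "\<dots> \<le> T * exp (- \<tau> / 2)"
          using sumT[of "C - B"] by (auto simp: sum_distrib_right[symmetric])
        also have "T \<le> Lam B * exp (- L * P) * C0"
        proof -
          have "1 / 2 \<le> exp (- L * P)"
            using exp_ge_add_one_self[of "- L * P"] LP by linarith
          then have "1 \<le> 2 * exp (- L * P)" by simp
          then have "Lam B * (T / Lam {}) * 1 \<le> Lam B * (T / Lam {}) * (2 * exp (- L * P))"
            using Lpos'[OF B(1)] T Lam0 by (intro mult_left_mono) auto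
          then show ?thesis using ratio[OF B(1)] by (simp add: C0_def mult_ac)
        qed
        finally show ?thesis by (simp add: mult.assoc mult_right_mono)
      qed
      have "(\<Sum>a\<in>C. lam a * exp (- \<tau> * p a)) \<le> Lam B * exp (- L * P) * (1 + C0 * exp (- \<tau> / 2))"
        using s1 s2 unfolding split[OF B(1)] by (simp add: algebra_simps)
      also have "\<dots> \<le> Lam B * exp (- L * P) * exp (C0 * exp (- \<tau> / 2))"
        using Lpos'[OF B(1)] by (intro mult_left_mono exp_ge_add_one_self) auto
      also have "\<dots> = exp (ln (Lam B) - L * P + C0 * exp (- \<tau> / 2))"
        by (subst Lexp[OF B(1)]) (simp add: mult_exp_exp)
      also have "\<dots> \<le> exp (avg - \<kappa> * dis + C0 * exp (- \<tau> / 2))"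
      proof -
        have "\<kappa> * dis \<le> \<kappa> * (2 * (P + Q))" using dis \<kappa> by (intro mult_left_mono) auto
        also have "\<dots> \<le> \<gamma> * (P + Q)" using mult_right_mono[OF \<kappa>(2), of "P + Q"] P0 by (simp add: algebra_simps)
        also have "\<dots> \<le> (L - M) * P + \<gamma> * Q"
          using mult_right_mono[of \<gamma> "L - M" P] L P0 by (simp add: algebra_simps)
        finally show ?thesis using lower[OF B(1)] by (simp add: P_def Q_def algebra_simps)
      qed
      finally show ?thesis .
    next
      case False
      \<comment> \<open>As no set is dominant, \<open>A w\<close> differs from this \<open>B\<close>
        with frequency above \<open>\<delta>\<close>, yet it fails to contain \<open>B\<close> with
        frequency at most \<open>k * \<delta>2\<close>. Frequent strict supersets thus lift the
        average of logarithms by \<open>2 * \<kappa>\<close>: one \<open>\<kappa>\<close> pays for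
        the colours outside \<open>B\<close>, the other for the disagreement.\<close>
      define B where "B = {a\<in>C. p a < \<delta>2}"
      have B: "B \<subseteq> C" by (auto simp: B_def)
      define P where "P = freq D (\<lambda>w. \<not> B \<subseteq> A w)"
      define Q where "Q = freq D (\<lambda>w. B \<subset> A w)"
      have PQ: "freq D (\<lambda>w. A w \<noteq> B) = P + Q"
        unfolding P_def Q_def using D by (intro freq_add) auto
      have PQ': "P + Q > \<delta>" using False B PQ by auto
      have P: "P \<le> k * \<delta>2"
      proof -
        have "P \<le> (\<Sum>a\<in>B. p a)"
          unfolding P_def p_def using D fin[OF B] by (intro freq_union_le) auto
        also have "\<dots> \<le> (\<Sum>a\<in>B. \<delta>2)" by (intro sum_mono) (auto simp: B_def)
        also have "\<dots> \<le> k * \<delta>2"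
          using card_mono[OF finC B] \<delta>2 by (simp add: k_def)
        finally show ?thesis .
      qed
      have "(\<gamma> + M) * P \<le> \<gamma> * \<delta> / 2"
      proof -
        have 1: "(\<gamma> + M) * P \<le> (\<gamma> + M) * (k * \<delta>2)" using P \<gamma> M0 by (intro mult_left_mono) auto
        have q: "s * (k * (x / (2 * s * k))) = x / 2" if "s > 0" for s x
          using k that by (simp add: field_simps)
        have "(\<gamma> + M) * (k * \<delta>2) = \<gamma> * \<delta> / 2"
          unfolding \<delta>2_def by (rule q) (use \<gamma>(1) M0 in simp)
        with 1 show ?thesis by simp
      qed
      moreover have "\<gamma> * \<delta> \<le> \<gamma> * (P + Q)" using PQ' \<gamma> by (intro mult_left_mono) auto
      ultimately have low: "avg \<ge> ln (Lam B) + 2 * \<kappa>"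
        using lower[OF B] by (simp add: P_def Q_def \<kappa>_def algebra_simps)
      have dis1: "dis \<le> 1" unfolding dis_def using D by (intro freq_le_1) auto
      have "(\<Sum>a\<in>B. lam a * exp (- \<tau> * p a)) \<le> (\<Sum>a\<in>B. lam a * 1)"
        using B lam \<tau>' p by (intro sum_mono mult_left_mono) (auto intro: less_imp_le)
      then have s1: "(\<Sum>a\<in>B. lam a * exp (- \<tau> * p a)) \<le> Lam B" using sumLam[OF B] by simp
      have s2: "(\<Sum>a\<in>C - B. lam a * exp (- \<tau> * p a)) \<le> Lam B * \<kappa>"
      proof -
        have "(\<Sum>a\<in>C - B. lam a * exp (- \<tau> * p a)) \<le> (\<Sum>a\<in>C - B. lam a * exp (- \<tau> * \<delta>2))"
        proof (intro sum_mono mult_left_mono)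
          fix a assume a: "a \<in> C - B"
          then show "0 \<le> lam a" using lam[of a] by auto
          have "\<delta>2 \<le> p a" using a by (auto simp: B_def)
          then show "exp (- \<tau> * p a) \<le> exp (- \<tau> * \<delta>2)"
            using mult_left_mono[OF _ \<tau>'(1), of \<delta>2 "p a"] by simp
        qed
        also have "\<dots> \<le> T * exp (- \<tau> * \<delta>2)"
          using sumT[of "C - B"] by (auto simp: sum_distrib_right[symmetric])
        also have "\<dots> \<le> Lam B * (T / Lam {}) * exp (- \<tau> * \<delta>2)"
          using ratio[OF B] by (intro mult_right_mono) auto
        also have "\<dots> \<le> Lam B * \<kappa>"
          using \<tau>'(3) Lpos'[OF B] unfolding mult.assoc by (intro mult_left_mono) auto
        finally show ?thesis .
      qed
      have "(\<Sum>a\<in>C. lam a * exp (- \<tau> * p a)) \<le> Lam B * (1 + \<kappa>)"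
        using s1 s2 unfolding split[OF B] by (simp add: algebra_simps)
      also have "\<dots> \<le> Lam B * exp \<kappa>"
        using Lpos'[OF B] by (intro mult_left_mono exp_ge_add_one_self) auto
      also have "\<dots> = exp (ln (Lam B) + \<kappa>)" using Lpos'[OF B] by (simp add: exp_add)
      also have "\<dots> \<le> exp (avg - \<kappa> * dis + C0 * exp (- \<tau> / 2))"
      proof -
        have "\<kappa> * dis \<le> \<kappa>" using dis1 \<kappa> by (simp add: mult_left_le)
        moreover have "C0 * exp (- \<tau> / 2) \<ge> 0" using C0 by simp
        ultimately show ?thesis using low by simp
      qed
      finally show ?thesis .
    qed
    then show ?thesis by (simp add: p_def avg_def dis_def)
  qed
  show ?thesis by (rule that[OF \<kappa>(1) C0]) (rule main)
qed

section \<open>Spin systems on regular bipartite graphs\<close>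

lemma sum_PiE_union:
  fixes F :: "('u \<Rightarrow> 'c) \<Rightarrow> real"
  assumes "X \<inter> Y = {}"
  shows "(\<Sum>g\<in>X \<union> Y \<rightarrow>\<^sub>E C. F g) =
         (\<Sum>g\<in>X \<rightarrow>\<^sub>E C. \<Sum>h\<in>Y \<rightarrow>\<^sub>E C. F (\<lambda>x. if x \<in> X then g x else h x))"
proof -
  have "(\<Sum>g\<in>X \<union> Y \<rightarrow>\<^sub>E C. F g) =
        (\<Sum>(g, h)\<in>(X \<rightarrow>\<^sub>E C) \<times> (Y \<rightarrow>\<^sub>E C). F (\<lambda>x. if x \<in> X then g x else h x))"
  proof (rule sum.reindex_bij_witness[where
        i = "\<lambda>(g, h). \<lambda>x. if x \<in> X then g x else h x" and j = "\<lambda>g. (restrict g X, restrict g Y)"], goal_cases)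
    case (1 a) then show ?case using assms by (auto simp: fun_eq_iff PiE_iff extensional_def)
  next
    case (2 a) then show ?case by (auto simp: PiE_iff)
  next
    case (3 b) then show ?case using assms by (auto simp: fun_eq_iff PiE_iff extensional_def)
  next
    case (4 b) then show ?case using assms by (auto simp: PiE_iff extensional_def)
  next
    case (5 a)
    then have "(\<lambda>x. if x \<in> X then restrict a X x else restrict a Y x) = a"
      by (auto simp: fun_eq_iff PiE_iff extensional_def)
    then show ?case by simp
  qed
  also have "\<dots> = (\<Sum>g\<in>X \<rightarrow>\<^sub>E C. \<Sum>h\<in>Y \<rightarrow>\<^sub>E C. F (\<lambda>x. if x \<in> X then g x else h x))"
    by (rule sum.cartesian_product[symmetric])
  finally show ?thesis .
qed

lemma sum_PiE_prod_const:
  fixes lam :: "'c \<Rightarrow> real"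
  assumes "finite S" "finite A"
  shows "(\<Sum>x\<in>S \<rightarrow>\<^sub>E A. \<Prod>u\<in>S. lam (x u)) = sum lam A ^ card S"
proof -
  have "(\<Prod>u\<in>S. \<Sum>a\<in>A. lam a) = (\<Sum>x\<in>S \<rightarrow>\<^sub>E A. \<Prod>u\<in>S. lam (x u))"
    using assms by (intro prod_sum_PiE) auto
  then show ?thesis by simp
qed

section \<open>Concentration of colour frequencies under product weights\<close>

lemma exp_le_quadratic:
  fixes s :: real
  assumes "\<bar>s\<bar> \<le> 1"
  shows "exp s \<le> 1 + s + s\<^sup>2"
proof (cases "s \<ge> 0")
  case True then show ?thesis using exp_bound[of s] assms by simp
next
  case False
  define r where "r = - s"
  have r: "0 \<le> r" "r \<le> 1" using False assms by (auto simp: r_def)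
  have "1 \<le> (1 + r) * (1 - r + r\<^sup>2)"
    using r by (simp add: algebra_simps power2_eq_square)
  also have "\<dots> \<le> exp r * (1 - r + r\<^sup>2)"
    using r by (intro mult_right_mono exp_ge_add_one_self) (auto simp: add_nonneg_nonneg)
  finally have "exp (- r) \<le> 1 - r + r\<^sup>2" by (simp add: exp_minus field_simps)
  then show ?thesis by (simp add: r_def)
qed

text \<open>After division by \<open>sum lam A ^ card S\<close> the entries of \<open>x\<close> are
  independent with law \<open>lam / sum lam A\<close>. An exponential tilt by \<open>s\<close> costs
  \<open>s ^ 2\<close> per coordinate and gains \<open>s * \<epsilon>\<close>, which is best at
  \<open>s = \<epsilon> / 2\<close>; the two signs give the factor two.\<close>

lemma Chernoff_weighted:
  fixes lam :: "'c \<Rightarrow> real"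
  assumes S: "finite S" "S \<noteq> {}" and A: "finite A" "a \<in> A" and lam: "\<And>c. c \<in> A \<Longrightarrow> lam c > 0"
    and \<epsilon>: "0 < \<epsilon>" "\<epsilon> \<le> 1"
  shows "(\<Sum>x | x \<in> S \<rightarrow>\<^sub>E A \<and> \<epsilon> < \<bar>freq S (\<lambda>u. x u = a) - lam a / sum lam A\<bar>. \<Prod>u\<in>S. lam (x u))
           \<le> 2 * sum lam A ^ card S * exp (- \<epsilon>\<^sup>2 / 4 * card S)"
proof -
  define L where "L = sum lam A"
  define q where "q = lam a / L"
  have L: "L > 0" unfolding L_def using A lam by (intro sum_pos) auto
  have q: "0 \<le> q" "q \<le> 1"
  proof -
    have "lam a \<le> L" unfolding L_def using A lam by (intro member_le_sum) (auto intro: less_imp_le)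
    then show "0 \<le> q" "q \<le> 1" using L lam[OF A(2)] by (auto simp: q_def)
  qed
  have cS: "card S > 0" using S by (simp add: card_gt_0_iff)
  have mgf: "(\<Sum>x\<in>S \<rightarrow>\<^sub>E A. (\<Prod>u\<in>S. lam (x u)) * exp (s * card S * (freq S (\<lambda>u. x u = a) - q)))
       \<le> (L * exp (s\<^sup>2)) ^ card S" if s: "\<bar>s\<bar> \<le> 1" for s :: real
  proof -
    have "(\<Prod>u\<in>S. lam (x u)) * exp (s * card S * (freq S (\<lambda>u. x u = a) - q))
        = (\<Prod>u\<in>S. lam (x u) * exp (s * (of_bool (x u = a) - q)))" for x
    proof -
      have "s * card S * (freq S (\<lambda>u. x u = a) - q) = (\<Sum>u\<in>S. s * (of_bool (x u = a) - q))"
        using cS S by (simp add: freq_eq_sum sum_distrib_left[symmetric] sum_subtractf field_simps del: sum_of_bool_eq)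
      then show ?thesis by (simp add: exp_sum S prod.distrib)
    qed
    then have "(\<Sum>x\<in>S \<rightarrow>\<^sub>E A. (\<Prod>u\<in>S. lam (x u)) * exp (s * card S * (freq S (\<lambda>u. x u = a) - q)))
        = (\<Sum>x\<in>S \<rightarrow>\<^sub>E A. \<Prod>u\<in>S. lam (x u) * exp (s * (of_bool (x u = a) - q)))" by simp
    also have "\<dots> = (\<Prod>u\<in>S. \<Sum>c\<in>A. lam c * exp (s * (of_bool (c = a) - q)))"
      using S A by (intro prod_sum_PiE[symmetric]) auto
    also have "\<dots> = (\<Sum>c\<in>A. lam c * exp (s * (of_bool (c = a) - q))) ^ card S" by simp
    also have "\<dots> \<le> (L * exp (s\<^sup>2)) ^ card S"
    proof (rule power_mono)
      have "(\<Sum>c\<in>A. lam c * exp (s * (of_bool (c = a) - q)))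
         \<le> (\<Sum>c\<in>A. lam c * (1 + s * (of_bool (c = a) - q) + s\<^sup>2))"
      proof (intro sum_mono mult_left_mono)
        fix c assume "c \<in> A"
        define r :: real where "r = of_bool (c = a) - q"
        have r: "\<bar>r\<bar> \<le> 1" using q by (auto simp: r_def)
        have sr: "\<bar>s * r\<bar> \<le> \<bar>s\<bar>" using r by (simp add: abs_mult mult_left_le)
        have "exp (s * r) \<le> 1 + s * r + (s * r)\<^sup>2" using sr s by (intro exp_le_quadratic) auto
        also have "(s * r)\<^sup>2 \<le> s\<^sup>2" using sr by (simp add: abs_le_square_iff)
        finally show "exp (s * (of_bool (c = a) - q)) \<le> 1 + s * (of_bool (c = a) - q) + s\<^sup>2"
          by (simp add: r_def)
      next
        fix c assume "c \<in> A" then show "0 \<le> lam c" using lam by (simp add: less_imp_le)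
      qed
      also have "\<dots> = L * (1 + s\<^sup>2) + s * ((\<Sum>c\<in>A. lam c * of_bool (c = a)) - L * q)"
        by (simp add: L_def sum_distrib_left sum_distrib_right sum.distrib sum_subtractf algebra_simps)
      also have "(\<Sum>c\<in>A. lam c * of_bool (c = a)) = (\<Sum>c\<in>{a}. lam c * of_bool (c = a))"
        using A by (intro sum.mono_neutral_right) auto
      also have "L * (1 + s\<^sup>2) + s * ((\<Sum>c\<in>{a}. lam c * of_bool (c = a)) - L * q) = L * (1 + s\<^sup>2)"
        using L by (simp add: q_def)
      also have "\<dots> \<le> L * exp (s\<^sup>2)" using L by (intro mult_left_mono exp_ge_add_one_self) auto
      finally show "(\<Sum>c\<in>A. lam c * exp (s * (of_bool (c = a) - q))) \<le> L * exp (s\<^sup>2)" .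
    next
      show "0 \<le> (\<Sum>c\<in>A. lam c * exp (s * (of_bool (c = a) - q)))"
        using lam by (intro sum_nonneg mult_nonneg_nonneg) (auto intro: less_imp_le)
    qed
    finally show ?thesis .
  qed
  let ?P = "\<lambda>x. \<Prod>u\<in>S. lam (x u)"
  let ?f = "\<lambda>x. card S * (freq S (\<lambda>u. x u = a) - q)"
  have finX: "finite (S \<rightarrow>\<^sub>E A)" using S A by (intro finite_PiE) auto
  have P0: "?P x \<ge> 0" if "x \<in> S \<rightarrow>\<^sub>E A" for x
    using that lam by (intro prod_nonneg) (auto intro!: less_imp_le simp: PiE_iff)
  have pt: "?P x * of_bool (\<epsilon> < \<bar>freq S (\<lambda>u. x u = a) - q\<bar>)
      \<le> (?P x * exp (\<epsilon> / 2 * ?f x) + ?P x * exp (- \<epsilon> / 2 * ?f x)) * exp (- \<epsilon>\<^sup>2 / 2 * card S)"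
    if x: "x \<in> S \<rightarrow>\<^sub>E A" for x
  proof (cases "\<epsilon> < \<bar>freq S (\<lambda>u. x u = a) - q\<bar>")
    case True
    define y where "y = ?f x"
    have "\<epsilon> * card S \<le> \<bar>y\<bar>" using True cS by (simp add: y_def abs_mult mult.commute)
    then have "\<epsilon> / 2 * (\<epsilon> * card S) \<le> \<epsilon> / 2 * \<bar>y\<bar>" using \<epsilon> by (intro mult_left_mono) auto
    then have "\<epsilon>\<^sup>2 / 2 * card S \<le> \<epsilon> / 2 * \<bar>y\<bar>" by (simp add: power2_eq_square)
    then have "exp (\<epsilon>\<^sup>2 / 2 * card S) \<le> exp (\<epsilon> / 2 * \<bar>y\<bar>)" by simp
    also have "\<dots> \<le> exp (\<epsilon> / 2 * y) + exp (- \<epsilon> / 2 * y)"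
      by (cases "y \<ge> 0") (auto simp: abs_if)
    finally have "1 \<le> (exp (\<epsilon> / 2 * y) + exp (- \<epsilon> / 2 * y)) * exp (- \<epsilon>\<^sup>2 / 2 * card S)"
      by (simp add: exp_minus field_simps)
    then have "?P x * 1 \<le> ?P x * ((exp (\<epsilon> / 2 * y) + exp (- \<epsilon> / 2 * y)) * exp (- \<epsilon>\<^sup>2 / 2 * card S))"
      using P0[OF x] by (rule mult_left_mono)
    then show ?thesis using True by (simp add: y_def algebra_simps)
  next
    case False
    then show ?thesis using P0[OF x] by simp
  qed
  have "(\<Sum>x | x \<in> S \<rightarrow>\<^sub>E A \<and> \<epsilon> < \<bar>freq S (\<lambda>u. x u = a) - q\<bar>. ?P x)
      = (\<Sum>x\<in>S \<rightarrow>\<^sub>E A. ?P x * of_bool (\<epsilon> < \<bar>freq S (\<lambda>u. x u = a) - q\<bar>))"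
    using finX by (intro sum.mono_neutral_cong_left) auto
  also have "\<dots> \<le> (\<Sum>x\<in>S \<rightarrow>\<^sub>E A. (?P x * exp (\<epsilon> / 2 * ?f x) + ?P x * exp (- \<epsilon> / 2 * ?f x))
                 * exp (- \<epsilon>\<^sup>2 / 2 * card S))"
    by (rule sum_mono) (rule pt)
  also have "\<dots> = ((\<Sum>x\<in>S \<rightarrow>\<^sub>E A. ?P x * exp (\<epsilon> / 2 * card S * (freq S (\<lambda>u. x u = a) - q)))
      + (\<Sum>x\<in>S \<rightarrow>\<^sub>E A. ?P x * exp (- \<epsilon> / 2 * card S * (freq S (\<lambda>u. x u = a) - q)))) * exp (- \<epsilon>\<^sup>2 / 2 * card S)"
    by (simp only: sum_distrib_right[symmetric] sum.distrib mult.assoc)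
  also have "\<dots> \<le> ((L * exp ((\<epsilon> / 2)\<^sup>2)) ^ card S + (L * exp ((- \<epsilon> / 2)\<^sup>2)) ^ card S) * exp (- \<epsilon>\<^sup>2 / 2 * card S)"
    using mgf[of "\<epsilon> / 2"] mgf[of "- \<epsilon> / 2"] \<epsilon> by (intro mult_right_mono add_mono) auto
  also have "\<dots> = 2 * L ^ card S * (exp ((\<epsilon> / 2)\<^sup>2) ^ card S * exp (- \<epsilon>\<^sup>2 / 2 * card S))"
    by (simp add: power_mult_distrib)
  also have "exp ((\<epsilon> / 2)\<^sup>2) ^ card S * exp (- \<epsilon>\<^sup>2 / 2 * card S) = exp (- \<epsilon>\<^sup>2 / 4 * card S)"
    by (simp add: exp_of_nat_mult[symmetric] mult_exp_exp power2_eq_square algebra_simps)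
  finally show ?thesis by (simp add: L_def q_def)
qed

text \<open>\<open>nu A\<close> stands for the total weight left to an odd vertex whose neighbours
  show the colour set \<open>A\<close>. Since only order properties of \<open>nu\<close> are
  assumed, the full, plus and minus homomorphism spaces are treated at once.\<close>

locale spin_model =
  fixes C :: "'c set" and lam :: "'c \<Rightarrow> real" and nu :: "'c set \<Rightarrow> real" and eta :: real
  assumes finC: "finite C" and neC: "C \<noteq> {}" and lam_pos: "c \<in> C \<Longrightarrow> lam c > 0"
    and nu_nonneg: "A \<subseteq> C \<Longrightarrow> nu A \<ge> 0"
    and nu_anti: "A \<subseteq> B \<Longrightarrow> B \<subseteq> C \<Longrightarrow> nu B \<le> nu A"
    and eta_pos: "eta > 0" and le_eta: "A \<subseteq> C \<Longrightarrow> sum lam A * nu A \<le> eta"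
begin

definition dominant :: "'c set \<Rightarrow> bool" where
  "dominant A \<longleftrightarrow> A \<subseteq> C \<and> sum lam A * nu A = eta"

text \<open>The limiting frequency of a colour when the even vertices take colours from
  \<open>A\<close> independently with probabilities proportional to \<open>lam\<close>.\<close>

definition share :: "'c set \<Rightarrow> 'c \<Rightarrow> real" where
  "share A a = (if a \<in> A then lam a / sum lam A else 0)"

definition typical :: "real \<Rightarrow> 'u set \<Rightarrow> ('u \<Rightarrow> 'c) \<Rightarrow> bool" where
  "typical \<epsilon> S x \<longleftrightarrow> dominant (x ` S) \<and> (\<forall>a\<in>x ` S. \<bar>freq S (\<lambda>u. x u = a) - share (x ` S) a\<bar> \<le> \<epsilon>)"

text \<open>The set of colours seen on a sample may be empty. Giving it a small positive weight
  keeps the logarithms below meaningful.\<close>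

definition Lam :: "'c set \<Rightarrow> real" where
  "Lam A = (if A = {} then min (eta / (nu {} + 1)) (Min (lam ` C) / 2) else sum lam A)"

lemma fin_sub: "A \<subseteq> C \<Longrightarrow> finite A"
  using finC by (rule finite_subset[rotated])

lemma Lam_nonempty: "A \<noteq> {} \<Longrightarrow> Lam A = sum lam A"
  by (simp add: Lam_def)

lemma Lam_empty: "Lam {} > 0" "c \<in> C \<Longrightarrow> Lam {} < lam c" "Lam {} * nu {} \<le> eta"
proof -
  have nu0: "nu {} \<ge> 0" by (rule nu_nonneg) simp
  have m: "Min (lam ` C) > 0" using finC neC lam_pos by (subst Min_gr_iff) auto
  show "Lam {} > 0" using m eta_pos nu0 by (simp add: Lam_def)
  show "Lam {} < lam c" if "c \<in> C"
  proof -
    have "Lam {} \<le> Min (lam ` C) / 2" unfolding Lam_def by (simp only: refl if_True min.cobounded2)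
    also have "\<dots> < Min (lam ` C)" using m by simp
    also have "\<dots> \<le> lam c" using that finC by (intro Min_le) auto
    finally show ?thesis .
  qed
  have "Lam {} * nu {} \<le> eta / (nu {} + 1) * nu {}"
    using nu0 by (intro mult_right_mono) (auto simp: Lam_def)
  also have "\<dots> \<le> eta" using nu0 eta_pos by (simp add: field_simps)
  finally show "Lam {} * nu {} \<le> eta" .
qed

lemma Lam_pos: "A \<subseteq> C \<Longrightarrow> Lam A > 0"
  using Lam_empty(1) lam_pos by (cases "A = {}") (auto simp: Lam_nonempty intro!: sum_pos fin_sub)

lemma sum_le_Lam: "A \<subseteq> C \<Longrightarrow> sum lam A \<le> Lam A"
  using Lam_empty(1) by (cases "A = {}") (auto simp: Lam_nonempty)

lemma sum_nonneg_lam: "A \<subseteq> C \<Longrightarrow> sum lam A \<ge> 0"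
  using lam_pos by (intro sum_nonneg) (auto intro: less_imp_le)

lemma Lam_nu: "A \<subseteq> C \<Longrightarrow> Lam A * nu A \<le> eta"
  using Lam_empty(3) le_eta by (cases "A = {}") (auto simp: Lam_nonempty)

lemma dominant_nonempty: "dominant A \<Longrightarrow> A \<noteq> {}"
  using eta_pos by (auto simp: dominant_def)

end

locale spin_system = spin_model C lam nu eta
  for C :: "'c set" and lam :: "'c \<Rightarrow> real" and nu :: "'c set \<Rightarrow> real" and eta :: real +
  fixes Ev Od :: "'v set" and N :: "'v \<Rightarrow> 'v set" and d :: nat
  assumes finE: "finite Ev" and finO: "finite Od" and d_pos: "d > 0"
    and N_E: "u \<in> Ev \<Longrightarrow> N u \<subseteq> Od" "u \<in> Ev \<Longrightarrow> card (N u) = d"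
    and N_O: "v \<in> Od \<Longrightarrow> N v \<subseteq> Ev" "v \<in> Od \<Longrightarrow> card (N v) = d"
    and N_sym: "u \<in> Ev \<Longrightarrow> v \<in> Od \<Longrightarrow> u \<in> N v \<longleftrightarrow> v \<in> N u"
begin

definition W :: "('v \<Rightarrow> 'c) \<Rightarrow> real" where
  "W g = (\<Prod>u\<in>Ev. lam (g u)) * (\<Prod>v\<in>Od. nu (g ` N v))"

definition seen :: "'v set \<Rightarrow> ('v \<Rightarrow> 'c) \<Rightarrow> 'v \<Rightarrow> 'c set" where
  "seen E0 g v = g ` (N v \<inter> E0)"

lemma sum_swap_edges:
  fixes F :: "'v \<Rightarrow> 'v \<Rightarrow> real"
  assumes "X \<subseteq> Ev"
  shows "(\<Sum>u\<in>X. \<Sum>w\<in>N u. F u w) = (\<Sum>w\<in>Od. \<Sum>u\<in>N w \<inter> X. F u w)"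
proof -
  have "(\<Sum>u\<in>X. \<Sum>w\<in>N u. F u w) = (\<Sum>u\<in>X. \<Sum>w | w \<in> Od \<and> u \<in> N w. F u w)"
  proof (intro sum.cong refl)
    fix u assume "u \<in> X"
    then have u: "u \<in> Ev" using assms by auto
    show "N u = {w \<in> Od. u \<in> N w}" using N_E(1)[OF u] N_sym[OF u] by auto
  qed
  also have "\<dots> = (\<Sum>w\<in>Od. \<Sum>u | u \<in> X \<and> u \<in> N w. F u w)"
    using finite_subset[OF assms finE] finO by (rule sum.swap_restrict)
  also have "\<dots> = (\<Sum>w\<in>Od. \<Sum>u\<in>N w \<inter> X. F u w)"
    by (intro sum.cong refl) auto
  finally show ?thesis .
qed

lemma finN: "u \<in> Ev \<Longrightarrow> finite (N u)" "v \<in> Od \<Longrightarrow> finite (N v)"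
  by (blast intro: finite_subset[OF N_E(1) finO] finite_subset[OF N_O(1) finE])+

lemma neN: "u \<in> Ev \<Longrightarrow> N u \<noteq> {}" "v \<in> Od \<Longrightarrow> N v \<noteq> {}"
  using N_E(2) N_O(2) d_pos by fastforce+

lemma card_Ev: "card Ev = card Od"
proof -
  have "(\<Sum>u\<in>Ev. \<Sum>w\<in>N u. 1) = (\<Sum>w\<in>Od. \<Sum>u\<in>N w \<inter> Ev. 1::real)" by (rule sum_swap_edges) simp
  then have "real (card Ev) * d = real (card Od) * d"
    using N_E(2) N_O by (simp add: Int_absorb2)
  then show ?thesis using d_pos by simp
qed

lemma image_sub: "g \<in> Ev \<rightarrow>\<^sub>E C \<Longrightarrow> v \<in> Od \<Longrightarrow> g ` N v \<subseteq> C"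
  using N_O(1) by (auto simp: PiE_iff)

lemma W_nonneg: "g \<in> Ev \<rightarrow>\<^sub>E C \<Longrightarrow> W g \<ge> 0"
  unfolding W_def using lam_pos nu_nonneg image_sub
  by (intro mult_nonneg_nonneg prod_nonneg) (auto simp: PiE_iff intro: less_imp_le)

lemma sum_by_image:
  fixes F :: "('u \<Rightarrow> 'c) \<Rightarrow> real"
  assumes S: "finite S"
  shows "(\<Sum>x\<in>S \<rightarrow>\<^sub>E C. F x) = (\<Sum>A\<in>Pow C. \<Sum>x | x \<in> S \<rightarrow>\<^sub>E C \<and> x ` S = A. F x)"
proof -
  have "(\<Sum>A\<in>Pow C. \<Sum>x\<in>{x \<in> S \<rightarrow>\<^sub>E C. x ` S = A}. F x) = (\<Sum>x\<in>S \<rightarrow>\<^sub>E C. F x)"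
    using finC S by (intro sum.group finite_PiE) (auto simp: PiE_iff)
  then show ?thesis by simp
qed

lemma sum_image_le:
  assumes S: "finite S" and A: "A \<subseteq> C"
  shows "(\<Sum>x | x \<in> S \<rightarrow>\<^sub>E C \<and> x ` S = A. \<Prod>u\<in>S. lam (x u)) \<le> sum lam A ^ card S"
proof -
  have "(\<Sum>x | x \<in> S \<rightarrow>\<^sub>E C \<and> x ` S = A. \<Prod>u\<in>S. lam (x u)) \<le> (\<Sum>x\<in>S \<rightarrow>\<^sub>E A. \<Prod>u\<in>S. lam (x u))"
  proof (rule sum_mono2)
    show "finite (S \<rightarrow>\<^sub>E A)" using S fin_sub[OF A] by (intro finite_PiE) auto
    show "{x \<in> S \<rightarrow>\<^sub>E C. x ` S = A} \<subseteq> S \<rightarrow>\<^sub>E A" by (auto simp: PiE_iff extensional_def)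
    show "0 \<le> (\<Prod>u\<in>S. lam (x u))" if "x \<in> (S \<rightarrow>\<^sub>E A) - {x \<in> S \<rightarrow>\<^sub>E C. x ` S = A}" for x
    proof (rule prod_nonneg)
      fix u assume "u \<in> S"
      then have "x u \<in> C" using that A by (auto simp: PiE_iff)
      then show "0 \<le> lam (x u)" by (rule less_imp_le[OF lam_pos])
    qed
  qed
  then show ?thesis using S fin_sub[OF A] by (simp add: sum_PiE_prod_const)
qed

text \<open>Local sums enter Finner's inequality through their \<open>d\<close>-th roots, so a
  surplus factor \<open>1 + z\<close> at a vertex costs only \<open>z / d\<close> in the
  exponent.\<close>

lemma prod_root_le:
  assumes "\<And>v. v \<in> Od \<Longrightarrow> 0 \<le> F v \<and> F v \<le> eta ^ d * (1 + z)" "z \<ge> 0"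
  shows "(\<Prod>v\<in>Od. root d (F v)) \<le> eta ^ card Od * exp (z * card Od / d)"
proof -
  have "(\<Prod>v\<in>Od. root d (F v)) \<le> (\<Prod>v\<in>Od. eta * exp (z / d))"
  proof (intro prod_mono conjI)
    fix v assume v: "v \<in> Od"
    show "0 \<le> root d (F v)" using assms(1)[OF v] d_pos by simp
    have "F v \<le> (eta * exp (z / d)) ^ d"
    proof -
      have "F v \<le> eta ^ d * (1 + z)" using assms(1)[OF v] by simp
      also have "\<dots> \<le> eta ^ d * exp z"
        using eta_pos by (intro mult_left_mono exp_ge_add_one_self) auto
      also have "\<dots> = (eta * exp (z / d)) ^ d"
        using d_pos by (simp add: power_mult_distrib exp_of_nat_mult[symmetric])
      finally show ?thesis .
    qed
    then have "root d (F v) \<le> root d ((eta * exp (z / d)) ^ d)" using d_pos by simp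
    also have "\<dots> = eta * exp (z / d)" using d_pos eta_pos by (intro real_root_power_cancel) auto
    finally show "root d (F v) \<le> eta * exp (z / d)" .
  qed
  also have "\<dots> = eta ^ card Od * exp (z * card Od / d)"
    by (simp add: power_mult_distrib exp_of_nat_mult[symmetric] mult.commute)
  finally show ?thesis .
qed

end


section \<open>Colours outside a sample summed out\<close>

context spin_system
begin

text \<open>Grouped by the colour set \<open>A\<close>, the coordinates in \<open>S\<close> give
  \<open>sum lam A ^ card S\<close> and the \<open>e\<close> factors \<open>Lam A\<close> stand in
  for the unsampled neighbours, so each \<open>A\<close> completes to
  \<open>(Lam A * nu A) ^ d\<close>. The weights \<open>r\<close> record how free the choice of
  \<open>A\<close> still is.\<close>

lemma local_sum_le:
  assumes S: "finite S" and e: "card S + e = d"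
    and r: "\<And>A. A \<subseteq> C \<Longrightarrow> 0 \<le> r A" and R: "(\<Sum>A\<in>Pow C. r A) \<le> z"
  shows "(\<Sum>x\<in>S \<rightarrow>\<^sub>E C. (\<Prod>u\<in>S. lam (x u)) * (nu (x ` S) ^ d * r (x ` S) * Lam (x ` S) ^ e)) \<le> eta ^ d * z"
proof -
  have "(\<Sum>x\<in>S \<rightarrow>\<^sub>E C. (\<Prod>u\<in>S. lam (x u)) * (nu (x ` S) ^ d * r (x ` S) * Lam (x ` S) ^ e))
      = (\<Sum>A\<in>Pow C. (\<Sum>x | x \<in> S \<rightarrow>\<^sub>E C \<and> x ` S = A. \<Prod>u\<in>S. lam (x u)) * (nu A ^ d * r A * Lam A ^ e))"
    unfolding sum_by_image[OF S] sum_distrib_right by (intro sum.cong) auto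
  also have "\<dots> \<le> (\<Sum>A\<in>Pow C. eta ^ d * r A)"
  proof (intro sum_mono)
    fix A assume "A \<in> Pow C"
    then have A: "A \<subseteq> C" by simp
    have "(\<Sum>x | x \<in> S \<rightarrow>\<^sub>E C \<and> x ` S = A. \<Prod>u\<in>S. lam (x u)) * (nu A ^ d * r A * Lam A ^ e)
        \<le> Lam A ^ card S * (nu A ^ d * r A * Lam A ^ e)"
      using sum_image_le[OF S A] power_mono[OF sum_le_Lam[OF A] sum_nonneg_lam[OF A], of "card S"]
        nu_nonneg[OF A] r[OF A] Lam_pos[OF A] by (intro mult_right_mono) auto
    also have "\<dots> = (Lam A * nu A) ^ d * r A"
      by (simp add: e[symmetric] power_add power_mult_distrib)
    also have "\<dots> \<le> eta ^ d * r A"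
      using Lam_nu[OF A] nu_nonneg[OF A] Lam_pos[OF A] r[OF A]
      by (intro mult_right_mono power_mono) auto
    finally show "(\<Sum>x | x \<in> S \<rightarrow>\<^sub>E C \<and> x ` S = A. \<Prod>u\<in>S. lam (x u)) * (nu A ^ d * r A * Lam A ^ e)
        \<le> eta ^ d * r A" .
  qed
  also have "\<dots> = eta ^ d * (\<Sum>A\<in>Pow C. r A)" by (simp add: sum_distrib_left)
  also have "\<dots> \<le> eta ^ d * z" using R eta_pos by (intro mult_left_mono) auto
  finally show ?thesis .
qed

definition dis :: "'v set \<Rightarrow> ('v \<Rightarrow> 'c) \<Rightarrow> 'v \<Rightarrow> real" where
  "dis E0 g u = freq (N u \<times> N u) (\<lambda>(w, w'). seen E0 g w \<noteq> seen E0 g w')"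

definition miss :: "'v set \<Rightarrow> ('v \<Rightarrow> 'c) \<Rightarrow> 'v \<Rightarrow> 'c \<Rightarrow> real" where
  "miss E0 g u a = freq (N u) (\<lambda>w. a \<notin> seen E0 g w)"

text \<open>The colours outside \<open>E0\<close> are summed out exactly, given those on \<open>E0\<close>: a vertex
  \<open>u\<close> then contributes at most the geometric mean of the weights of its neighbours' sampled colour sets,
  times the gain from their disagreement. These weights restore the exponent \<open>d\<close> of the full
  neighbourhood in Finner's inequality on \<open>E0\<close>.\<close>

lemma partition_function_bound:
  fixes ref :: "'v \<Rightarrow> 'c set"
  assumes E0: "E0 \<subseteq> Ev"
    and gain: "\<And>(D :: 'v set) A. finite D \<Longrightarrow> D \<noteq> {} \<Longrightarrow> (\<And>w. w \<in> D \<Longrightarrow> A w \<subseteq> C) \<Longrightarrow>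
       (\<Sum>a\<in>C. lam a * exp (- \<tau> * freq D (\<lambda>w. a \<notin> A w)))
       \<le> exp ((\<Sum>w\<in>D. ln (Lam (A w))) / card D
              - \<kappa> * freq (D \<times> D) (\<lambda>(w, w'). A w \<noteq> A w') + c0)"
  shows "(\<Sum>g\<in>Ev \<rightarrow>\<^sub>E C. W g * exp ((\<Sum>u\<in>Ev - E0. \<kappa> * dis E0 g u - c0 - \<tau> * miss E0 g u (g u))
            - \<sigma> / d * card {v\<in>Od. seen E0 g v \<noteq> ref v}))
         \<le> eta ^ card Od * exp (2 ^ card C * exp (- \<sigma>) * card Od / d)"
proof -
  define E1 where "E1 = Ev - E0"
  have Ev: "E0 \<union> E1 = Ev" "E0 \<inter> E1 = {}" using E0 by (auto simp: E1_def)
  have finE0: "finite E0" "finite E1" using finE E0 by (auto simp: E1_def intro: finite_subset)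
  define mg where "mg g h = (\<lambda>x. if x \<in> E0 then g x else h x)" for g h :: "'v \<Rightarrow> 'c"
  define e where "e v = card (N v \<inter> E1)" for v
  define S where "S v = N v \<inter> E0" for v
  \<comment> \<open>Each of the \<open>e v\<close> neighbours outside the sample hands
    \<open>v\<close> a share \<open>1 / d\<close> of the logarithm of \<open>Lam\<close>; Finner's
    \<open>d\<close>-th power turns this into \<open>Lam _ ^ e v\<close>.\<close>
  define phi where "phi v x = nu (x ` S v) * exp (- \<sigma> / d * of_bool (x ` S v \<noteq> ref v))
      * exp (e v / d * ln (Lam (x ` S v)))" for v x
  have seenM: "seen E0 (mg g h) v = g ` S v" for g h v
    by (auto simp: seen_def mg_def S_def)
  have disM: "dis E0 (mg g h) u = dis E0 g u" for g h u
    by (simp add: dis_def seenM) (simp add: seen_def S_def)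
  have missM: "miss E0 (mg g h) u a = miss E0 g u a" for g h u a
    by (simp add: miss_def seenM) (simp add: seen_def S_def)
  have mgC: "mg g h \<in> Ev \<rightarrow>\<^sub>E C" if "g \<in> E0 \<rightarrow>\<^sub>E C" "h \<in> E1 \<rightarrow>\<^sub>E C" for g h
    using that Ev by (auto simp: mg_def PiE_iff extensional_def)
  have subC: "g ` S v \<subseteq> C" if "g \<in> E0 \<rightarrow>\<^sub>E C" for g v
    using that by (auto simp: S_def PiE_iff)
  let ?J = "\<lambda>g h. (\<Sum>u\<in>E1. \<kappa> * dis E0 (mg g h) u - c0 - \<tau> * miss E0 (mg g h) u (mg g h u))
            - \<sigma> / d * card {v\<in>Od. seen E0 (mg g h) v \<noteq> ref v}"
  have inner: "(\<Sum>h\<in>E1 \<rightarrow>\<^sub>E C. W (mg g h) * exp (?J g h))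
       \<le> (\<Prod>u\<in>E0. lam (g u)) * (\<Prod>v\<in>Od. phi v (restrict g (S v)))" if g: "g \<in> E0 \<rightarrow>\<^sub>E C" for g
  proof -
    let ?A = "\<Prod>u\<in>E0. lam (g u)"
    let ?B = "\<Prod>v\<in>Od. nu (g ` S v) * exp (- \<sigma> / d * of_bool (g ` S v \<noteq> ref v))"
    let ?G = "\<lambda>u a. lam a * exp (\<kappa> * dis E0 g u - c0 - \<tau> * miss E0 g u a)"
    have A0: "?A \<ge> 0" using g lam_pos by (intro prod_nonneg) (auto simp: PiE_iff intro: less_imp_le)
    have B0: "?B \<ge> 0" using nu_nonneg subC[OF g] by (intro prod_nonneg mult_nonneg_nonneg) auto
    have "W (mg g h) * exp (?J g h)
          \<le> ?A * ?B * (\<Prod>u\<in>E1. ?G u (h u))" if h: "h \<in> E1 \<rightarrow>\<^sub>E C" for h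
    proof -
      have mE1: "mg g h u = h u" if "u \<in> E1" for u using that Ev by (auto simp: mg_def)
      \<comment> \<open>Passing from the full colour set to the sampled one can only increase
        \<open>nu\<close>, and makes the sum over \<open>h\<close> factorise over the vertices of
        \<open>E1\<close>.\<close>
      have "W (mg g h) \<le> (\<Prod>u\<in>Ev. lam (mg g h u)) * (\<Prod>v\<in>Od. nu (g ` S v))"
        unfolding W_def
      proof (intro mult_left_mono prod_mono conjI prod_nonneg)
        fix v assume v: "v \<in> Od"
        show "0 \<le> nu (mg g h ` N v)" using nu_nonneg image_sub[OF mgC[OF g h] v] by blast
        have "g ` S v \<subseteq> mg g h ` N v" by (force simp: S_def mg_def)
        then show "nu (mg g h ` N v) \<le> nu (g ` S v)" using image_sub[OF mgC[OF g h] v] by (rule nu_anti)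
      next
        fix u assume "u \<in> Ev"
        then have "mg g h u \<in> C" using mgC[OF g h] by (auto simp: PiE_iff)
        then show "0 \<le> lam (mg g h u)" by (rule less_imp_le[OF lam_pos])
      qed
      also have "(\<Prod>u\<in>Ev. lam (mg g h u)) = ?A * (\<Prod>u\<in>E1. lam (h u))"
      proof -
        have "(\<Prod>u\<in>Ev. lam (mg g h u)) = (\<Prod>u\<in>E0. lam (mg g h u)) * (\<Prod>u\<in>E1. lam (mg g h u))"
          unfolding Ev(1)[symmetric] using finE0 Ev(2) by (rule prod.union_disjoint)
        moreover have "(\<Prod>u\<in>E0. lam (mg g h u)) = ?A" by (intro prod.cong) (auto simp: mg_def)
        moreover have "(\<Prod>u\<in>E1. lam (mg g h u)) = (\<Prod>u\<in>E1. lam (h u))"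
          by (intro prod.cong) (auto simp: mE1)
        ultimately show ?thesis by simp
      qed
      finally have 1: "W (mg g h) \<le> ?A * (\<Prod>u\<in>E1. lam (h u)) * (\<Prod>v\<in>Od. nu (g ` S v))" .
      have "exp (?J g h)
          = (\<Prod>u\<in>E1. exp (\<kappa> * dis E0 g u - c0 - \<tau> * miss E0 g u (h u)))
            * (\<Prod>v\<in>Od. exp (- \<sigma> / d * of_bool (g ` S v \<noteq> ref v)))"
      proof -
        have "(\<Sum>u\<in>E1. \<kappa> * dis E0 (mg g h) u - c0 - \<tau> * miss E0 (mg g h) u (mg g h u))
            = (\<Sum>u\<in>E1. \<kappa> * dis E0 g u - c0 - \<tau> * miss E0 g u (h u))"
          by (intro sum.cong) (auto simp: disM missM mE1)
        moreover have "- (\<sigma> / d * card {v\<in>Od. seen E0 (mg g h) v \<noteq> ref v})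
            = (\<Sum>v\<in>Od. - \<sigma> / d * of_bool (g ` S v \<noteq> ref v))"
        proof -
          have c: "real (card {v\<in>Od. g ` S v \<noteq> ref v}) = (\<Sum>v\<in>Od. of_bool (g ` S v \<noteq> ref v))"
            using finO by (simp add: Int_def)
          show ?thesis unfolding seenM c by (simp only: sum_distrib_left sum_negf[symmetric] minus_mult_left minus_divide_left)
        qed
        ultimately show ?thesis
          using finO finE0 by (simp only: exp_sum[symmetric] mult_exp_exp diff_conv_add_uminus)
      qed
      then have "W (mg g h) * exp (?J g h)
         \<le> (?A * (\<Prod>u\<in>E1. lam (h u)) * (\<Prod>v\<in>Od. nu (g ` S v))) *
           ((\<Prod>u\<in>E1. exp (\<kappa> * dis E0 g u - c0 - \<tau> * miss E0 g u (h u)))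
            * (\<Prod>v\<in>Od. exp (- \<sigma> / d * of_bool (g ` S v \<noteq> ref v))))"
        using 1 by (simp add: mult_right_mono prod_nonneg)
      also have "\<dots> = ?A * ?B * (\<Prod>u\<in>E1. ?G u (h u))" by (simp only: prod.distrib mult_ac)
      finally show ?thesis .
    qed
    then have "(\<Sum>h\<in>E1 \<rightarrow>\<^sub>E C. W (mg g h) * exp (?J g h))
       \<le> (\<Sum>h\<in>E1 \<rightarrow>\<^sub>E C. ?A * ?B * (\<Prod>u\<in>E1. ?G u (h u)))"
      by (rule sum_mono)
    also have "\<dots> = ?A * ?B * (\<Prod>u\<in>E1. \<Sum>a\<in>C. ?G u a)"
      unfolding sum_distrib_left[symmetric] using finE0 finC by (subst prod_sum_PiE) auto
    \<comment> \<open>The terms \<open>\<kappa> * dis\<close> and \<open>c0\<close> in the exponent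
      cancel exactly against those supplied by \<open>gain\<close>.\<close>
    also have "\<dots> \<le> ?A * ?B * (\<Prod>u\<in>E1. exp ((\<Sum>w\<in>N u. ln (Lam (g ` S w))) / d))"
    proof (intro mult_left_mono prod_mono conjI)
      fix u assume "u \<in> E1"
      then have u: "u \<in> Ev" by (simp add: E1_def)
      show "0 \<le> (\<Sum>a\<in>C. ?G u a)" using lam_pos by (intro sum_nonneg mult_nonneg_nonneg) (auto intro: less_imp_le)
      have "(\<Sum>a\<in>C. ?G u a) = exp (\<kappa> * dis E0 g u - c0) * (\<Sum>a\<in>C. lam a * exp (- \<tau> * freq (N u) (\<lambda>w. a \<notin> g ` S w)))"
        unfolding sum_distrib_left
        by (intro sum.cong refl) (simp add: miss_def seen_def S_def mult.left_commute mult_exp_exp)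
      also have "\<dots> \<le> exp (\<kappa> * dis E0 g u - c0) * exp ((\<Sum>w\<in>N u. ln (Lam (g ` S w))) / card (N u)
              - \<kappa> * freq (N u \<times> N u) (\<lambda>(w, w'). g ` S w \<noteq> g ` S w') + c0)"
        using finN(1)[OF u] neN(1)[OF u] subC[OF g] by (intro mult_left_mono gain) auto
      also have "\<dots> = exp ((\<Sum>w\<in>N u. ln (Lam (g ` S w))) / d)"
        by (simp add: mult_exp_exp dis_def seen_def S_def N_E(2)[OF u])
      finally show "(\<Sum>a\<in>C. ?G u a) \<le> exp ((\<Sum>w\<in>N u. ln (Lam (g ` S w))) / d)" .
    qed (use A0 B0 in simp)
    also have "(\<Prod>u\<in>E1. exp ((\<Sum>w\<in>N u. ln (Lam (g ` S w))) / d)) = (\<Prod>v\<in>Od. exp (e v / d * ln (Lam (g ` S v))))"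
    proof -
      have "(\<Sum>u\<in>E1. \<Sum>w\<in>N u. ln (Lam (g ` S w)) / d) = (\<Sum>w\<in>Od. \<Sum>u\<in>N w \<inter> E1. ln (Lam (g ` S w)) / d)"
        by (rule sum_swap_edges) (simp add: E1_def)
      then show ?thesis
        using finO finE0 by (simp add: exp_sum[symmetric] sum_divide_distrib e_def)
    qed
    also have "?A * ?B * (\<Prod>v\<in>Od. exp (e v / d * ln (Lam (g ` S v)))) = ?A * (\<Prod>v\<in>Od. phi v (restrict g (S v)))"
      by (simp add: phi_def prod.distrib mult.assoc)
    finally show ?thesis .
  qed
  have "(\<Sum>g\<in>Ev \<rightarrow>\<^sub>E C. W g * exp ((\<Sum>u\<in>Ev - E0. \<kappa> * dis E0 g u - c0 - \<tau> * miss E0 g u (g u))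
            - \<sigma> / d * card {v\<in>Od. seen E0 g v \<noteq> ref v}))
      = (\<Sum>g\<in>E0 \<rightarrow>\<^sub>E C. \<Sum>h\<in>E1 \<rightarrow>\<^sub>E C. W (mg g h) * exp (?J g h))"
    unfolding Ev(1)[symmetric] sum_PiE_union[OF Ev(2)] mg_def using Ev(2) by (simp add: Un_Diff Diff_triv Int_commute)
  also have "\<dots> \<le> (\<Sum>g\<in>E0 \<rightarrow>\<^sub>E C. (\<Prod>u\<in>E0. lam (g u)) * (\<Prod>v\<in>Od. phi v (restrict g (S v))))"
    by (rule sum_mono) (rule inner)
  also have "\<dots> \<le> (\<Prod>v\<in>Od. root d (\<Sum>x\<in>S v \<rightarrow>\<^sub>E C. (\<Prod>u\<in>S v. lam (x u)) * phi v x ^ d))"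
  proof (rule Finner[OF finE0(1) finO finC d_pos])
    fix u assume u: "u \<in> E0"
    have "{v \<in> Od. u \<in> S v} = N u"
      using u E0 N_E(1)[of u] N_sym[of u] by (auto simp: S_def)
    then show "card {v \<in> Od. u \<in> S v} = d" using u E0 N_E(2) by auto
  next
    fix v x assume x: "x \<in> S v \<rightarrow>\<^sub>E C"
    then have "x ` S v \<subseteq> C" by (auto simp: PiE_iff)
    then show "0 \<le> phi v x" unfolding phi_def using nu_nonneg by simp
  qed (auto simp: S_def lam_pos less_imp_le)
  also have "\<dots> \<le> eta ^ card Od * exp (2 ^ card C * exp (- \<sigma>) * card Od / d)"
  proof (rule prod_root_le)
    fix v assume v: "v \<in> Od"
    have finS: "finite (S v)" using finN(2)[OF v] by (simp add: S_def)
    have ce: "card (S v) + e v = d"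
    proof -
      have "N v = S v \<union> (N v \<inter> E1)" using N_O(1)[OF v] Ev by (auto simp: S_def)
      then have "card (N v) = card (S v) + card (N v \<inter> E1)"
        using finN(2)[OF v] Ev(2) finS by (metis (no_types, lifting) S_def card_Un_disjoint finite_Int inf.assoc inf.commute inf_bot_right)
      then show ?thesis using N_O(2)[OF v] by (simp add: e_def)
    qed
    \<comment> \<open>The \<open>d\<close>-th power turns the penalty \<open>\<sigma> / d\<close>
      into a full factor \<open>exp (- \<sigma>)\<close>, so all colour sets other than
      \<open>ref v\<close> together count for at most
      \<open>2 ^ card C * exp (- \<sigma>)\<close>.\<close>
    define r where "r A = exp (- \<sigma> * of_bool (A \<noteq> ref v))" for A
    have phid: "phi v x ^ d = nu (x ` S v) ^ d * r (x ` S v) * Lam (x ` S v) ^ e v" if "x \<in> S v \<rightarrow>\<^sub>E C" for x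
    proof -
      have "x ` S v \<subseteq> C" using that by (auto simp: PiE_iff)
      then have L: "Lam (x ` S v) > 0" by (rule Lam_pos)
      have "exp (e v / d * ln (Lam (x ` S v))) ^ d = Lam (x ` S v) ^ e v"
      proof -
        have "exp (e v / d * ln (Lam (x ` S v))) ^ d = exp (e v * ln (Lam (x ` S v)))"
          using d_pos by (simp add: exp_of_nat_mult[symmetric])
        also have "\<dots> = Lam (x ` S v) ^ e v" using L by (simp add: exp_of_nat_mult)
        finally show ?thesis .
      qed
      moreover have "exp (- \<sigma> / d * of_bool (x ` S v \<noteq> ref v)) ^ d = r (x ` S v)"
        using d_pos by (simp add: r_def exp_of_nat_mult[symmetric])
      ultimately show ?thesis by (simp add: phi_def power_mult_distrib)
    qed
    have eq: "(\<Sum>x\<in>S v \<rightarrow>\<^sub>E C. (\<Prod>u\<in>S v. lam (x u)) * phi v x ^ d)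
       = (\<Sum>x\<in>S v \<rightarrow>\<^sub>E C. (\<Prod>u\<in>S v. lam (x u)) * (nu (x ` S v) ^ d * r (x ` S v) * Lam (x ` S v) ^ e v))"
      by (intro sum.cong) (auto simp: phid)
    have "(\<Sum>A\<in>Pow C. r A) \<le> (\<Sum>A\<in>Pow C. of_bool (A = ref v) + exp (- \<sigma>))"
      by (intro sum_mono) (auto simp: r_def)
    also have "\<dots> \<le> 1 + 2 ^ card C * exp (- \<sigma>)"
    proof -
      have "(\<Sum>A\<in>Pow C. of_bool (A = ref v)) = (\<Sum>A\<in>Pow C. if A = ref v then 1 else (0::real))"
        by (intro sum.cong) auto
      also have "\<dots> \<le> 1" using finC by simp
      finally show ?thesis using finC by (simp add: sum.distrib card_Pow del: sum_of_bool_eq)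
    qed
    finally have "(\<Sum>x\<in>S v \<rightarrow>\<^sub>E C. (\<Prod>u\<in>S v. lam (x u)) * phi v x ^ d) \<le> eta ^ d * (1 + 2 ^ card C * exp (- \<sigma>))"
      unfolding eq by (intro local_sum_le finS ce) (auto simp: r_def)
    moreover have "0 \<le> (\<Sum>x\<in>S v \<rightarrow>\<^sub>E C. (\<Prod>u\<in>S v. lam (x u)) * phi v x ^ d)"
    proof (intro sum_nonneg mult_nonneg_nonneg prod_nonneg)
      fix x assume x: "x \<in> S v \<rightarrow>\<^sub>E C"
      then have xS: "x ` S v \<subseteq> C" by (auto simp: PiE_iff)
      show "0 \<le> lam (x u)" if "u \<in> S v" for u using xS that by (intro less_imp_le[OF lam_pos]) auto
      show "0 \<le> phi v x ^ d" using nu_nonneg[OF xS] by (simp add: phi_def)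
    qed
    ultimately show "0 \<le> (\<Sum>x\<in>S v \<rightarrow>\<^sub>E C. (\<Prod>u\<in>S v. lam (x u)) * phi v x ^ d) \<and>
      (\<Sum>x\<in>S v \<rightarrow>\<^sub>E C. (\<Prod>u\<in>S v. lam (x u)) * phi v x ^ d) \<le> eta ^ d * (1 + 2 ^ card C * exp (- \<sigma>))" by simp
  qed simp
  finally show ?thesis .
qed

end

section \<open>Typical neighbourhoods\<close>

context spin_model
begin

lemma dominance_gap:
  obtains \<gamma> :: real where "\<gamma> > 0" "\<And>A. A \<subseteq> C \<Longrightarrow> \<not> dominant A \<Longrightarrow> sum lam A * nu A \<le> eta * exp (- \<gamma>)"
proof -
  \<comment> \<open>The extra element \<open>eta / 2\<close> keeps the maximum defined and positive
    even if every set is dominant or all other products vanish.\<close>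
  define X where "X = insert (eta / 2) ((\<lambda>A. sum lam A * nu A) ` {A. A \<subseteq> C \<and> \<not> dominant A})"
  have finX: "finite X" using finC by (simp add: X_def)
  have lt: "Max X < eta"
    using finX eta_pos le_eta by (subst Max_less_iff) (auto simp: X_def dominant_def order.not_eq_order_implies_strict)
  have ge: "Max X \<ge> eta / 2" using finX by (intro Max_ge) (auto simp: X_def)
  then have pos: "Max X > 0" using eta_pos by linarith
  show ?thesis
  proof (rule that[of "ln (eta / Max X)"])
    show "ln (eta / Max X) > 0" using lt pos by simp
    have "eta * exp (- ln (eta / Max X)) = Max X" using pos eta_pos by (simp add: exp_minus)
    then show "sum lam A * nu A \<le> eta * exp (- ln (eta / Max X))" if "A \<subseteq> C" "\<not> dominant A" for A
      using that finX by (auto simp: X_def intro!: Max_ge)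
  qed
qed

lemma typical_restrict: "typical \<epsilon> S (restrict g S) \<longleftrightarrow> typical \<epsilon> S g"
proof -
  have "{u\<in>S. restrict g S u = a} = {u\<in>S. g u = a}" for a by auto
  then show ?thesis by (simp add: typical_def freq_def)
qed

text \<open>Atypicality has two sources: a colour set that is not dominant loses a fixed factor per
  coordinate, and wrong frequencies inside a dominant set are unlikely by the Chernoff bound.
  \<open>t\<close> is the smaller of the two rates.\<close>

lemma atypical_weight:
  assumes \<epsilon>: "0 < \<epsilon>" "\<epsilon> \<le> 1"
  obtains t K :: real where "t > 0" "K \<ge> 0"
    "\<And>S :: 'u set. finite S \<Longrightarrow> S \<noteq> {} \<Longrightarrow>
       (\<Sum>x | x \<in> S \<rightarrow>\<^sub>E C \<and> \<not> typical \<epsilon> S x. (\<Prod>u\<in>S. lam (x u)) * nu (x ` S) ^ card S)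
        \<le> eta ^ card S * (K * exp (- t * card S))"
proof -
  obtain \<gamma> where \<gamma>: "\<gamma> > 0" "\<And>A. A \<subseteq> C \<Longrightarrow> \<not> dominant A \<Longrightarrow> sum lam A * nu A \<le> eta * exp (- \<gamma>)"
    using dominance_gap by blast
  define t where "t = min \<gamma> (\<epsilon>\<^sup>2 / 4)"
  define K where "K = 2 ^ card C * (1 + 2 * real (card C))"
  have t: "t > 0" using \<gamma>(1) \<epsilon> by (simp add: t_def)
  have K: "K \<ge> 0" by (simp add: K_def)
  have "(\<Sum>x | x \<in> S \<rightarrow>\<^sub>E C \<and> \<not> typical \<epsilon> S x. (\<Prod>u\<in>S. lam (x u)) * nu (x ` S) ^ card S)
        \<le> eta ^ card S * (K * exp (- t * card S))" if S: "finite S" "S \<noteq> {}" for S :: "'u set"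
  proof -
    let ?s = "card S"
    let ?X = "\<lambda>A. {x \<in> S \<rightarrow>\<^sub>E C. \<not> typical \<epsilon> S x \<and> x ` S = A}"
    let ?P = "\<lambda>x. \<Prod>u\<in>S. lam (x u)"
    have finF: "finite (S \<rightarrow>\<^sub>E C)" using S finC by (intro finite_PiE) auto
    have P0: "?P x \<ge> 0" if "x \<in> S \<rightarrow>\<^sub>E C" for x
      using that lam_pos by (intro prod_nonneg) (auto simp: PiE_iff intro: less_imp_le)
    have A: "(\<Sum>x\<in>?X A. ?P x) * nu A ^ ?s \<le> eta ^ ?s * ((1 + 2 * real (card C)) * exp (- t * ?s))"
      if A: "A \<subseteq> C" for A
    proof (cases "dominant A")
      case False
      have "(\<Sum>x\<in>?X A. ?P x) \<le> (\<Sum>x\<in>S \<rightarrow>\<^sub>E A. ?P x)"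
      proof (rule sum_mono2)
        show "finite (S \<rightarrow>\<^sub>E A)" using S fin_sub[OF A] by (intro finite_PiE) auto
        show "?X A \<subseteq> S \<rightarrow>\<^sub>E A" by (auto simp: PiE_iff extensional_def)
        show "0 \<le> ?P x" if "x \<in> (S \<rightarrow>\<^sub>E A) - ?X A" for x
          using that A by (intro P0) (auto simp: PiE_iff)
      qed
      also have "\<dots> = sum lam A ^ ?s" using S(1) fin_sub[OF A] by (rule sum_PiE_prod_const)
      finally have "(\<Sum>x\<in>?X A. ?P x) * nu A ^ ?s \<le> (sum lam A * nu A) ^ ?s"
        using nu_nonneg[OF A] by (simp add: power_mult_distrib mult_right_mono)
      also have "\<dots> \<le> (eta * exp (- \<gamma>)) ^ ?s"
        using \<gamma>(2)[OF A False] nu_nonneg[OF A] sum_nonneg_lam[OF A] by (intro power_mono) auto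
      also have "\<dots> = eta ^ ?s * exp (- \<gamma> * ?s)"
        by (simp add: power_mult_distrib exp_of_nat_mult[symmetric] mult.commute)
      also have "\<dots> \<le> eta ^ ?s * ((1 + 2 * real (card C)) * exp (- t * ?s))"
      proof -
        have "exp (- \<gamma> * ?s) \<le> exp (- t * ?s)" by (simp add: t_def mult_right_mono)
        also have "\<dots> = 1 * exp (- t * ?s)" by simp
        also have "\<dots> \<le> (1 + 2 * real (card C)) * exp (- t * ?s)" by (intro mult_right_mono) auto
        finally show ?thesis using eta_pos by (intro mult_left_mono) auto
      qed
      finally show ?thesis .
    next
      case True
      have Ane: "A \<noteq> {}" using True by (rule dominant_nonempty)
      let ?D = "\<lambda>a. {x. x \<in> S \<rightarrow>\<^sub>E A \<and> \<epsilon> < \<bar>freq S (\<lambda>u. x u = a) - lam a / sum lam A\<bar>}"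
      have finA: "finite (S \<rightarrow>\<^sub>E A)" using S fin_sub[OF A] by (intro finite_PiE) auto
      have PA: "?P x \<ge> 0" if "x \<in> S \<rightarrow>\<^sub>E A" for x
        using that A by (intro P0) (auto simp: PiE_iff)
      have sub: "?X A \<subseteq> (\<Union>a\<in>A. ?D a)"
      proof
        fix x assume x: "x \<in> ?X A"
        then obtain a where a: "a \<in> A" "\<not> \<bar>freq S (\<lambda>u. x u = a) - share A a\<bar> \<le> \<epsilon>"
          using True by (auto simp: typical_def)
        then have "x \<in> ?D a" using x by (auto simp: share_def PiE_iff extensional_def)
        then show "x \<in> (\<Union>a\<in>A. ?D a)" using a(1) by blast
      qed
      have "(\<Sum>x\<in>?X A. ?P x) \<le> (\<Sum>x\<in>(\<Union>a\<in>A. ?D a). ?P x)"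
        using sub PA finA fin_sub[OF A] by (intro sum_mono2) auto
      also have "\<dots> \<le> (\<Sum>a\<in>A. \<Sum>x\<in>?D a. ?P x)"
      proof -
        have "(\<Sum>x\<in>(\<Union>a\<in>A. ?D a). ?P x) \<le> (\<Sum>x\<in>S \<rightarrow>\<^sub>E A. ?P x * (\<Sum>a\<in>A. of_bool (x \<in> ?D a)))"
        proof -
          have "(\<Sum>x\<in>(\<Union>a\<in>A. ?D a). ?P x) \<le> (\<Sum>x\<in>(\<Union>a\<in>A. ?D a). ?P x * (\<Sum>a\<in>A. of_bool (x \<in> ?D a)))"
          proof (rule sum_mono)
            fix x assume "x \<in> (\<Union>a\<in>A. ?D a)"
            then obtain a where a: "a \<in> A" "x \<in> ?D a" by blast
            have "(1::real) = of_bool (x \<in> ?D a)" using a by simp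
            also have "\<dots> \<le> (\<Sum>a\<in>A. of_bool (x \<in> ?D a))"
              using a(1) fin_sub[OF A] by (intro member_le_sum) auto
            finally have "?P x * 1 \<le> ?P x * (\<Sum>a\<in>A. of_bool (x \<in> ?D a))"
              using a(2) PA by (intro mult_left_mono) auto
            then show "?P x \<le> ?P x * (\<Sum>a\<in>A. of_bool (x \<in> ?D a))" by simp
          qed
          also have "\<dots> \<le> (\<Sum>x\<in>S \<rightarrow>\<^sub>E A. ?P x * (\<Sum>a\<in>A. of_bool (x \<in> ?D a)))"
            using finA PA by (intro sum_mono2 mult_nonneg_nonneg sum_nonneg) auto
          finally show ?thesis .
        qed
        also have "\<dots> = (\<Sum>a\<in>A. \<Sum>x\<in>S \<rightarrow>\<^sub>E A. ?P x * of_bool (x \<in> ?D a))"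
          unfolding sum_distrib_left by (rule sum.swap)
        also have "\<dots> = (\<Sum>a\<in>A. \<Sum>x\<in>?D a. ?P x)"
          using finA by (intro sum.cong refl sum.mono_neutral_cong_right) auto
        finally show ?thesis .
      qed
      also have "\<dots> \<le> (\<Sum>a\<in>A. 2 * sum lam A ^ ?s * exp (- \<epsilon>\<^sup>2 / 4 * ?s))"
        using S fin_sub[OF A] A lam_pos \<epsilon> by (intro sum_mono Chernoff_weighted) auto
      also have "\<dots> = card A * (2 * sum lam A ^ ?s * exp (- \<epsilon>\<^sup>2 / 4 * ?s))" by simp
      also have "\<dots> \<le> card C * (2 * sum lam A ^ ?s * exp (- \<epsilon>\<^sup>2 / 4 * ?s))"
        using card_mono[OF finC A] sum_nonneg_lam[OF A] by (intro mult_right_mono) auto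
      finally have "(\<Sum>x\<in>?X A. ?P x) * nu A ^ ?s
          \<le> card C * (2 * sum lam A ^ ?s * exp (- \<epsilon>\<^sup>2 / 4 * ?s)) * nu A ^ ?s"
        using nu_nonneg[OF A] by (intro mult_right_mono) auto
      also have "\<dots> = (sum lam A * nu A) ^ ?s * (2 * card C * exp (- \<epsilon>\<^sup>2 / 4 * ?s))"
        by (simp add: power_mult_distrib)
      also have "\<dots> = eta ^ ?s * (2 * card C * exp (- \<epsilon>\<^sup>2 / 4 * ?s))"
        using True by (simp add: dominant_def)
      also have "\<dots> \<le> eta ^ ?s * ((1 + 2 * real (card C)) * exp (- t * ?s))"
      proof -
        have "t * ?s \<le> \<epsilon>\<^sup>2 / 4 * ?s" by (intro mult_right_mono) (auto simp: t_def)
        then show ?thesis using eta_pos by (intro mult_left_mono mult_mono) auto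
      qed
      finally show ?thesis .
    qed
    have "(\<Sum>x | x \<in> S \<rightarrow>\<^sub>E C \<and> \<not> typical \<epsilon> S x. ?P x * nu (x ` S) ^ ?s)
        = (\<Sum>A\<in>Pow C. \<Sum>x\<in>{x \<in> {x. x \<in> S \<rightarrow>\<^sub>E C \<and> \<not> typical \<epsilon> S x}. x ` S = A}. ?P x * nu (x ` S) ^ ?s)"
      using finC by (intro sum.group[symmetric] finite_subset[OF _ finF]) (auto simp: PiE_iff extensional_def)
    also have "\<dots> = (\<Sum>A\<in>Pow C. (\<Sum>x\<in>?X A. ?P x) * nu A ^ ?s)"
      unfolding sum_distrib_right by (intro sum.cong) auto
    also have "\<dots> \<le> (\<Sum>A\<in>Pow C. eta ^ ?s * ((1 + 2 * real (card C)) * exp (- t * ?s)))"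
      by (intro sum_mono A) auto
    also have "\<dots> = eta ^ ?s * (K * exp (- t * ?s))"
      using finC by (simp add: K_def card_Pow)
    finally show ?thesis .
  qed
  then show ?thesis using that[OF t K] by blast
qed

end

section \<open>Global weight of atypical vertices and of a single pattern\<close>

context spin_system
begin

text \<open>Finner's \<open>d\<close>-th power turns the tilt into \<open>exp (t * d)\<close>, which
  the local loss \<open>exp (- t * d)\<close> absorbs. What remains is one free choice per
  \<open>d\<close> vertices, so by Markov's inequality more than order \<open>card Od / d\<close>
  atypical vertices are negligible.\<close>

lemma atypical_tilt:
  fixes t K \<epsilon> :: real
  assumes K: "K \<ge> 0" and loc: "\<And>v. v \<in> Od \<Longrightarrow>
     (\<Sum>x | x \<in> N v \<rightarrow>\<^sub>E C \<and> \<not> typical \<epsilon> (N v) x. (\<Prod>u\<in>N v. lam (x u)) * nu (x ` N v) ^ d)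
        \<le> eta ^ d * (K * exp (- t * d))"
  shows "(\<Sum>g\<in>Ev \<rightarrow>\<^sub>E C. W g * exp (t * card {v\<in>Od. \<not> typical \<epsilon> (N v) g}))
          \<le> eta ^ card Od * exp ((2 ^ card C + K) * card Od / d)"
proof -
  define phi where "phi v x = nu (x ` N v) * exp (t * of_bool (\<not> typical \<epsilon> (N v) x))" for v x
  have "(\<Sum>g\<in>Ev \<rightarrow>\<^sub>E C. W g * exp (t * card {v\<in>Od. \<not> typical \<epsilon> (N v) g}))
      = (\<Sum>g\<in>Ev \<rightarrow>\<^sub>E C. (\<Prod>u\<in>Ev. lam (g u)) * (\<Prod>v\<in>Od. phi v (restrict g (N v))))"
  proof (intro sum.cong refl)
    fix g
    have c: "real (card {v\<in>Od. \<not> typical \<epsilon> (N v) g}) = (\<Sum>v\<in>Od. of_bool (\<not> typical \<epsilon> (N v) g))"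
      using finO by (simp add: Int_def)
    show "W g * exp (t * card {v\<in>Od. \<not> typical \<epsilon> (N v) g})
        = (\<Prod>u\<in>Ev. lam (g u)) * (\<Prod>v\<in>Od. phi v (restrict g (N v)))"
      unfolding c sum_distrib_left exp_sum[OF finO]
      by (simp add: W_def phi_def typical_restrict prod.distrib mult.assoc)
  qed
  also have "\<dots> \<le> (\<Prod>v\<in>Od. root d (\<Sum>x\<in>N v \<rightarrow>\<^sub>E C. (\<Prod>u\<in>N v. lam (x u)) * phi v x ^ d))"
  proof (rule Finner[OF finE finO finC d_pos])
    fix u assume u: "u \<in> Ev"
    have "{v \<in> Od. u \<in> N v} = N u" using u N_E(1)[OF u] N_sym[OF u] by auto
    then show "card {v \<in> Od. u \<in> N v} = d" using u N_E(2) by auto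
  next
    fix v x assume "x \<in> N v \<rightarrow>\<^sub>E C"
    then have "x ` N v \<subseteq> C" by (auto simp: PiE_iff)
    then show "0 \<le> phi v x" unfolding phi_def using nu_nonneg by simp
  qed (auto simp: N_O lam_pos less_imp_le)
  also have "\<dots> \<le> eta ^ card Od * exp ((2 ^ card C + K) * card Od / d)"
  proof (rule prod_root_le)
    fix v assume v: "v \<in> Od"
    note fv = finN(2)[OF v] and cv = N_O(2)[OF v]
    let ?P = "\<lambda>x. \<Prod>u\<in>N v. lam (x u)"
    have finF: "finite (N v \<rightarrow>\<^sub>E C)" using fv finC by (intro finite_PiE) auto
    have P0: "?P x \<ge> 0" "nu (x ` N v) \<ge> 0" if "x \<in> N v \<rightarrow>\<^sub>E C" for x
    proof -
      have xS: "x ` N v \<subseteq> C" using that by (auto simp: PiE_iff)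
      then show "nu (x ` N v) \<ge> 0" by (rule nu_nonneg)
      show "?P x \<ge> 0" using xS by (intro prod_nonneg less_imp_le[OF lam_pos]) auto
    qed
    have "(\<Sum>x\<in>N v \<rightarrow>\<^sub>E C. ?P x * phi v x ^ d)
       \<le> (\<Sum>x\<in>N v \<rightarrow>\<^sub>E C. ?P x * (nu (x ` N v) ^ d * 1 * Lam (x ` N v) ^ 0)
            + exp (t * d) * (?P x * nu (x ` N v) ^ d * of_bool (\<not> typical \<epsilon> (N v) x)))"
    proof (rule sum_mono)
      fix x assume x: "x \<in> N v \<rightarrow>\<^sub>E C"
      have "phi v x ^ d = nu (x ` N v) ^ d * exp (t * d * of_bool (\<not> typical \<epsilon> (N v) x))"
        by (simp add: phi_def power_mult_distrib exp_of_nat_mult[symmetric] mult_ac)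
      then show "?P x * phi v x ^ d \<le> ?P x * (nu (x ` N v) ^ d * 1 * Lam (x ` N v) ^ 0)
            + exp (t * d) * (?P x * nu (x ` N v) ^ d * of_bool (\<not> typical \<epsilon> (N v) x))"
        using P0[OF x] by (cases "typical \<epsilon> (N v) x") (auto simp: mult_ac)
    qed
    also have "\<dots> = (\<Sum>x\<in>N v \<rightarrow>\<^sub>E C. ?P x * (nu (x ` N v) ^ d * 1 * Lam (x ` N v) ^ 0))
            + exp (t * d) * (\<Sum>x\<in>N v \<rightarrow>\<^sub>E C. ?P x * nu (x ` N v) ^ d * of_bool (\<not> typical \<epsilon> (N v) x))"
      by (simp add: sum.distrib sum_distrib_left)
    also have "\<dots> \<le> eta ^ d * 2 ^ card C + exp (t * d) * (eta ^ d * (K * exp (- t * d)))"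
    proof (intro add_mono mult_left_mono)
      show "(\<Sum>x\<in>N v \<rightarrow>\<^sub>E C. ?P x * (nu (x ` N v) ^ d * 1 * Lam (x ` N v) ^ 0)) \<le> eta ^ d * 2 ^ card C"
        using fv cv finC by (intro local_sum_le) (auto simp: card_Pow)
      have "(\<Sum>x\<in>N v \<rightarrow>\<^sub>E C. ?P x * nu (x ` N v) ^ d * of_bool (\<not> typical \<epsilon> (N v) x))
         = (\<Sum>x | x \<in> N v \<rightarrow>\<^sub>E C \<and> \<not> typical \<epsilon> (N v) x. ?P x * nu (x ` N v) ^ d)"
        using finF by (intro sum.mono_neutral_cong_right) auto
      then show "(\<Sum>x\<in>N v \<rightarrow>\<^sub>E C. ?P x * nu (x ` N v) ^ d * of_bool (\<not> typical \<epsilon> (N v) x))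
         \<le> eta ^ d * (K * exp (- t * d))" using loc[OF v] by simp
    qed simp
    also have "\<dots> = eta ^ d * (2 ^ card C + K)"
      by (simp add: exp_minus field_simps)
    also have "\<dots> \<le> eta ^ d * (1 + (2 ^ card C + K))"
      using eta_pos by (intro mult_left_mono) auto
    finally have up: "(\<Sum>x\<in>N v \<rightarrow>\<^sub>E C. ?P x * phi v x ^ d) \<le> eta ^ d * (1 + (2 ^ card C + K))" .
    have "0 \<le> (\<Sum>x\<in>N v \<rightarrow>\<^sub>E C. ?P x * phi v x ^ d)"
      using P0 by (intro sum_nonneg mult_nonneg_nonneg) (auto simp: phi_def)
    then show "0 \<le> (\<Sum>x\<in>N v \<rightarrow>\<^sub>E C. ?P x * phi v x ^ d) \<and>
      (\<Sum>x\<in>N v \<rightarrow>\<^sub>E C. ?P x * phi v x ^ d) \<le> eta ^ d * (1 + (2 ^ card C + K))" using up by simp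
  qed (use K in simp)
  finally show ?thesis .
qed

text \<open>Colourings of the even class by \<open>A\<close> alone suffice: every odd vertex then
  has weight at least \<open>nu A\<close>, which gives \<open>eta ^ card Od\<close> times the
  probability that independent colours have frequencies near \<open>share A\<close>.\<close>

lemma phase_weight_ge:
  assumes A: "dominant A" and \<epsilon>: "0 < \<epsilon>" "\<epsilon> \<le> 1" and neE: "Ev \<noteq> {}"
  shows "eta ^ card Od * (1 - 2 * card C * exp (- \<epsilon>\<^sup>2 / 4 * card Od))
     \<le> (\<Sum>g | g \<in> Ev \<rightarrow>\<^sub>E C \<and> (\<forall>a\<in>C. \<bar>freq Ev (\<lambda>u. g u = a) - share A a\<bar> \<le> \<epsilon>). W g)"
proof -
  have AC: "A \<subseteq> C" using A by (simp add: dominant_def)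
  let ?P = "\<lambda>x. \<Prod>u\<in>Ev. lam (x u)"
  let ?D = "\<lambda>a. {x. x \<in> Ev \<rightarrow>\<^sub>E A \<and> \<epsilon> < \<bar>freq Ev (\<lambda>u. x u = a) - lam a / sum lam A\<bar>}"
  let ?G = "{g \<in> Ev \<rightarrow>\<^sub>E A. \<forall>a\<in>A. \<bar>freq Ev (\<lambda>u. g u = a) - share A a\<bar> \<le> \<epsilon>}"
  have finA: "finite (Ev \<rightarrow>\<^sub>E A)" using finE fin_sub[OF AC] by (intro finite_PiE) auto
  have AE: "g \<in> Ev \<rightarrow>\<^sub>E C" if "g \<in> Ev \<rightarrow>\<^sub>E A" for g using that AC by (auto simp: PiE_iff)
  have PA: "?P x \<ge> 0" if "x \<in> Ev \<rightarrow>\<^sub>E A" for x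
    using AE[OF that] by (intro prod_nonneg less_imp_le[OF lam_pos]) (auto simp: PiE_iff)
  have "sum lam A ^ card Ev = (\<Sum>g\<in>Ev \<rightarrow>\<^sub>E A. ?P g)"
    using finE fin_sub[OF AC] by (simp add: sum_PiE_prod_const)
  also have "\<dots> \<le> (\<Sum>g\<in>?G. ?P g) + (\<Sum>a\<in>A. \<Sum>x\<in>?D a. ?P x)"
  proof -
    have "(\<Sum>g\<in>Ev \<rightarrow>\<^sub>E A. ?P g) \<le> (\<Sum>g\<in>Ev \<rightarrow>\<^sub>E A. ?P g * of_bool (g \<in> ?G) + (\<Sum>a\<in>A. ?P g * of_bool (g \<in> ?D a)))"
    proof (rule sum_mono)
      fix g assume g: "g \<in> Ev \<rightarrow>\<^sub>E A"
      show "?P g \<le> ?P g * of_bool (g \<in> ?G) + (\<Sum>a\<in>A. ?P g * of_bool (g \<in> ?D a))"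
      proof (cases "g \<in> ?G")
        case True
        have "0 \<le> (\<Sum>a\<in>A. ?P g * of_bool (g \<in> ?D a))"
          using PA[OF g] by (intro sum_nonneg mult_nonneg_nonneg) auto
        moreover have "of_bool (g \<in> ?G) = (1::real)" by (simp only: True of_bool_eq)
        ultimately show ?thesis by (simp only: mult_1_right le_add_same_cancel1)
      next
        case False
        then obtain a where a: "a \<in> A" "g \<in> ?D a" using g by (auto simp: share_def)
        have "?P g = ?P g * of_bool (g \<in> ?D a)" using a by simp
        also have "\<dots> \<le> (\<Sum>a\<in>A. ?P g * of_bool (g \<in> ?D a))"
          using a(1) fin_sub[OF AC] PA[OF g] by (intro member_le_sum) auto
        finally have "?P g \<le> (\<Sum>a\<in>A. ?P g * of_bool (g \<in> ?D a))" .
        moreover have "of_bool (g \<in> ?G) = (0::real)" by (simp only: False of_bool_eq)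
        ultimately show ?thesis by (simp only: mult_zero_right add_0)
      qed
    qed
    also have "\<dots> = (\<Sum>g\<in>Ev \<rightarrow>\<^sub>E A. ?P g * of_bool (g \<in> ?G)) + (\<Sum>a\<in>A. \<Sum>g\<in>Ev \<rightarrow>\<^sub>E A. ?P g * of_bool (g \<in> ?D a))"
      unfolding sum.distrib by (subst (2) sum.swap) simp
    also have "(\<Sum>g\<in>Ev \<rightarrow>\<^sub>E A. ?P g * of_bool (g \<in> ?G)) = (\<Sum>g\<in>?G. ?P g)"
      using finA by (intro sum.mono_neutral_cong_right) auto
    also have "(\<Sum>a\<in>A. \<Sum>g\<in>Ev \<rightarrow>\<^sub>E A. ?P g * of_bool (g \<in> ?D a)) = (\<Sum>a\<in>A. \<Sum>g\<in>?D a. ?P g)"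
      using finA by (intro sum.cong refl sum.mono_neutral_cong_right) auto
    finally show ?thesis .
  qed
  also have "(\<Sum>a\<in>A. \<Sum>x\<in>?D a. ?P x) \<le> (\<Sum>a\<in>A. 2 * sum lam A ^ card Ev * exp (- \<epsilon>\<^sup>2 / 4 * card Ev))"
    using finE neE fin_sub[OF AC] AC lam_pos \<epsilon> by (intro sum_mono Chernoff_weighted) auto
  also have "\<dots> \<le> card C * (2 * sum lam A ^ card Ev * exp (- \<epsilon>\<^sup>2 / 4 * card Ev))"
    using card_mono[OF finC AC] sum_nonneg_lam[OF AC] by (simp add: mult_right_mono)
  finally have "sum lam A ^ card Ev * (1 - 2 * card C * exp (- \<epsilon>\<^sup>2 / 4 * card Ev)) \<le> (\<Sum>g\<in>?G. ?P g)"
    by (simp add: algebra_simps)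
  then have "sum lam A ^ card Ev * (1 - 2 * card C * exp (- \<epsilon>\<^sup>2 / 4 * card Ev)) * nu A ^ card Od
      \<le> (\<Sum>g\<in>?G. ?P g) * nu A ^ card Od"
    using nu_nonneg[OF AC] by (intro mult_right_mono) auto
  also have "\<dots> \<le> (\<Sum>g\<in>?G. W g)"
    unfolding sum_distrib_right W_def
  proof (intro sum_mono mult_left_mono)
    fix g assume g: "g \<in> ?G"
    then show "0 \<le> ?P g" using PA by simp
    have "(\<Prod>v\<in>Od. nu A) \<le> (\<Prod>v\<in>Od. nu (g ` N v))"
    proof (intro prod_mono conjI)
      fix v assume "v \<in> Od"
      then have "g ` N v \<subseteq> A" using g N_O(1) by (auto simp: PiE_iff)
      then show "nu A \<le> nu (g ` N v)" using AC by (rule nu_anti)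
    qed (rule nu_nonneg[OF AC])
    then show "nu A ^ card Od \<le> (\<Prod>v\<in>Od. nu (g ` N v))" by simp
  qed
  also have "\<dots> \<le> (\<Sum>g | g \<in> Ev \<rightarrow>\<^sub>E C \<and> (\<forall>a\<in>C. \<bar>freq Ev (\<lambda>u. g u = a) - share A a\<bar> \<le> \<epsilon>). W g)"
  proof (rule sum_mono2)
    show "finite {g. g \<in> Ev \<rightarrow>\<^sub>E C \<and> (\<forall>a\<in>C. \<bar>freq Ev (\<lambda>u. g u = a) - share A a\<bar> \<le> \<epsilon>)}"
      using finE finC by (intro finite_subset[OF _ finite_PiE[of Ev "\<lambda>_. C"]]) auto
    show "?G \<subseteq> {g. g \<in> Ev \<rightarrow>\<^sub>E C \<and> (\<forall>a\<in>C. \<bar>freq Ev (\<lambda>u. g u = a) - share A a\<bar> \<le> \<epsilon>)}"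
    proof safe
      fix g a assume g: "g \<in> Ev \<rightarrow>\<^sub>E A" "\<forall>a\<in>A. \<bar>freq Ev (\<lambda>u. g u = a) - share A a\<bar> \<le> \<epsilon>" and a: "a \<in> C"
      show "\<bar>freq Ev (\<lambda>u. g u = a) - share A a\<bar> \<le> \<epsilon>"
      proof (cases "a \<in> A")
        case False
        then have z: "{u\<in>Ev. g u = a} = {}" using g(1) by (auto simp: PiE_iff)
        show ?thesis using False \<epsilon> unfolding freq_def z share_def by simp
      qed (use g in simp)
    qed (use AE in auto)
  qed (auto intro: W_nonneg)
  also have "sum lam A ^ card Ev * (1 - 2 * card C * exp (- \<epsilon>\<^sup>2 / 4 * card Ev)) * nu A ^ card Od
      = eta ^ card Od * (1 - 2 * card C * exp (- \<epsilon>\<^sup>2 / 4 * card Od))"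
    using A by (simp add: card_Ev dominant_def[of A] power_mult_distrib[symmetric] mult.commute mult.left_commute)
  finally show ?thesis .
qed

end

section \<open>Averaging over the sample\<close>

text \<open>Counting over \<open>Pow X\<close> plays the role of a uniform random sample, which
  misses all of \<open>Q\<close> with probability \<open>(1 / 2) ^ card Q\<close>.\<close>

lemma card_Pow_disjoint:
  assumes "finite X" "Q \<subseteq> X"
  shows "real (card {Y \<in> Pow X. Y \<inter> Q = {}}) = 2 ^ card X * (1 / 2) ^ card Q"
proof -
  have "{Y \<in> Pow X. Y \<inter> Q = {}} = Pow (X - Q)" by auto
  then have "real (card {Y \<in> Pow X. Y \<inter> Q = {}}) = 2 ^ (card X - card Q)"
    using assms by (simp add: card_Pow card_Diff_subset finite_subset)
  also have "\<dots> = 2 ^ card X * (1 / 2) ^ card Q"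
    using card_mono[OF assms] by (simp add: power_diff power_one_over)
  finally show ?thesis .
qed

lemma freq_Times:
  assumes "finite D" "D \<noteq> {}"
  shows "freq (D \<times> D) (\<lambda>(w, w'). P w) = freq D P" "freq (D \<times> D) (\<lambda>(w, w'). P w') = freq D P"
proof -
  have "{p \<in> D \<times> D. case p of (w, w') \<Rightarrow> P w} = {w\<in>D. P w} \<times> D"
    "{p \<in> D \<times> D. case p of (w, w') \<Rightarrow> P w'} = D \<times> {w\<in>D. P w}" by auto
  then show "freq (D \<times> D) (\<lambda>(w, w'). P w) = freq D P" "freq (D \<times> D) (\<lambda>(w, w'). P w') = freq D P"
    using assms by (auto simp: freq_def card_cartesian_product)
qed

context spin_system
begin

definition atyp :: "real \<Rightarrow> ('v \<Rightarrow> 'c) \<Rightarrow> nat" where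
  "atyp \<epsilon> g = card {v\<in>Od. \<not> typical \<epsilon> (N v) g}"

lemma atyp_eq: "real (atyp \<epsilon> g) = (\<Sum>v\<in>Od. of_bool (\<not> typical \<epsilon> (N v) g))"
  using finO by (simp add: atyp_def Int_def)

lemma card_unseen:
  assumes w: "w \<in> Od"
  shows "(\<Sum>E0\<in>Pow Ev. of_bool (a \<notin> seen E0 g w)) = 2 ^ card Ev * (1 / 2 :: real) ^ card {u\<in>N w. g u = a}"
proof -
  let ?Q = "{u\<in>N w. g u = a}"
  have "(\<Sum>E0\<in>Pow Ev. of_bool (a \<notin> seen E0 g w)) = real (card {E0 \<in> Pow Ev. a \<notin> seen E0 g w})"
    using finE by (simp add: Int_def)
  also have "{E0 \<in> Pow Ev. a \<notin> seen E0 g w} = {E0 \<in> Pow Ev. E0 \<inter> ?Q = {}}"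
    by (auto simp: seen_def)
  also have "real (card \<dots>) = 2 ^ card Ev * (1 / 2) ^ card ?Q"
    using finE N_O(1)[OF w] by (intro card_Pow_disjoint) auto
  finally show ?thesis .
qed

text \<open>In a typical neighbourhood the frequency of a present colour is within
  \<open>\<epsilon>\<close> of a share of at least \<open>2 * \<epsilon>\<close>, so it occurs at
  least \<open>\<epsilon> * d\<close> times. The left hand side is the probability that the sample
  misses all its occurrences.\<close>

lemma typical_count:
  fixes \<epsilon> :: real
  assumes \<epsilon>: "\<And>A a. A \<subseteq> C \<Longrightarrow> a \<in> A \<Longrightarrow> share A a \<ge> 2 * \<epsilon>" "\<epsilon> > 0"
    and w: "w \<in> Od" "typical \<epsilon> (N w) g" and a: "a \<in> g ` N w"
  shows "(1 / 2) ^ card {u\<in>N w. g u = a} \<le> (1 / 2 :: real) powr (\<epsilon> * d)"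
proof -
  have "\<bar>freq (N w) (\<lambda>u. g u = a) - share (g ` N w) a\<bar> \<le> \<epsilon>" "g ` N w \<subseteq> C"
    using w(2) a by (auto simp: typical_def dominant_def)
  then have "\<epsilon> \<le> freq (N w) (\<lambda>u. g u = a)" using \<epsilon>(1)[of "g ` N w" a] a by linarith
  then have "\<epsilon> * d \<le> card {u\<in>N w. g u = a}"
    using d_pos by (simp add: freq_def N_O(2)[OF w(1)] field_simps)
  then have "(1 / 2 :: real) powr card {u\<in>N w. g u = a} \<le> (1 / 2) powr (\<epsilon> * d)"
    by (intro powr_mono') auto
  then show ?thesis by (simp add: powr_realpow)
qed

lemma sum_unseen:
  fixes F :: "'v set \<Rightarrow> 'v \<Rightarrow> real"
  shows "(\<Sum>E0\<in>Pow Ev. \<Sum>u\<in>Ev - E0. F E0 u) = (\<Sum>u\<in>Ev. \<Sum>E0 | E0 \<in> Pow Ev \<and> u \<notin> E0. F E0 u)"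
proof -
  have "(\<Sum>E0\<in>Pow Ev. \<Sum>u\<in>Ev - E0. F E0 u) = (\<Sum>E0\<in>Pow Ev. \<Sum>u | u \<in> Ev \<and> u \<notin> E0. F E0 u)"
    by (intro sum.cong) auto
  also have "\<dots> = (\<Sum>u\<in>Ev. \<Sum>E0 | E0 \<in> Pow Ev \<and> u \<notin> E0. F E0 u)"
    using finE by (intro sum.swap_restrict) auto
  finally show ?thesis .
qed

text \<open>The factor \<open>2 ^ card Ev\<close> normalises the average over samples. A colour
  occurring \<open>k\<close> times around an odd vertex is missed with probability
  \<open>(1 / 2) ^ k\<close> and charged by \<open>k\<close> neighbours; at an atypical vertex this
  totals at most one per colour, whence \<open>card C / d\<close>.\<close>

lemma avg_miss:
  fixes \<epsilon> :: real
  assumes \<epsilon>: "\<And>A a. A \<subseteq> C \<Longrightarrow> a \<in> A \<Longrightarrow> share A a \<ge> 2 * \<epsilon>" "\<epsilon> > 0"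
    and g: "g \<in> Ev \<rightarrow>\<^sub>E C"
  shows "(\<Sum>E0\<in>Pow Ev. \<Sum>u\<in>Ev - E0. miss E0 g u (g u))
     \<le> 2 ^ card Ev * (card Od * (1 / 2) powr (\<epsilon> * d) + atyp \<epsilon> g * card C / d)"
proof -
  let ?c = "\<lambda>w u. card {u'\<in>N w. g u' = g u}"
  let ?\<delta> = "(1 / 2 :: real) powr (\<epsilon> * d)"
  have "(\<Sum>E0\<in>Pow Ev. \<Sum>u\<in>Ev - E0. miss E0 g u (g u))
      \<le> (\<Sum>u\<in>Ev. \<Sum>E0\<in>Pow Ev. miss E0 g u (g u))"
    unfolding sum_unseen using finE by (intro sum_mono sum_mono2) (auto simp: miss_def freq_nonneg)
  also have "\<dots> = (\<Sum>u\<in>Ev. \<Sum>E0\<in>Pow Ev. \<Sum>w\<in>N u. of_bool (g u \<notin> seen E0 g w) / d)"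
    by (intro sum.cong refl) (simp add: miss_def freq_eq_sum finN(1) N_E(2) sum_divide_distrib del: sum_of_bool_eq)
  also have "\<dots> = (\<Sum>u\<in>Ev. \<Sum>w\<in>N u. \<Sum>E0\<in>Pow Ev. of_bool (g u \<notin> seen E0 g w) / d)"
    by (intro sum.cong refl) (rule sum.swap)
  also have "\<dots> = (\<Sum>u\<in>Ev. \<Sum>w\<in>N u. 2 ^ card Ev * ((1 / 2) ^ ?c w u / d))"
  proof (intro sum.cong refl)
    fix u w assume "u \<in> Ev" "w \<in> N u"
    then have "w \<in> Od" using N_E(1) by auto
    then show "(\<Sum>E0\<in>Pow Ev. of_bool (g u \<notin> seen E0 g w) / d) = 2 ^ card Ev * ((1 / 2) ^ ?c w u / d)"
      by (simp only: sum_divide_distrib[symmetric] card_unseen times_divide_eq_right)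
  qed
  also have "\<dots> = 2 ^ card Ev * (\<Sum>u\<in>Ev. \<Sum>w\<in>N u. (1 / 2) ^ ?c w u / d)"
    by (simp only: sum_distrib_left)
  also have "(\<Sum>u\<in>Ev. \<Sum>w\<in>N u. (1 / 2) ^ ?c w u / d) = (\<Sum>w\<in>Od. \<Sum>u\<in>N w \<inter> Ev. (1 / 2) ^ ?c w u / d)"
    by (rule sum_swap_edges) simp
  also have "\<dots> \<le> (\<Sum>w\<in>Od. ?\<delta> + of_bool (\<not> typical \<epsilon> (N w) g) * (card C / d))"
  proof (intro sum_mono)
    fix w assume w: "w \<in> Od"
    have NE: "N w \<inter> Ev = N w" using N_O(1)[OF w] by auto
    show "(\<Sum>u\<in>N w \<inter> Ev. (1 / 2) ^ ?c w u / d) \<le> ?\<delta> + of_bool (\<not> typical \<epsilon> (N w) g) * (card C / d)"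
    proof (cases "typical \<epsilon> (N w) g")
      case True
      have "(\<Sum>u\<in>N w. (1 / 2) ^ ?c w u / d) \<le> (\<Sum>u\<in>N w. ?\<delta> / d)"
        using True by (intro sum_mono divide_right_mono typical_count[OF \<epsilon> w]) auto
      then show ?thesis using True d_pos by (simp add: NE N_O(2)[OF w])
    next
      case False
      have "(\<Sum>u\<in>N w. (1 / 2 :: real) ^ ?c w u) = (\<Sum>a\<in>C. \<Sum>u | u \<in> N w \<and> g u = a. (1 / 2) ^ ?c w u)"
        using finN(2)[OF w] finC image_sub[OF g w] by (intro sum.group[symmetric]) auto
      also have "\<dots> \<le> (\<Sum>a\<in>C. 1)"
      proof (intro sum_mono)
        fix a
        let ?n = "card {u'\<in>N w. g u' = a}"
        have "(\<Sum>u | u \<in> N w \<and> g u = a. (1 / 2 :: real) ^ ?c w u) = (\<Sum>u | u \<in> N w \<and> g u = a. (1 / 2) ^ ?n)"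
          by (intro sum.cong) auto
        also have "\<dots> = ?n * (1 / 2) ^ ?n" by simp
        also have "\<dots> \<le> 1"
        proof -
          have "real ?n \<le> 2 ^ ?n" by (rule order.strict_implies_order) (rule of_nat_less_two_power)
          then show ?thesis by (simp add: power_one_over field_simps)
        qed
        finally show "(\<Sum>u | u \<in> N w \<and> g u = a. (1 / 2 :: real) ^ ?c w u) \<le> 1" .
      qed
      finally have "(\<Sum>u\<in>N w. (1 / 2) ^ ?c w u / d) \<le> card C / d"
        using d_pos by (simp add: sum_divide_distrib[symmetric] divide_right_mono)
      then show ?thesis using False by (simp add: NE add_increasing)
    qed
  qed
  also have "\<dots> = card Od * ?\<delta> + atyp \<epsilon> g * card C / d"
    unfolding sum.distrib sum_distrib_right[symmetric] atyp_eq[symmetric] by simp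
  finally show ?thesis by (simp add: mult_left_mono)
qed

text \<open>A sampled colour set can only be too small, so an error at a typical vertex means that
  one of at most \<open>card C\<close> colours was missed. Atypical vertices are simply counted as
  wrong.\<close>

lemma avg_wrong:
  fixes \<epsilon> :: real
  assumes \<epsilon>: "\<And>A a. A \<subseteq> C \<Longrightarrow> a \<in> A \<Longrightarrow> share A a \<ge> 2 * \<epsilon>" "\<epsilon> > 0"
    and g: "g \<in> Ev \<rightarrow>\<^sub>E C"
  shows "(\<Sum>E0\<in>Pow Ev. real (card {w\<in>Od. seen E0 g w \<noteq> g ` N w}))
     \<le> 2 ^ card Ev * (card Od * card C * (1 / 2) powr (\<epsilon> * d) + atyp \<epsilon> g)"
proof -
  let ?\<delta> = "(1 / 2 :: real) powr (\<epsilon> * d)"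
  have "(\<Sum>E0\<in>Pow Ev. real (card {w\<in>Od. seen E0 g w \<noteq> g ` N w}))
      = (\<Sum>E0\<in>Pow Ev. \<Sum>w\<in>Od. of_bool (seen E0 g w \<noteq> g ` N w))"
    using finO by (simp add: Int_def)
  also have "\<dots> = (\<Sum>w\<in>Od. \<Sum>E0\<in>Pow Ev. of_bool (seen E0 g w \<noteq> g ` N w))" by (rule sum.swap)
  also have "\<dots> \<le> (\<Sum>w\<in>Od. 2 ^ card Ev * (card C * ?\<delta> + of_bool (\<not> typical \<epsilon> (N w) g)))"
  proof (rule sum_mono)
    fix w assume w: "w \<in> Od"
    have fg: "finite (g ` N w)" using finN(2)[OF w] by simp
    show "(\<Sum>E0\<in>Pow Ev. of_bool (seen E0 g w \<noteq> g ` N w))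
        \<le> 2 ^ card Ev * (card C * ?\<delta> + of_bool (\<not> typical \<epsilon> (N w) g))"
    proof (cases "typical \<epsilon> (N w) g")
      case True
      have "(\<Sum>E0\<in>Pow Ev. of_bool (seen E0 g w \<noteq> g ` N w))
          \<le> (\<Sum>E0\<in>Pow Ev. \<Sum>a\<in>g ` N w. of_bool (a \<notin> seen E0 g w) :: real)"
      proof (rule sum_mono)
        fix E0
        show "of_bool (seen E0 g w \<noteq> g ` N w) \<le> (\<Sum>a\<in>g ` N w. of_bool (a \<notin> seen E0 g w) :: real)"
        proof (cases "seen E0 g w = g ` N w")
          case False
          have "seen E0 g w \<subseteq> g ` N w" by (auto simp: seen_def)
          then obtain a where a: "a \<in> g ` N w" "a \<notin> seen E0 g w" using False by blast
          have "(1::real) = of_bool (a \<notin> seen E0 g w)" using a by simp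
          also have "\<dots> \<le> (\<Sum>a\<in>g ` N w. of_bool (a \<notin> seen E0 g w))"
            using a(1) fg by (intro member_le_sum) auto
          finally show ?thesis using False by simp
        qed (simp add: sum_nonneg)
      qed
      also have "\<dots> = (\<Sum>a\<in>g ` N w. \<Sum>E0\<in>Pow Ev. of_bool (a \<notin> seen E0 g w))" by (rule sum.swap)
      also have "\<dots> \<le> (\<Sum>a\<in>g ` N w. 2 ^ card Ev * ?\<delta>)"
        unfolding card_unseen[OF w] by (intro sum_mono mult_left_mono typical_count[OF \<epsilon> w True]) auto
      also have "\<dots> = card (g ` N w) * (2 ^ card Ev * ?\<delta>)" by simp
      also have "\<dots> \<le> card C * (2 ^ card Ev * ?\<delta>)"
        using card_mono[OF finC image_sub[OF g w]] by (intro mult_right_mono) auto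
      finally show ?thesis using True by (simp add: mult_ac)
    next
      case False
      have "(\<Sum>E0\<in>Pow Ev. of_bool (seen E0 g w \<noteq> g ` N w)) \<le> (\<Sum>E0\<in>Pow Ev. 1::real)"
        by (intro sum_mono) auto
      also have "\<dots> = 2 ^ card Ev * 1" using finE by (simp add: card_Pow)
      also have "\<dots> \<le> 2 ^ card Ev * (card C * ?\<delta> + of_bool (\<not> typical \<epsilon> (N w) g))"
        using False by (intro mult_left_mono) auto
      finally show ?thesis .
    qed
  qed
  also have "\<dots> = 2 ^ card Ev * (card Od * card C * ?\<delta> + atyp \<epsilon> g)"
    unfolding sum_distrib_left[symmetric] sum.distrib atyp_eq[symmetric] by simp
  finally show ?thesis .
qed

text \<open>Moving \<open>u\<close> into the sample \<open>E0\<close> changes the sampled colour sets of its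
  neighbours only where the colour of \<open>u\<close> was missed before.\<close>

lemma dis_insert:
  assumes u: "u \<in> Ev"
  shows "dis (insert u E0) g u \<le> dis E0 g u + 2 * miss E0 g u (g u)"
proof -
  let ?Q = "\<lambda>i::nat. if i = 0 then (\<lambda>(w, w'). seen E0 g w \<noteq> seen E0 g w')
     else if i = 1 then (\<lambda>(w, w'). g u \<notin> seen E0 g w) else (\<lambda>(w, w'). g u \<notin> seen E0 g w')"
  have H: "seen (insert u E0) g w = insert (g u) (seen E0 g w)" if "w \<in> N u" for w
    using that u N_sym[OF u, of w] N_E(1)[OF u] by (auto simp: seen_def)
  have "dis (insert u E0) g u \<le> (\<Sum>i\<in>{0,1,2}. freq (N u \<times> N u) (?Q i))"
    unfolding dis_def
  proof (rule freq_union_le)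
    fix p assume p: "p \<in> N u \<times> N u" "case p of (w, w') \<Rightarrow> seen (insert u E0) g w \<noteq> seen (insert u E0) g w'"
    obtain w w' where p_eq: "p = (w, w')" by (cases p)
    show "\<exists>i\<in>{0,1,2}. ?Q i p"
      using p H[of w] H[of w'] by (auto simp: p_eq insert_absorb)
  qed (use finN(1)[OF u] in auto)
  then show ?thesis
    using freq_Times[OF finN(1)[OF u] neN(1)[OF u], of "\<lambda>w. g u \<notin> seen E0 g w"]
    by (simp add: dis_def miss_def)
qed

text \<open>Samples with and without \<open>u\<close> are paired by inserting \<open>u\<close>.
  Disagreement can only be exploited at unsampled vertices; the pairing shows that, up to missed
  colours, half of it is found there.\<close>

lemma avg_dis:
  "(\<Sum>E0\<in>Pow Ev. \<Sum>u\<in>Ev. dis E0 g u) \<le>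
     2 * (\<Sum>E0\<in>Pow Ev. \<Sum>u\<in>Ev - E0. dis E0 g u) + 2 * (\<Sum>E0\<in>Pow Ev. \<Sum>u\<in>Ev - E0. miss E0 g u (g u))"
proof -
  have "(\<Sum>E0\<in>Pow Ev. dis E0 g u) \<le> 2 * (\<Sum>E0 | E0 \<in> Pow Ev \<and> u \<notin> E0. dis E0 g u)
       + 2 * (\<Sum>E0 | E0 \<in> Pow Ev \<and> u \<notin> E0. miss E0 g u (g u))" if u: "u \<in> Ev" for u
  proof -
    let ?P = "{E0. E0 \<in> Pow Ev \<and> u \<notin> E0}"
    have fin: "finite ?P" using finE by simp
    have un: "Pow Ev = ?P \<union> insert u ` ?P"
    proof (intro equalityI subsetI)
      fix X assume X: "X \<in> Pow Ev"
      show "X \<in> ?P \<union> insert u ` ?P"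
      proof (cases "u \<in> X")
        case True
        then have "X = insert u (X - {u})" "X - {u} \<in> ?P" using X by auto
        then show ?thesis by blast
      qed (use X in auto)
    qed (use u in auto)
    have inj: "inj_on (insert u) ?P" by (rule inj_onI) auto
    have "(\<Sum>E0\<in>Pow Ev. dis E0 g u) = (\<Sum>E0\<in>?P. dis E0 g u) + (\<Sum>E0\<in>insert u ` ?P. dis E0 g u)"
      by (subst un, rule sum.union_disjoint) (use fin in auto)
    also have "(\<Sum>E0\<in>insert u ` ?P. dis E0 g u) = (\<Sum>E0\<in>?P. dis (insert u E0) g u)"
      using inj by (simp add: sum.reindex)
    also have "\<dots> \<le> (\<Sum>E0\<in>?P. dis E0 g u + 2 * miss E0 g u (g u))"
      by (intro sum_mono dis_insert u)
    finally show ?thesis by (simp add: sum.distrib sum_distrib_left)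
  qed
  then have "(\<Sum>u\<in>Ev. \<Sum>E0\<in>Pow Ev. dis E0 g u) \<le> (\<Sum>u\<in>Ev. 2 * (\<Sum>E0 | E0 \<in> Pow Ev \<and> u \<notin> E0. dis E0 g u)
       + 2 * (\<Sum>E0 | E0 \<in> Pow Ev \<and> u \<notin> E0. miss E0 g u (g u)))"
    by (rule sum_mono)
  then show ?thesis
    unfolding sum_unseen by (subst sum.swap) (simp add: sum.distrib sum_distrib_left)
qed

end

section \<open>Geometry of the torus\<close>

definition shift :: "nat \<Rightarrow> nat \<Rightarrow> (nat \<Rightarrow> nat) \<Rightarrow> nat \<Rightarrow> nat" where
  "shift m k x = x(k := (x k + 1) mod m)"

definition translate :: "nat \<Rightarrow> nat set \<Rightarrow> (nat \<Rightarrow> nat) \<Rightarrow> (nat \<Rightarrow> nat) \<Rightarrow> nat \<Rightarrow> nat" where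
  "translate m B s x = (\<lambda>i. if i \<in> B then (x i + s i) mod m else x i)"

definition nbs :: "nat \<Rightarrow> nat \<Rightarrow> (nat \<Rightarrow> nat) \<Rightarrow> (nat \<Rightarrow> nat) set" where
  "nbs m n x = {y \<in> torus m n. torus_adj m n x y}"

lemma finite_torus: "finite (torus m n)"
  unfolding torus_def by (intro finite_PiE) auto

lemma card_torus: "card (torus m n) = m ^ n"
  unfolding torus_def by (simp add: card_PiE)

lemma torus_iff: "x \<in> torus m n \<longleftrightarrow> (\<forall>i<n. x i < m) \<and> (\<forall>i\<ge>n. x i = undefined)"
  by (auto simp: torus_def PiE_iff extensional_def)

lemma shift_torus: "x \<in> torus m n \<Longrightarrow> k < n \<Longrightarrow> m > 0 \<Longrightarrow> shift m k x \<in> torus m n"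
  by (auto simp: torus_iff shift_def)

lemma translate_torus:
  "x \<in> torus m n \<Longrightarrow> B \<subseteq> {..<n} \<Longrightarrow> m > 0 \<Longrightarrow> translate m B s x \<in> torus m n"
  by (auto simp: torus_iff translate_def)

lemma mod_add_eq_cancel:
  fixes a b c m :: nat
  assumes "a < m" "b < m" "(a + c) mod m = (b + c) mod m"
  shows "a = b"
proof -
  have "[a + c = b + c] (mod m)" using assms(3) by (simp add: cong_def)
  then have "[a = b] (mod m)" by (simp add: cong_add_rcancel_nat)
  then show ?thesis using assms(1,2) by (simp add: cong_def)
qed

lemma inj_shift: "k < n \<Longrightarrow> inj_on (shift m k) (torus m n)"
proof (rule inj_onI)
  fix x y assume k: "k < n" and x: "x \<in> torus m n" and y: "y \<in> torus m n" and e: "shift m k x = shift m k y"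
  show "x = y"
  proof
    fix i
    have ei: "shift m k x i = shift m k y i" using e by simp
    show "x i = y i"
    proof (cases "i = k")
      case True
      then show ?thesis using ei x y k mod_add_eq_cancel[of "x k" m "y k" 1]
        by (auto simp: shift_def torus_iff)
    next
      case False then show ?thesis using ei by (simp add: shift_def)
    qed
  qed
qed

lemma bij_shift:
  assumes "k < n" "m > 0"
  shows "bij_betw (shift m k) (torus m n) (torus m n)"
  unfolding bij_betw_def
  using inj_shift[OF assms(1)] assms
  by (auto intro!: endo_inj_surj[OF finite_torus] shift_torus)

lemma inj_translate: "B \<subseteq> {..<n} \<Longrightarrow> inj_on (translate m B s) (torus m n)"
proof (rule inj_onI)
  fix x y assume B: "B \<subseteq> {..<n}" and x: "x \<in> torus m n" and y: "y \<in> torus m n"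
    and e: "translate m B s x = translate m B s y"
  show "x = y"
  proof
    fix i
    have ei: "translate m B s x i = translate m B s y i" using e by simp
    show "x i = y i"
    proof (cases "i \<in> B")
      case True
      then have "i < n" using B by auto
      then show ?thesis using True ei x y mod_add_eq_cancel[of "x i" m "y i" "s i"]
        by (auto simp: translate_def torus_iff)
    next
      case False then show ?thesis using ei by (simp add: translate_def)
    qed
  qed
qed

lemma bij_translate:
  assumes "B \<subseteq> {..<n}" "m > 0"
  shows "bij_betw (translate m B s) (torus m n) (torus m n)"
  unfolding bij_betw_def
  using inj_translate[OF assms(1)] assms
  by (auto intro!: endo_inj_surj[OF finite_torus] translate_torus)

lemma translate_commute: "x \<in> torus m n \<Longrightarrow> s \<in> torus m n \<Longrightarrow> translate m {..<n} s x = translate m {..<n} x s"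
  by (auto simp: translate_def torus_iff fun_eq_iff add.commute)

lemma shift_pow:
  assumes "m > 0" "x k < m"
  shows "(shift m k ^^ j) x = x(k := (x k + j) mod m)"
proof (induction j)
  case 0 then show ?case using assms by (simp add: fun_eq_iff)
next
  case (Suc j) then show ?case by (simp add: shift_def fun_eq_iff mod_Suc_eq)
qed

text \<open>The displacement is subadditive under composition of bijections of the torus.\<close>

lemma displacement_translate:
  fixes a :: "(nat \<Rightarrow> nat) \<Rightarrow> 't"
  assumes m: "m > 0" and B: "B \<subseteq> {..<n}"
  shows "card {x \<in> torus m n. a x \<noteq> a (translate m B s x)}
    \<le> (\<Sum>k\<in>B. s k * card {x \<in> torus m n. a x \<noteq> a (shift m k x)})"
proof -
  let ?X = "torus m n"
  define P where "P f = card {x \<in> ?X. a x \<noteq> a (f x)}" for f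
  have comp: "P (h \<circ> f) \<le> P f + P h" if f: "bij_betw f ?X ?X" for f h
  proof -
    have "{x \<in> ?X. a x \<noteq> a ((h \<circ> f) x)} \<subseteq> {x \<in> ?X. a x \<noteq> a (f x)} \<union> {x \<in> ?X. a (f x) \<noteq> a (h (f x))}"
      by auto
    then have "P (h \<circ> f) \<le> card ({x \<in> ?X. a x \<noteq> a (f x)} \<union> {x \<in> ?X. a (f x) \<noteq> a (h (f x))})"
      unfolding P_def using finite_torus[of m n] by (intro card_mono) auto
    also have "\<dots> \<le> P f + card {x \<in> ?X. a (f x) \<noteq> a (h (f x))}"
      unfolding P_def by (rule card_Un_le)
    also have "card {x \<in> ?X. a (f x) \<noteq> a (h (f x))} \<le> P h"
      unfolding P_def using f finite_torus[of m n]
      by (intro card_inj_on_le[of f]) (auto simp: bij_betw_def inj_on_def)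
    finally show ?thesis by simp
  qed
  have pow: "bij_betw (shift m k ^^ j) ?X ?X \<and> P (shift m k ^^ j) \<le> j * P (shift m k)" if k: "k < n" for k j
  proof (induction j)
    case 0 then show ?case by (simp add: P_def bij_betw_def)
  next
    case (Suc j)
    then have "bij_betw (shift m k \<circ> (shift m k ^^ j)) ?X ?X"
      using bij_shift[OF k m] by (blast intro: bij_betw_trans)
    moreover have "P (shift m k \<circ> (shift m k ^^ j)) \<le> P (shift m k ^^ j) + P (shift m k)"
      using Suc by (intro comp) auto
    ultimately show ?case using Suc unfolding funpow.simps(2) mult_Suc by linarith
  qed
  have "finite B" using B by (rule finite_subset) simp
  then have "P (translate m B s) \<le> (\<Sum>k\<in>B. s k * P (shift m k))" using B
  proof (induction B rule: finite_induct)
    case empty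
    have "translate m {} s = id" by (simp add: translate_def fun_eq_iff)
    then show ?case by (simp add: P_def)
  next
    case (insert k B)
    have k: "k < n" using insert.prems by auto
    have eq: "translate m (insert k B) s x = ((shift m k ^^ s k) \<circ> translate m B s) x" if x: "x \<in> ?X" for x
    proof -
      have "translate m B s x k = x k" using insert.hyps by (simp add: translate_def)
      moreover have "x k < m" using x k by (simp add: torus_iff)
      ultimately show ?thesis using m by (simp add: shift_pow) (auto simp: translate_def fun_eq_iff)
    qed
    have "P (translate m (insert k B) s) = P ((shift m k ^^ s k) \<circ> translate m B s)"
      unfolding P_def using eq by (intro arg_cong[where f = card]) auto
    also have "\<dots> \<le> P (translate m B s) + P (shift m k ^^ s k)"
      using insert.prems m by (intro comp bij_translate) auto
    also have "\<dots> \<le> (\<Sum>k\<in>B. s k * P (shift m k)) + s k * P (shift m k)"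
      using insert pow[OF k] by (intro add_mono) auto
    finally show ?case using insert.hyps by simp
  qed
  then show ?thesis by (simp add: P_def)
qed

text \<open>For fixed \<open>x\<close>, replacing the coordinates in \<open>B\<close> by those of a
  uniform \<open>t\<close> amounts to translating them by a uniform \<open>s\<close>, and each
  coordinate is crossed in fewer than \<open>m\<close> unit steps. With all coordinates in
  \<open>B\<close> this is the Poincare inequality of the torus.\<close>

lemma displacement_override:
  fixes a :: "(nat \<Rightarrow> nat) \<Rightarrow> 't"
  assumes m: "m > 0" and B: "B \<subseteq> {..<n}"
  shows "(\<Sum>t\<in>torus m n. card {x \<in> torus m n. a x \<noteq> a (override_on x t B)})
    \<le> card (torus m n) * (m * (\<Sum>k\<in>B. card {x \<in> torus m n. a x \<noteq> a (shift m k x)}))"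
proof -
  let ?X = "torus m n"
  let ?D = "\<lambda>k. card {x \<in> ?X. a x \<noteq> a (shift m k x)}"
  have cs: "card {x \<in> ?X. Q x} = (\<Sum>x\<in>?X. of_bool (Q x))" for Q
    using finite_torus[of m n] by (simp add: Int_def)
  have "(\<Sum>t\<in>?X. card {x \<in> ?X. a x \<noteq> a (override_on x t B)})
      = (\<Sum>x\<in>?X. \<Sum>t\<in>?X. of_bool (a x \<noteq> a (override_on x t B)))"
    unfolding cs by (rule sum.swap)
  also have "\<dots> = (\<Sum>x\<in>?X. \<Sum>s\<in>?X. of_bool (a x \<noteq> a (translate m B s x)))"
  proof (rule sum.cong[OF refl])
    fix x assume x: "x \<in> ?X"
    have "(\<Sum>t\<in>?X. of_bool (a x \<noteq> a (override_on x t B)))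
        = (\<Sum>s\<in>?X. of_bool (a x \<noteq> a (override_on x (translate m {..<n} x s) B)) :: nat)"
      by (rule sum.reindex_bij_betw[OF bij_translate, symmetric]) (use m in auto)
    also have "\<dots> = (\<Sum>s\<in>?X. of_bool (a x \<noteq> a (translate m B s x)))"
    proof (rule sum.cong[OF refl])
      fix s assume "s \<in> ?X"
      have "override_on x (translate m {..<n} x s) B = translate m B s x"
        using B by (auto simp: override_on_def translate_def fun_eq_iff add.commute)
      then show "of_bool (a x \<noteq> a (override_on x (translate m {..<n} x s) B)) = (of_bool (a x \<noteq> a (translate m B s x)) :: nat)"
        by simp
    qed
    finally show "(\<Sum>t\<in>?X. of_bool (a x \<noteq> a (override_on x t B)))
        = (\<Sum>s\<in>?X. of_bool (a x \<noteq> a (translate m B s x)) :: nat)" .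
  qed
  also have "\<dots> = (\<Sum>s\<in>?X. card {x \<in> ?X. a x \<noteq> a (translate m B s x)})"
    unfolding cs by (rule sum.swap)
  also have "\<dots> \<le> (\<Sum>s\<in>?X. \<Sum>k\<in>B. s k * ?D k)"
    by (intro sum_mono displacement_translate m B)
  also have "\<dots> \<le> (\<Sum>s\<in>?X. \<Sum>k\<in>B. m * ?D k)"
    using B by (intro sum_mono mult_right_mono) (auto simp: torus_iff intro: less_imp_le)
  also have "\<dots> = card ?X * (m * (\<Sum>k\<in>B. ?D k))" by (simp add: sum_distrib_left)
  finally show ?thesis .
qed

lemma card_range_override:
  assumes t: "t \<in> torus m n" and B: "B \<subseteq> {..<n}"
  shows "card ((\<lambda>x. override_on x t B) ` torus m n) * m ^ card B \<le> m ^ n"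
proof -
  have "(\<lambda>x. override_on x t B) ` torus m n \<subseteq> (\<Pi>\<^sub>E i\<in>{..<n}. if i \<in> B then {t i} else {..<m})"
  proof (rule image_subsetI)
    fix x assume x: "x \<in> torus m n"
    show "override_on x t B \<in> (\<Pi>\<^sub>E i\<in>{..<n}. if i \<in> B then {t i} else {..<m})"
    proof (rule PiE_I)
      fix i assume "i \<in> {..<n}"
      then show "override_on x t B i \<in> (if i \<in> B then {t i} else {..<m})"
        using x by (simp add: torus_iff override_on_def)
    next
      fix i assume i: "i \<notin> {..<n}"
      then have "i \<notin> B" using B by blast
      then show "override_on x t B i = undefined" using x i by (simp add: torus_iff override_on_def)
    qed
  qed
  then have "card ((\<lambda>x. override_on x t B) ` torus m n) \<le> card (\<Pi>\<^sub>E i\<in>{..<n}. if i \<in> B then {t i} else {..<m})"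
    by (intro card_mono finite_PiE) auto
  also have "\<dots> = (\<Prod>i<n. if i \<in> B then 1 else m)"
    by (simp add: card_PiE if_distrib cong: if_cong)
  also have "\<dots> = (\<Prod>i\<in>{..<n} - B. m)"
    by (intro prod.mono_neutral_cong_right) auto
  also have "\<dots> = m ^ (n - card B)"
    using B by (simp add: card_Diff_subset finite_subset)
  finally have "card ((\<lambda>x. override_on x t B) ` torus m n) * m ^ card B \<le> m ^ (n - card B) * m ^ card B"
    by (rule mult_right_mono) simp
  also have "\<dots> = m ^ n"
    using card_mono[OF _ B] by (simp add: power_add[symmetric])
  finally show ?thesis .
qed

section \<open>Adjacency and degrees in the torus\<close>

lemma torus_adj_iff:
  assumes m: "m \<ge> 2" and x: "x \<in> torus m n" and y: "y \<in> torus m n"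
  shows "torus_adj m n x y \<longleftrightarrow> (\<exists>k<n. y = shift m k x \<or> x = shift m k y)"
proof -
  have c1: "[int a = int b + 1] (mod int m) \<longleftrightarrow> a = (b + 1) mod m" if "a < m" for a b
  proof -
    have "[int a = int b + 1] (mod int m) \<longleftrightarrow> [a = b + 1] (mod m)"
      by (metis cong_int_iff of_nat_1 of_nat_add)
    then show ?thesis using that by (simp add: cong_def)
  qed
  have c2: "[int a = int b - 1] (mod int m) \<longleftrightarrow> [int b = int a + 1] (mod int m)" for a b
    unfolding cong_iff_dvd_diff by (metis add_diff_cancel_left' diff_diff_eq2 diff_minus_eq_add dvd_minus_iff minus_diff_eq uminus_add_conv_diff)
  have "torus_adj m n x y \<longleftrightarrow> (\<exists>k<n. (x k = (y k + 1) mod m \<or> y k = (x k + 1) mod m) \<and> (\<forall>j<n. j \<noteq> k \<longrightarrow> x j = y j))"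
    unfolding torus_adj_def
  proof (intro ex_cong1 conj_cong refl)
    fix k assume "k < n"
    then have "x k < m" "y k < m" using x y by (auto simp: torus_iff)
    then show "([int (x k) = int (y k) + 1] (mod int m) \<or> [int (x k) = int (y k) - 1] (mod int m))
        \<longleftrightarrow> (x k = (y k + 1) mod m \<or> y k = (x k + 1) mod m)"
      unfolding c2 by (simp only: c1)
  qed
  also have "\<dots> \<longleftrightarrow> (\<exists>k<n. y = shift m k x \<or> x = shift m k y)"
  proof (intro ex_cong1 conj_cong refl)
    fix k assume k: "k < n"
    have ext: "x j = y j" if "j \<ge> n" for j using x y that by (simp add: torus_iff)
    have all: "(\<forall>j<n. j \<noteq> k \<longrightarrow> x j = y j) \<longleftrightarrow> (\<forall>j. j \<noteq> k \<longrightarrow> x j = y j)"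
      using ext k by (metis not_le)
    show "((x k = (y k + 1) mod m \<or> y k = (x k + 1) mod m) \<and> (\<forall>j<n. j \<noteq> k \<longrightarrow> x j = y j))
        \<longleftrightarrow> (y = shift m k x \<or> x = shift m k y)"
      unfolding all shift_def fun_eq_iff by (auto simp: fun_upd_def)
  qed
  finally show ?thesis .
qed

lemma nbs_eq:
  assumes "m \<ge> 2" "x \<in> torus m n"
  shows "nbs m n x = {y \<in> torus m n. \<exists>k<n. y = shift m k x \<or> x = shift m k y}"
  using torus_adj_iff[OF assms] by (auto simp: nbs_def)

lemma nbs_sym: "m \<ge> 2 \<Longrightarrow> x \<in> torus m n \<Longrightarrow> y \<in> torus m n \<Longrightarrow> y \<in> nbs m n x \<longleftrightarrow> x \<in> nbs m n y"
  by (auto simp: nbs_eq)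

lemma shift_nbs: "m \<ge> 2 \<Longrightarrow> x \<in> torus m n \<Longrightarrow> k < n \<Longrightarrow> shift m k x \<in> nbs m n x"
  by (auto simp: nbs_eq shift_torus)

lemma shift_inj_index:
  assumes "m \<ge> 2" "x \<in> torus m n" "k < n" "j < n" "shift m k x = shift m j x"
  shows "k = j"
proof (rule ccontr)
  assume "k \<noteq> j"
  then have "(x k + 1) mod m = x k" using fun_cong[OF assms(5), of k] by (simp add: shift_def)
  moreover have "x k < m" using assms by (simp add: torus_iff)
  ultimately show False using assms(1) by (cases "x k + 1 = m") auto
qed

text \<open>The lower bound counts forward shifts. Forward and backward steps coincide for
  \<open>m = 2\<close>, where the degree is \<open>n\<close>; for larger \<open>m\<close> it is
  \<open>2 * n\<close>. The two bounds cover both cases.\<close>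

lemma card_nbs_bounds:
  assumes m: "m \<ge> 2" and x: "x \<in> torus m n"
  shows "n \<le> card (nbs m n x)" "card (nbs m n x) \<le> 2 * n"
proof -
  have fin: "finite (nbs m n x)" using finite_torus by (simp add: nbs_def)
  have inj: "inj_on (\<lambda>k. shift m k x) {..<n}"
    using shift_inj_index[OF m x] by (auto intro!: inj_onI)
  have "card ((\<lambda>k. shift m k x) ` {..<n}) \<le> card (nbs m n x)"
    using fin shift_nbs[OF m x] by (intro card_mono) auto
  then show "n \<le> card (nbs m n x)" using card_image[OF inj] by simp
  have "nbs m n x \<subseteq> (\<Union>k<n. {shift m k x} \<union> {y \<in> torus m n. x = shift m k y})"
    using nbs_eq[OF m x] by auto
  then have "card (nbs m n x) \<le> card (\<Union>k<n. {shift m k x} \<union> {y \<in> torus m n. x = shift m k y})"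
    using finite_torus by (intro card_mono) auto
  also have "\<dots> \<le> (\<Sum>k<n. card ({shift m k x} \<union> {y \<in> torus m n. x = shift m k y}))"
    by (rule card_UN_le) simp
  also have "\<dots> \<le> (\<Sum>k<n. 2)"
  proof (rule sum_mono)
    fix k assume "k \<in> {..<n}"
    then have "card {y \<in> torus m n. x = shift m k y} \<le> 1"
      using inj_shift[of k n m] by (intro card_le_Suc0_iff_eq[THEN iffD2, unfolded One_nat_def[symmetric]])
        (auto simp: finite_torus inj_on_def)
    then show "card ({shift m k x} \<union> {y \<in> torus m n. x = shift m k y}) \<le> 2"
      using card_Un_le[of "{shift m k x}" "{y \<in> torus m n. x = shift m k y}"] by simp
  qed
  finally show "card (nbs m n x) \<le> 2 * n" by simp
qed

text \<open>Translations preserve adjacency and act transitively on the torus.\<close>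

lemma card_nbs_const:
  assumes m: "m \<ge> 2" and x: "x \<in> torus m n" and y: "y \<in> torus m n"
  shows "card (nbs m n x) = card (nbs m n y)"
proof -
  have le: "card (nbs m n x) \<le> card (nbs m n y)" if x: "x \<in> torus m n" and y: "y \<in> torus m n" for x y
  proof -
    have m0: "m > 0" using m by simp
    obtain s where s: "s \<in> torus m n" "translate m {..<n} s x = y"
    proof -
      have "y \<in> translate m {..<n} x ` torus m n"
        using bij_translate[of "{..<n}" n m x] m0 y by (simp add: bij_betw_def)
      then show ?thesis using that translate_commute[OF x] by auto
    qed
    have sh: "translate m {..<n} s (shift m k z) = shift m k (translate m {..<n} s z)" if "k < n" for k z
      using that by (auto simp: translate_def shift_def fun_eq_iff mod_simps)
    show ?thesis
    proof (rule card_inj_on_le)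
      show "inj_on (translate m {..<n} s) (nbs m n x)"
        using inj_translate[of "{..<n}" n m s] by (rule inj_on_subset) (auto simp: nbs_def)
      show "translate m {..<n} s ` nbs m n x \<subseteq> nbs m n y"
      proof safe
        fix z assume "z \<in> nbs m n x"
        then obtain k where z: "z \<in> torus m n" "k < n" "z = shift m k x \<or> x = shift m k z"
          using nbs_eq[OF m x] by auto
        then have "translate m {..<n} s z = shift m k y \<or> y = shift m k (translate m {..<n} s z)"
          using sh[of k] s(2) by metis
        then show "translate m {..<n} s z \<in> nbs m n y"
          using z translate_torus[OF z(1) _ m0, of "{..<n}" s] by (auto simp: nbs_eq[OF m y])
      qed
      show "finite (nbs m n y)" using finite_torus by (simp add: nbs_def)
    qed
  qed
  show ?thesis using le[OF x y] le[OF y x] by simp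
qed

lemma classes: "torus m n = even_class m n \<union> odd_class m n" "even_class m n \<inter> odd_class m n = {}"
  by (auto simp: even_class_def odd_class_def)

lemma nbs_classes:
  assumes "even m" "m \<ge> 2"
  shows "u \<in> even_class m n \<Longrightarrow> nbs m n u \<subseteq> odd_class m n"
    and "v \<in> odd_class m n \<Longrightarrow> nbs m n v \<subseteq> even_class m n"
  using torus_adj_parity[OF assms(1)] by (auto simp: nbs_def even_class_def odd_class_def)

lemma even_class_nonempty: "m > 0 \<Longrightarrow> even_class m n \<noteq> {}"
proof -
  assume m: "m > 0"
  have "(\<lambda>i. if i < n then 0 else undefined) \<in> even_class m n"
    using m by (simp add: even_class_def torus_iff)
  then show ?thesis by blast
qed

section \<open>Spin systems on the torus\<close>

text \<open>Jensen's inequality, from the tangent line of \<open>exp\<close> at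
  \<open>s\<close>.\<close>

lemma exp_avg_le:
  fixes f :: "'p \<Rightarrow> real" and s :: real
  assumes P: "finite P" "P \<noteq> {}" and s: "s * card P \<le> (\<Sum>p\<in>P. f p)"
  shows "exp s * card P \<le> (\<Sum>p\<in>P. exp (f p))"
proof -
  have "exp s * card P + exp s * ((\<Sum>p\<in>P. f p) - s * card P) = (\<Sum>p\<in>P. exp s * (1 + (f p - s)))"
    by (simp add: sum_distrib_left[symmetric] sum.distrib sum_subtractf algebra_simps)
  also have "\<dots> \<le> (\<Sum>p\<in>P. exp s * exp (f p - s))"
    by (intro sum_mono mult_left_mono exp_ge_add_one_self) auto
  also have "\<dots> = (\<Sum>p\<in>P. exp (f p))" by (simp add: mult_exp_exp)
  finally have "exp s * card P + exp s * ((\<Sum>p\<in>P. f p) - s * card P) \<le> (\<Sum>p\<in>P. exp (f p))" .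
  moreover have "exp s * ((\<Sum>p\<in>P. f p) - s * card P) \<ge> 0" using s by simp
  ultimately show ?thesis by linarith
qed

lemma card_residue_class_ge:
  assumes "b < L"
  shows "n div L \<le> card {i. i < n \<and> i mod L = b}"
proof -
  have "inj_on (\<lambda>q. q * L + b) {..<n div L}" using assms by (auto simp: inj_on_def)
  then have "n div L = card ((\<lambda>q. q * L + b) ` {..<n div L})" by (simp add: card_image)
  also have "\<dots> \<le> card {i. i < n \<and> i mod L = b}"
  proof (intro card_mono)
    show "(\<lambda>q. q * L + b) ` {..<n div L} \<subseteq> {i. i < n \<and> i mod L = b}"
    proof (rule image_subsetI)
      fix q assume "q \<in> {..<n div L}"
      then have "Suc q * L \<le> n div L * L" by (intro mult_right_mono) auto
      also have "\<dots> \<le> n" by (rule div_times_less_eq_dividend)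
      finally have "q * L + b < n" using assms by simp
      then show "q * L + b \<in> {i. i < n \<and> i mod L = b}" using assms by simp
    qed
  qed simp
  finally show ?thesis .
qed

locale torus_spin = spin_model C lam nu eta
  for C :: "'c set" and lam :: "'c \<Rightarrow> real" and nu :: "'c set \<Rightarrow> real" and eta :: real +
  fixes m n :: nat
  assumes even_m: "even m" and m2: "m \<ge> 2" and n1: "n \<ge> 1"
begin

definition deg :: nat where
  "deg = card (nbs m n (\<lambda>i. if i < n then 0 else undefined))"

lemma origin: "(\<lambda>i. if i < n then 0 else undefined) \<in> torus m n"
  using m2 by (auto simp: torus_iff)

lemma deg_bounds: "n \<le> deg" "deg \<le> 2 * n"
  using card_nbs_bounds[OF m2 origin] by (simp_all add: deg_def)

abbreviation "Ev \<equiv> even_class m n"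
abbreviation "Od \<equiv> odd_class m n"
abbreviation "X \<equiv> torus m n"

lemma EvX: "u \<in> Ev \<Longrightarrow> u \<in> X" and OdX: "v \<in> Od \<Longrightarrow> v \<in> X"
  by (auto simp: even_class_def odd_class_def)

sublocale spin_system C lam nu eta Ev Od "nbs m n" deg
proof
  show "finite Ev" "finite Od"
    using finite_torus[of m n] by (simp_all add: even_class_def odd_class_def)
  show "0 < deg" using deg_bounds n1 by simp
  show "u \<in> Ev \<Longrightarrow> nbs m n u \<subseteq> Od" "v \<in> Od \<Longrightarrow> nbs m n v \<subseteq> Ev" for u v
    using nbs_classes[OF even_m m2] by auto
  show "u \<in> Ev \<Longrightarrow> card (nbs m n u) = deg" "v \<in> Od \<Longrightarrow> card (nbs m n v) = deg" for u v
    unfolding deg_def using card_nbs_const[OF m2 _ origin] EvX OdX by auto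
  show "u \<in> Ev \<Longrightarrow> v \<in> Od \<Longrightarrow> (u \<in> nbs m n v) = (v \<in> nbs m n u)" for u v
    using nbs_sym[OF m2 EvX OdX] by auto
qed

lemma card_X: "card X = 2 * card Od" "m ^ n = 2 * card Od"
proof -
  have "card X = card Ev + card Od"
    unfolding classes(1)[of m n] using finE finO classes(2) by (rule card_Un_disjoint)
  then show "card X = 2 * card Od" by (simp add: card_Ev)
  then show "m ^ n = 2 * card Od" by (simp add: card_torus)
qed

lemma Od_pos: "card Od > 0"
proof -
  have "m ^ n > 0" using m2 by simp
  then show ?thesis using card_X(2) by simp
qed

lemma shift_class: "k < n \<Longrightarrow> u \<in> Ev \<Longrightarrow> shift m k u \<in> Od" "k < n \<Longrightarrow> v \<in> Od \<Longrightarrow> shift m k v \<in> Ev"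
  using shift_nbs[OF m2 EvX, of u k] shift_nbs[OF m2 OdX, of v k] N_E(1)[of u] N_O(1)[of v] by auto

text \<open>Unit steps change parity, whereas colour sets live on odd vertices only. An even vertex
  therefore borrows the set of its odd neighbour in direction \<open>j\<close>; summing over
  \<open>j\<close> later spreads this choice over all directions.\<close>

definition field :: "nat \<Rightarrow> (nat \<Rightarrow> nat) set \<Rightarrow> ((nat \<Rightarrow> nat) \<Rightarrow> 'c) \<Rightarrow> (nat \<Rightarrow> nat) \<Rightarrow> 'c set" where
  "field j E0 g x = (if x \<in> Od then seen E0 g x else seen E0 g (shift m j x))"

definition jumps :: "nat \<Rightarrow> (nat \<Rightarrow> nat) set \<Rightarrow> ((nat \<Rightarrow> nat) \<Rightarrow> 'c) \<Rightarrow> nat \<Rightarrow> nat" where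
  "jumps j E0 g k = card {x \<in> X. field j E0 g x \<noteq> field j E0 g (shift m k x)}"

text \<open>A jump along a unit step compares two neighbours of the even end of the step: its odd
  end, and the neighbour in direction \<open>j\<close>. Summed over \<open>j\<close> and
  \<open>k\<close> these are among the pairs counted by \<open>dis\<close>, once for each parity of
  the starting vertex, and \<open>deg \<le> 2 * n\<close>.\<close>

lemma sum_jumps:
  "(\<Sum>j<n. \<Sum>k<n. real (jumps j E0 g k)) \<le> 8 * real n ^ 2 * (\<Sum>u\<in>Ev. dis E0 g u)"
proof -
  define G where "G j u w = (of_bool (seen E0 g (shift m j u) \<noteq> seen E0 g w) :: real)" for j u w
  define S where "S j = (\<Sum>u\<in>Ev. \<Sum>w\<in>nbs m n u. G j u w)" for j
  have G0: "G j u w \<ge> 0" for j u w by (simp add: G_def)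
  have row: "(\<Sum>k<n. F (shift m k x)) \<le> (\<Sum>w\<in>nbs m n x. F w)"
    if "x \<in> X" "\<And>w. F w \<ge> 0" for x and F :: "(nat \<Rightarrow> nat) \<Rightarrow> real"
  proof -
    have inj: "inj_on (\<lambda>k. shift m k x) {..<n}"
      using shift_inj_index[OF m2 that(1)] by (auto intro!: inj_onI)
    have "(\<Sum>k<n. F (shift m k x)) = (\<Sum>w\<in>(\<lambda>k. shift m k x) ` {..<n}. F w)"
      using inj by (simp add: sum.reindex)
    also have "\<dots> \<le> (\<Sum>w\<in>nbs m n x. F w)"
      using that shift_nbs[OF m2 that(1)] finite_torus[of m n] by (intro sum_mono2) (auto simp: nbs_def)
    finally show ?thesis .
  qed
  have 1: "(\<Sum>k<n. real (jumps j E0 g k)) \<le> 2 * S j" if j: "j < n" for j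
  proof -
    have "real (jumps j E0 g k) = (\<Sum>u\<in>Ev. G j u (shift m k u)) + (\<Sum>v\<in>Od. G j (shift m k v) v)"
      if k: "k < n" for k
    proof -
      have "real (jumps j E0 g k) = (\<Sum>x\<in>X. of_bool (field j E0 g x \<noteq> field j E0 g (shift m k x)))"
        using finite_torus[of m n] by (simp add: jumps_def Int_def)
      also have "\<dots> = (\<Sum>x\<in>Ev. of_bool (field j E0 g x \<noteq> field j E0 g (shift m k x)))
                  + (\<Sum>x\<in>Od. of_bool (field j E0 g x \<noteq> field j E0 g (shift m k x)))"
        unfolding classes(1)[of m n] using finE finO classes(2) by (rule sum.union_disjoint)
      also have "(\<Sum>x\<in>Ev. of_bool (field j E0 g x \<noteq> field j E0 g (shift m k x))) = (\<Sum>u\<in>Ev. G j u (shift m k u))"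
      proof (intro sum.cong refl)
        fix u assume u: "u \<in> Ev"
        then have "u \<notin> Od" using classes(2)[of m n] by auto
        then show "of_bool (field j E0 g u \<noteq> field j E0 g (shift m k u)) = G j u (shift m k u)"
          using shift_class(1)[OF k u] by (simp add: field_def G_def)
      qed
      also have "(\<Sum>x\<in>Od. of_bool (field j E0 g x \<noteq> field j E0 g (shift m k x))) = (\<Sum>v\<in>Od. G j (shift m k v) v)"
      proof (intro sum.cong refl)
        fix v assume v: "v \<in> Od"
        have "shift m k v \<notin> Od" using shift_class(2)[OF k v] classes(2)[of m n] by auto
        then show "of_bool (field j E0 g v \<noteq> field j E0 g (shift m k v)) = G j (shift m k v) v"
          using v by (auto simp: field_def G_def)
      qed
      finally show ?thesis .
    qed
    then have "(\<Sum>k<n. real (jumps j E0 g k))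
       = (\<Sum>k<n. \<Sum>u\<in>Ev. G j u (shift m k u)) + (\<Sum>k<n. \<Sum>v\<in>Od. G j (shift m k v) v)"
      by (simp add: sum.distrib)
    also have "\<dots> = (\<Sum>u\<in>Ev. \<Sum>k<n. G j u (shift m k u)) + (\<Sum>v\<in>Od. \<Sum>k<n. G j (shift m k v) v)"
      by (intro arg_cong2[where f = "(+)"] sum.swap)
    also have "\<dots> \<le> (\<Sum>u\<in>Ev. \<Sum>w\<in>nbs m n u. G j u w) + (\<Sum>v\<in>Od. \<Sum>u\<in>nbs m n v. G j u v)"
      using EvX OdX G0 by (intro add_mono sum_mono row) auto
    also have "(\<Sum>v\<in>Od. \<Sum>u\<in>nbs m n v. G j u v) = (\<Sum>v\<in>Od. \<Sum>u\<in>nbs m n v \<inter> Ev. G j u v)"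
      using N_O(1) by (intro sum.cong refl) (auto simp: Int_absorb2)
    also have "\<dots> = S j" unfolding S_def by (rule sum_swap_edges[symmetric]) simp
    finally show ?thesis by (simp add: S_def)
  qed
  have 2: "(\<Sum>j<n. S j) \<le> real deg ^ 2 * (\<Sum>u\<in>Ev. dis E0 g u)"
  proof -
    have "(\<Sum>j<n. \<Sum>w\<in>nbs m n u. G j u w) \<le> real deg ^ 2 * dis E0 g u" if u: "u \<in> Ev" for u
    proof -
      have "(\<Sum>j<n. \<Sum>w\<in>nbs m n u. G j u w)
          \<le> (\<Sum>w'\<in>nbs m n u. \<Sum>w\<in>nbs m n u. of_bool (seen E0 g w' \<noteq> seen E0 g w))"
        unfolding G_def
        by (rule row[OF EvX[OF u], of "\<lambda>w'. \<Sum>w\<in>nbs m n u. of_bool (seen E0 g w' \<noteq> seen E0 g w)"])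
           (auto intro: sum_nonneg)
      also have "\<dots> = (\<Sum>p\<in>nbs m n u \<times> nbs m n u. of_bool (case p of (w', w) \<Rightarrow> seen E0 g w' \<noteq> seen E0 g w))"
        unfolding sum.cartesian_product by (intro sum.cong) auto
      also have "\<dots> = real deg ^ 2 * dis E0 g u"
        using d_pos finN(1)[OF u]
        by (simp add: dis_def freq_eq_sum card_cartesian_product N_E(2)[OF u] power2_eq_square del: sum_of_bool_eq)
      finally show ?thesis .
    qed
    then have "(\<Sum>u\<in>Ev. \<Sum>j<n. \<Sum>w\<in>nbs m n u. G j u w) \<le> (\<Sum>u\<in>Ev. real deg ^ 2 * dis E0 g u)"
      by (rule sum_mono)
    then show ?thesis unfolding S_def by (subst sum.swap) (simp add: sum_distrib_left)
  qed
  have "(\<Sum>j<n. \<Sum>k<n. real (jumps j E0 g k)) \<le> (\<Sum>j<n. 2 * S j)"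
    using 1 by (intro sum_mono) auto
  also have "\<dots> = 2 * (\<Sum>j<n. S j)" by (simp add: sum_distrib_left)
  also have "\<dots> \<le> 2 * (real deg ^ 2 * (\<Sum>u\<in>Ev. dis E0 g u))" using 2 by simp
  also have "\<dots> \<le> 2 * ((2 * real n) ^ 2 * (\<Sum>u\<in>Ev. dis E0 g u))"
    using deg_bounds(2) by (intro mult_left_mono mult_right_mono power_mono sum_nonneg)
      (auto simp: dis_def freq_nonneg)
  finally show ?thesis by (simp add: power2_eq_square)
qed

definition block :: "nat \<Rightarrow> nat \<Rightarrow> nat set" where
  "block L b = {i. i < n \<and> i mod L = b}"

definition wrong_ref :: "nat \<Rightarrow> (nat \<Rightarrow> nat) set \<Rightarrow> nat \<Rightarrow> nat \<Rightarrow> (nat \<Rightarrow> nat) \<Rightarrow> ((nat \<Rightarrow> nat) \<Rightarrow> 'c) \<Rightarrow> nat" where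
  "wrong_ref L E0 j b t g = card {v \<in> Od. seen E0 g v \<noteq> field j E0 g (override_on v t (block L b))}"

text \<open>A reference is wrong only if the field changes along the directions of the block. Each
  direction lies in exactly one block, so all \<open>L\<close> blocks together cost no more than all
  directions once.\<close>

lemma sum_wrong_ref:
  assumes L: "L > 0"
  shows "(\<Sum>j<n. \<Sum>b<L. \<Sum>t\<in>X. real (wrong_ref L E0 j b t g))
     \<le> card X * m * (8 * real n ^ 2 * (\<Sum>u\<in>Ev. dis E0 g u))"
proof -
  have m0: "m > 0" using m2 by simp
  have "(\<Sum>b<L. \<Sum>t\<in>X. real (wrong_ref L E0 j b t g)) \<le> card X * m * (\<Sum>k<n. real (jumps j E0 g k))" for j
  proof -
    have "(\<Sum>t\<in>X. wrong_ref L E0 j b t g) \<le> card X * (m * (\<Sum>k\<in>block L b. jumps j E0 g k))" for b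
    proof -
      have "(\<Sum>t\<in>X. wrong_ref L E0 j b t g)
         \<le> (\<Sum>t\<in>X. card {x \<in> X. field j E0 g x \<noteq> field j E0 g (override_on x t (block L b))})"
        unfolding wrong_ref_def using finite_torus[of m n] OdX
        by (intro sum_mono card_mono) (auto simp: field_def)
      also have "\<dots> \<le> card X * (m * (\<Sum>k\<in>block L b. jumps j E0 g k))"
        unfolding jumps_def by (rule displacement_override[OF m0]) (auto simp: block_def)
      finally show ?thesis .
    qed
    then have "(\<Sum>b<L. \<Sum>t\<in>X. wrong_ref L E0 j b t g) \<le> (\<Sum>b<L. card X * (m * (\<Sum>k\<in>block L b. jumps j E0 g k)))"
      by (rule sum_mono)
    also have "\<dots> = card X * m * (\<Sum>b<L. \<Sum>k | k \<in> {..<n} \<and> k mod L = b. jumps j E0 g k)"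
      by (simp add: sum_distrib_left block_def mult.assoc)
    also have "(\<Sum>b<L. \<Sum>k | k \<in> {..<n} \<and> k mod L = b. jumps j E0 g k) = (\<Sum>k<n. jumps j E0 g k)"
      using L by (intro sum.group) auto
    finally have "real (\<Sum>b<L. \<Sum>t\<in>X. wrong_ref L E0 j b t g) \<le> real (card X * m * (\<Sum>k<n. jumps j E0 g k))"
      by (rule of_nat_mono)
    then show ?thesis by simp
  qed
  then have "(\<Sum>j<n. \<Sum>b<L. \<Sum>t\<in>X. real (wrong_ref L E0 j b t g))
      \<le> (\<Sum>j<n. card X * m * (\<Sum>k<n. real (jumps j E0 g k)))" by (rule sum_mono)
  also have "\<dots> = card X * m * (\<Sum>j<n. \<Sum>k<n. real (jumps j E0 g k))" by (simp add: sum_distrib_left)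
  also have "\<dots> \<le> card X * m * (8 * real n ^ 2 * (\<Sum>u\<in>Ev. dis E0 g u))"
    by (intro mult_left_mono sum_jumps) auto
  finally show ?thesis .
qed

text \<open>Replacing all coordinates in \<open>displacement_override\<close> compares every pair of
  odd vertices. By \<open>spread\<close> at least a fraction \<open>\<epsilon>\<close> of the pairs
  have different colour sets, and a wrongly sampled vertex spoils only the pairs containing it, on
  either side.\<close>

lemma dis_lower:
  fixes \<epsilon> :: real
  assumes spread: "\<And>A. card {v\<in>Od. g ` nbs m n v = A} \<le> (1 - \<epsilon>) * card Od"
  shows "\<epsilon> * card Od - 2 * card {v\<in>Od. seen E0 g v \<noteq> g ` nbs m n v} \<le> 16 * m * n * (\<Sum>u\<in>Ev. dis E0 g u)"
proof -
  define A where "A v = g ` nbs m n v" for v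
  define H where "H v = seen E0 g v" for v
  define Wr where "Wr = card {v\<in>Od. H v \<noteq> A v}"
  let ?M = "real (card Od)"
  let ?Q = "\<Sum>v'\<in>Od. \<Sum>v\<in>Od. of_bool (H v \<noteq> H v') :: real"
  have m0: "m > 0" using m2 by simp
  have wr: "real Wr = (\<Sum>v\<in>Od. of_bool (H v \<noteq> A v))" using finO by (simp add: Wr_def Int_def)
  have up: "?Q \<le> card X * m * (\<Sum>k<n. real (jumps j E0 g k))" for j
  proof -
    have "(\<Sum>v'\<in>Od. \<Sum>v\<in>Od. of_bool (H v \<noteq> H v')) = (\<Sum>v'\<in>Od. card {v\<in>Od. H v \<noteq> H v'})"
      using finO by (simp add: Int_def)
    also have "\<dots> \<le> (\<Sum>t\<in>X. card {x \<in> X. field j E0 g x \<noteq> field j E0 g (override_on x t {..<n})})"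
    proof (rule order.trans[OF sum_mono sum_mono2])
      fix v' assume v': "v' \<in> Od"
      have "override_on v v' {..<n} = v'" if "v \<in> X" for v
        using that OdX[OF v'] by (auto simp: override_on_def torus_iff fun_eq_iff)
      then show "card {v\<in>Od. H v \<noteq> H v'} \<le> card {x \<in> X. field j E0 g x \<noteq> field j E0 g (override_on x v' {..<n})}"
        using finite_torus[of m n] OdX v' by (intro card_mono) (auto simp: field_def H_def)
    qed (use finite_torus[of m n] OdX in auto)
    also have "\<dots> \<le> card X * (m * (\<Sum>k<n. jumps j E0 g k))"
      unfolding jumps_def by (rule displacement_override[OF m0]) auto
    finally have "real (\<Sum>v'\<in>Od. \<Sum>v\<in>Od. of_bool (H v \<noteq> H v')) \<le> real (card X * (m * (\<Sum>k<n. jumps j E0 g k)))"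
      by (rule of_nat_mono)
    then show ?thesis by (simp add: mult.assoc)
  qed
  have "n * ?Q = (\<Sum>j<n. ?Q)" by simp
  also have "\<dots> \<le> (\<Sum>j<n. card X * m * (\<Sum>k<n. real (jumps j E0 g k)))" by (intro sum_mono up)
  also have "\<dots> = card X * m * (\<Sum>j<n. \<Sum>k<n. real (jumps j E0 g k))" by (simp add: sum_distrib_left)
  also have "\<dots> \<le> card X * m * (8 * real n ^ 2 * (\<Sum>u\<in>Ev. dis E0 g u))"
    by (intro mult_left_mono sum_jumps) auto
  also have "\<dots> = n * (?M * (16 * m * n * (\<Sum>u\<in>Ev. dis E0 g u)))"
    by (simp add: card_X(1) power2_eq_square)
  finally have up': "?Q \<le> ?M * (16 * m * n * (\<Sum>u\<in>Ev. dis E0 g u))" using n1 by simp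
  have "?M * (\<epsilon> * ?M) \<le> (\<Sum>v'\<in>Od. \<Sum>v\<in>Od. of_bool (A v \<noteq> A v'))"
  proof -
    have "\<epsilon> * ?M \<le> (\<Sum>v\<in>Od. of_bool (A v \<noteq> A v'))" for v'
    proof -
      have "(\<Sum>v\<in>Od. of_bool (A v \<noteq> A v') :: real) = (\<Sum>v\<in>Od. 1 - of_bool (A v = A v'))"
        by (intro sum.cong) auto
      also have "\<dots> = ?M - card {v\<in>Od. A v = A v'}" using finO by (simp add: sum_subtractf Int_def)
      also have "\<dots> \<ge> ?M - (1 - \<epsilon>) * ?M" using spread[of "A v'"] by (simp add: A_def)
      finally show ?thesis by (simp add: algebra_simps)
    qed
    then have "(\<Sum>v'\<in>Od. \<epsilon> * ?M) \<le> (\<Sum>v'\<in>Od. \<Sum>v\<in>Od. of_bool (A v \<noteq> A v'))" by (rule sum_mono)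
    then show ?thesis by simp
  qed
  also have "\<dots> \<le> (\<Sum>v'\<in>Od. \<Sum>v\<in>Od. of_bool (H v \<noteq> H v') + of_bool (H v \<noteq> A v) + of_bool (H v' \<noteq> A v'))"
    by (intro sum_mono) auto
  also have "\<dots> = ?Q + ?M * Wr + ?M * Wr"
    by (simp add: sum.distrib wr sum_distrib_left del: sum_of_bool_eq)
  finally have "?M * (\<epsilon> * ?M) \<le> ?M * (16 * m * n * (\<Sum>u\<in>Ev. dis E0 g u)) + ?M * Wr + ?M * Wr"
    using up' by linarith
  then have "?M * (\<epsilon> * ?M) \<le> ?M * (16 * m * n * (\<Sum>u\<in>Ev. dis E0 g u) + 2 * Wr)"
    by (simp add: algebra_simps)
  then have "\<epsilon> * ?M \<le> 16 * m * n * (\<Sum>u\<in>Ev. dis E0 g u) + 2 * Wr"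
    using Od_pos by simp
  then show ?thesis by (simp add: Wr_def H_def A_def)
qed

end


section \<open>Exponential tilts and the weight of spread configurations\<close>

context torus_spin
begin

text \<open>The exponential moments of the following exponent are bounded uniformly in
  \<open>(E0, j, b, t)\<close>, whereas its average over these parameters is large whenever the colour sets
  of the odd vertices are spread out.\<close>

definition tilt :: "real \<Rightarrow> real \<Rightarrow> real \<Rightarrow> real \<Rightarrow> nat \<Rightarrow> (nat \<Rightarrow> nat) set \<Rightarrow> nat \<Rightarrow> nat \<Rightarrow> (nat \<Rightarrow> nat)
    \<Rightarrow> ((nat \<Rightarrow> nat) \<Rightarrow> 'c) \<Rightarrow> real" where
  "tilt \<kappa> c0 \<tau> \<sigma> L E0 j b t g = (\<Sum>u\<in>Ev - E0. \<kappa> * dis E0 g u - c0 - \<tau> * miss E0 g u (g u))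
     - \<sigma> / deg * wrong_ref L E0 j b t g"

text \<open>The reference values live on the coordinate subtorus obtained by freezing one block of
  coordinates; there are so few of them that a union bound over all their values is affordable.\<close>

lemma tilted_sum_le:
  fixes \<kappa> c0 \<tau> \<sigma> :: real
  assumes gain: "\<And>(D :: (nat \<Rightarrow> nat) set) A. finite D \<Longrightarrow> D \<noteq> {} \<Longrightarrow> (\<And>w. w \<in> D \<Longrightarrow> A w \<subseteq> C) \<Longrightarrow>
       (\<Sum>a\<in>C. lam a * exp (- \<tau> * freq D (\<lambda>w. a \<notin> A w)))
       \<le> exp ((\<Sum>w\<in>D. ln (Lam (A w))) / card D
              - \<kappa> * freq (D \<times> D) (\<lambda>(w, w'). A w \<noteq> A w') + c0)"
    and E0: "E0 \<subseteq> Ev" and b: "b < L" and t: "t \<in> X" and j: "j < n"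
  shows "(\<Sum>g\<in>Ev \<rightarrow>\<^sub>E C. W g * exp (tilt \<kappa> c0 \<tau> \<sigma> L E0 j b t g))
     \<le> eta ^ card Od * exp (card Od * (2 ^ card C * exp (- \<sigma>) / n + 2 * card C * ln 2 * (1 / 2) ^ (n div L)))"
proof -
  let ?r = "\<lambda>x. override_on x t (block L b)"
  let ?k = "card C"
  let ?M = "card Od"
  define R where "R = ?r ` X"
  have finR: "finite R" using finite_torus by (simp add: R_def)
  have BL: "block L b \<subseteq> {..<n}" by (auto simp: block_def)
  have rX: "?r x \<in> X" if "x \<in> X" for x
    using that t BL by (auto simp: torus_iff override_on_def)
  define Ja where "Ja \<alpha> g = (\<Sum>u\<in>Ev - E0. \<kappa> * dis E0 g u - c0 - \<tau> * miss E0 g u (g u))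
     - \<sigma> / deg * card {v\<in>Od. seen E0 g v \<noteq> \<alpha> (?r v)}" for \<alpha> g
  have HC: "seen E0 g v \<subseteq> C" if "g \<in> Ev \<rightarrow>\<^sub>E C" for g v
    using that E0 by (auto simp: seen_def PiE_iff)
  have finA: "finite (R \<rightarrow>\<^sub>E Pow C)" using finR finC by (intro finite_PiE) auto
  have one: "W g * exp (tilt \<kappa> c0 \<tau> \<sigma> L E0 j b t g) \<le> (\<Sum>\<alpha>\<in>R \<rightarrow>\<^sub>E Pow C. W g * exp (Ja \<alpha> g))"
    if g: "g \<in> Ev \<rightarrow>\<^sub>E C" for g
  proof -
    \<comment> \<open>\<open>partition_function_bound\<close> needs a reference independent of
      \<open>g\<close>. The sum over all assignments on \<open>R\<close> contains this true one, and
      its other terms are nonnegative.\<close>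
    define \<alpha> where "\<alpha> = restrict (field j E0 g) R"
    have \<alpha>: "\<alpha> \<in> R \<rightarrow>\<^sub>E Pow C" using HC[OF g] by (auto simp: \<alpha>_def field_def)
    have "{v\<in>Od. seen E0 g v \<noteq> \<alpha> (?r v)} = {v\<in>Od. seen E0 g v \<noteq> field j E0 g (?r v)}"
      using OdX by (auto simp: \<alpha>_def R_def)
    then have "tilt \<kappa> c0 \<tau> \<sigma> L E0 j b t g = Ja \<alpha> g" by (simp add: tilt_def Ja_def wrong_ref_def)
    then have "W g * exp (tilt \<kappa> c0 \<tau> \<sigma> L E0 j b t g) = W g * exp (Ja \<alpha> g)" by simp
    also have "\<dots> \<le> (\<Sum>\<alpha>\<in>R \<rightarrow>\<^sub>E Pow C. W g * exp (Ja \<alpha> g))"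
      using \<alpha> finA W_nonneg[OF g] by (intro member_le_sum) auto
    finally show ?thesis .
  qed
  have "(\<Sum>g\<in>Ev \<rightarrow>\<^sub>E C. W g * exp (tilt \<kappa> c0 \<tau> \<sigma> L E0 j b t g))
      \<le> (\<Sum>g\<in>Ev \<rightarrow>\<^sub>E C. \<Sum>\<alpha>\<in>R \<rightarrow>\<^sub>E Pow C. W g * exp (Ja \<alpha> g))"
    by (intro sum_mono one)
  also have "\<dots> = (\<Sum>\<alpha>\<in>R \<rightarrow>\<^sub>E Pow C. \<Sum>g\<in>Ev \<rightarrow>\<^sub>E C. W g * exp (Ja \<alpha> g))" by (rule sum.swap)
  also have "\<dots> \<le> (\<Sum>\<alpha>\<in>R \<rightarrow>\<^sub>E Pow C. eta ^ ?M * exp (2 ^ ?k * exp (- \<sigma>) * ?M / deg))"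
    unfolding Ja_def by (intro sum_mono partition_function_bound E0 gain)
  also have "\<dots> = exp (card R * ?k * ln 2) * (eta ^ ?M * exp (2 ^ ?k * exp (- \<sigma>) * ?M / deg))"
  proof -
    have "real (card (R \<rightarrow>\<^sub>E Pow C)) = 2 ^ (?k * card R)"
      using finR finC by (simp add: card_PiE card_Pow power_mult)
    also have "\<dots> = exp (card R * ?k * ln 2)"
      by (metis exp_ln exp_of_nat_mult mult.commute of_nat_mult zero_less_numeral)
    finally show ?thesis by simp
  qed
  also have "\<dots> = eta ^ ?M * exp (card R * ?k * ln 2 + 2 ^ ?k * exp (- \<sigma>) * ?M / deg)"
    by (simp add: exp_add)
  also have "\<dots> \<le> eta ^ ?M * exp (?M * (2 ^ ?k * exp (- \<sigma>) / n + 2 * ?k * ln 2 * (1 / 2) ^ (n div L)))"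
  proof -
    \<comment> \<open>A block has at least \<open>n div L\<close> coordinates and
      \<open>m \<ge> 2\<close>, so freezing it divides the number of points by at least
      \<open>2 ^ (n div L)\<close>.\<close>
    have "real (card R) * 2 ^ (n div L) \<le> 2 * real ?M"
    proof -
      have "real (card R) * 2 ^ (n div L) \<le> real (card R) * real m ^ card (block L b)"
      proof (rule mult_left_mono)
        have "(2::real) ^ (n div L) \<le> real m ^ (n div L)" using m2 by (intro power_mono) auto
        also have "\<dots> \<le> real m ^ card (block L b)"
          using m2 card_residue_class_ge[OF b, of n] by (intro power_increasing) (auto simp: block_def)
        finally show "(2::real) ^ (n div L) \<le> real m ^ card (block L b)" .
      qed simp
      also have "\<dots> = real (card R * m ^ card (block L b))" by simp
      also have "\<dots> \<le> real (m ^ n)"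
        using card_range_override[OF t BL] unfolding R_def by (rule of_nat_mono)
      also have "\<dots> = 2 * real ?M" using card_X(2) by simp
      finally show ?thesis .
    qed
    then have "real (card R) \<le> 2 * real ?M * (1 / 2) ^ (n div L)"
      by (simp add: power_one_over field_simps)
    then have "real (card R) * (?k * ln 2) \<le> 2 * real ?M * (1 / 2) ^ (n div L) * (?k * ln 2)"
      by (intro mult_right_mono) auto
    moreover have "2 ^ ?k * exp (- \<sigma>) * ?M / deg \<le> 2 ^ ?k * exp (- \<sigma>) * ?M / n"
      using deg_bounds(1) n1 by (intro divide_left_mono) auto
    ultimately have "card R * ?k * ln 2 + 2 ^ ?k * exp (- \<sigma>) * ?M / deg
        \<le> ?M * (2 ^ ?k * exp (- \<sigma>) / n + 2 * ?k * ln 2 * (1 / 2) ^ (n div L))"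
      by (simp add: algebra_simps)
    then show ?thesis using eta_pos by (intro mult_left_mono) auto
  qed
  finally show ?thesis .
qed

text \<open>The guaranteed gain in the exponent per odd vertex. Of \<open>\<kappa>\<close> times the
  disagreement one half is lost to sampled vertices and a quarter pays for wrong references, which
  leaves \<open>\<kappa> / 4\<close> times the bound of \<open>dis_lower\<close>; the other terms
  are sampling errors and \<open>c0\<close>.\<close>

definition rate :: "real \<Rightarrow> real \<Rightarrow> real \<Rightarrow> real \<Rightarrow> real \<Rightarrow> real \<Rightarrow> real" where
  "rate \<kappa> c0 \<tau> \<epsilon> \<epsilon>1 K =
     \<kappa> / 4 * (\<epsilon> - 2 * (real (card C) * (1 / 2) powr (\<epsilon>1 * real n) + K / real n)) / (16 * real m * real n)
     - (\<kappa> + \<tau>) * ((1 / 2) powr (\<epsilon>1 * real n) + K * real (card C) / real n ^ 2) - c0"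

text \<open>The estimates for samples and for references hold only on average, so they are combined
  here for a fixed \<open>g\<close>. The condition on \<open>L\<close> caps the average penalty at a
  quarter of \<open>\<kappa>\<close> times the disagreement.\<close>

lemma sum_tilt_ge:
  fixes \<kappa> c0 \<tau> \<sigma> \<epsilon> \<epsilon>1 K :: real
  assumes pos: "\<kappa> \<ge> 0" "c0 \<ge> 0" "\<tau> \<ge> 0" "\<sigma> \<ge> 0" "L > 0" "8 * \<sigma> * m / L \<le> \<kappa> / 4"
    and \<epsilon>1: "\<And>A a. A \<subseteq> C \<Longrightarrow> a \<in> A \<Longrightarrow> share A a \<ge> 2 * \<epsilon>1" "\<epsilon>1 > 0"
    and g: "g \<in> Ev \<rightarrow>\<^sub>E C" and spread: "\<And>A. card {v\<in>Od. g ` nbs m n v = A} \<le> (1 - \<epsilon>) * card Od"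
    and few: "atyp \<epsilon>1 g \<le> K * card Od / n"
  shows "card Od * rate \<kappa> c0 \<tau> \<epsilon> \<epsilon>1 K * card (Pow Ev \<times> {..<n} \<times> {..<L} \<times> X)
     \<le> (\<Sum>(E0, j, b, t)\<in>Pow Ev \<times> {..<n} \<times> {..<L} \<times> X. tilt \<kappa> c0 \<tau> \<sigma> L E0 j b t g)"
proof -
  let ?M = "real (card Od)"
  let ?k = "real (card C)"
  define \<delta> where "\<delta> = (1 / 2 :: real) powr (\<epsilon>1 * n)"
  define T where "T = (\<Sum>E0\<in>Pow Ev. \<Sum>u\<in>Ev. dis E0 g u)"
  define Ms where "Ms = (\<Sum>E0\<in>Pow Ev. \<Sum>u\<in>Ev - E0. miss E0 g u (g u))"
  define J1 where "J1 E0 = (\<Sum>u\<in>Ev - E0. \<kappa> * dis E0 g u - c0 - \<tau> * miss E0 g u (g u))" for E0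
  define q where "q = (2::real) ^ card Ev"
  have q: "q > 0" by (simp add: q_def)
  have cP: "real (card (Pow Ev)) = q" using finE by (simp add: card_Pow q_def)
  have M: "?M > 0" using Od_pos by simp
  have n0: "real n > 0" using n1 by simp
  have m0: "real m > 0" using m2 by simp
  have X0: "real (card X) > 0" using Od_pos card_X by simp
  have K0: "K \<ge> 0"
  proof -
    have "0 \<le> K * ?M / n" using few by (meson of_nat_0_le_iff order.trans)
    then show ?thesis using M n0 by (simp add: zero_le_mult_iff zero_le_divide_iff)
  qed
  have dd: "(1 / 2 :: real) powr (\<epsilon>1 * deg) \<le> \<delta>"
    unfolding \<delta>_def using deg_bounds(1) \<epsilon>1(2) by (intro powr_mono') auto
  have T0: "T \<ge> 0" unfolding T_def by (intro sum_nonneg) (auto simp: dis_def freq_nonneg)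
  have Ms_le: "Ms \<le> q * (?M * (\<delta> + K * ?k / real n ^ 2))"
  proof -
    have "Ms \<le> q * (?M * (1 / 2) powr (\<epsilon>1 * deg) + atyp \<epsilon>1 g * ?k / deg)"
      using avg_miss[OF \<epsilon>1 g] by (simp add: Ms_def q_def)
    also have "\<dots> \<le> q * (?M * \<delta> + (K * ?M / n) * ?k / n)"
      using q dd few deg_bounds(1) n1 K0
      by (intro mult_left_mono add_mono frac_le mult_right_mono) auto
    also have "\<dots> = q * (?M * (\<delta> + K * ?k / real n ^ 2))"
      by (simp add: power2_eq_square algebra_simps)
    finally show ?thesis .
  qed
  have T_ge: "q * (?M * (\<epsilon> - 2 * (?k * \<delta> + K / n))) \<le> 16 * m * n * T"
  proof -
    let ?Wr = "\<lambda>E0. real (card {v\<in>Od. seen E0 g v \<noteq> g ` nbs m n v})"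
    have "(\<Sum>E0\<in>Pow Ev. \<epsilon> * ?M - 2 * ?Wr E0) \<le> (\<Sum>E0\<in>Pow Ev. 16 * m * n * (\<Sum>u\<in>Ev. dis E0 g u))"
      using dis_lower[OF spread] by (intro sum_mono) simp
    then have "q * (\<epsilon> * ?M) - 2 * (\<Sum>E0\<in>Pow Ev. ?Wr E0) \<le> 16 * m * n * T"
      by (simp add: sum_subtractf T_def sum_distrib_left cP)
    moreover have "(\<Sum>E0\<in>Pow Ev. ?Wr E0) \<le> q * (?M * ?k * (1 / 2) powr (\<epsilon>1 * deg) + atyp \<epsilon>1 g)"
      using avg_wrong[OF \<epsilon>1 g] by (simp add: q_def)
    moreover have "q * (?M * ?k * (1 / 2) powr (\<epsilon>1 * deg) + atyp \<epsilon>1 g) \<le> q * (?M * ?k * \<delta> + K * ?M / n)"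
      using q dd few by (intro mult_left_mono add_mono) auto
    ultimately have "q * (\<epsilon> * ?M) - 2 * (q * (?M * ?k * \<delta> + K * ?M / n)) \<le> 16 * m * n * T" by linarith
    then show ?thesis by (simp add: algebra_simps)
  qed
  have J1_ge: "(\<Sum>E0\<in>Pow Ev. J1 E0) \<ge> \<kappa> * (T / 2 - Ms) - c0 * (q * ?M) - \<tau> * Ms"
  proof -
    have "(\<Sum>E0\<in>Pow Ev. J1 E0) = \<kappa> * (\<Sum>E0\<in>Pow Ev. \<Sum>u\<in>Ev - E0. dis E0 g u)
        - c0 * (\<Sum>E0\<in>Pow Ev. real (card (Ev - E0))) - \<tau> * Ms"
      by (simp add: J1_def Ms_def sum_subtractf sum_distrib_left mult.commute)
    moreover have "\<kappa> * (T / 2 - Ms) \<le> \<kappa> * (\<Sum>E0\<in>Pow Ev. \<Sum>u\<in>Ev - E0. dis E0 g u)"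
      using avg_dis[of g] pos(1) by (intro mult_left_mono) (auto simp: T_def Ms_def)
    moreover have "c0 * (\<Sum>E0\<in>Pow Ev. real (card (Ev - E0))) \<le> c0 * (q * ?M)"
    proof (rule mult_left_mono[OF _ pos(2)])
      have "(\<Sum>E0\<in>Pow Ev. real (card (Ev - E0))) \<le> (\<Sum>E0\<in>Pow Ev. ?M)"
        using finE by (intro sum_mono) (auto simp: card_Ev[symmetric] intro: card_mono)
      then show "(\<Sum>E0\<in>Pow Ev. real (card (Ev - E0))) \<le> q * ?M" by (simp add: cP)
    qed
    ultimately show ?thesis by linarith
  qed
  have wr: "\<sigma> / deg * (\<Sum>E0\<in>Pow Ev. \<Sum>j<n. \<Sum>b<L. \<Sum>t\<in>X. real (wrong_ref L E0 j b t g))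
      \<le> n * L * card X * (\<kappa> / 4 * T)"
  proof -
    have "(\<Sum>E0\<in>Pow Ev. \<Sum>j<n. \<Sum>b<L. \<Sum>t\<in>X. real (wrong_ref L E0 j b t g))
       \<le> (\<Sum>E0\<in>Pow Ev. card X * m * (8 * real n ^ 2 * (\<Sum>u\<in>Ev. dis E0 g u)))"
      using pos(5) by (intro sum_mono sum_wrong_ref)
    also have "\<dots> = card X * m * (8 * real n ^ 2 * T)" by (simp add: T_def sum_distrib_left)
    finally have "\<sigma> / deg * (\<Sum>E0\<in>Pow Ev. \<Sum>j<n. \<Sum>b<L. \<Sum>t\<in>X. real (wrong_ref L E0 j b t g))
      \<le> \<sigma> / deg * (card X * m * (8 * real n ^ 2 * T))"
      using pos(4) by (intro mult_left_mono) auto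
    also have "\<dots> \<le> \<sigma> / n * (card X * m * (8 * real n ^ 2 * T))"
      using pos(4) deg_bounds(1) n0 T0 by (intro mult_right_mono divide_left_mono) auto
    also have "\<dots> = n * L * card X * ((8 * \<sigma> * m / L) * T)"
      using n0 pos(5) by (simp add: power2_eq_square)
    also have "\<dots> \<le> n * L * card X * (\<kappa> / 4 * T)"
      using pos(6) T0 by (intro mult_left_mono mult_right_mono) auto
    finally show ?thesis .
  qed
  have "(\<Sum>(E0, j, b, t)\<in>Pow Ev \<times> {..<n} \<times> {..<L} \<times> X. tilt \<kappa> c0 \<tau> \<sigma> L E0 j b t g)
      = (\<Sum>E0\<in>Pow Ev. \<Sum>j<n. \<Sum>b<L. \<Sum>t\<in>X. J1 E0 - \<sigma> / deg * wrong_ref L E0 j b t g)"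
    by (simp add: sum.cartesian_product[symmetric] tilt_def J1_def)
  also have "\<dots> = n * L * card X * (\<Sum>E0\<in>Pow Ev. J1 E0)
       - \<sigma> / deg * (\<Sum>E0\<in>Pow Ev. \<Sum>j<n. \<Sum>b<L. \<Sum>t\<in>X. real (wrong_ref L E0 j b t g))"
    by (simp add: sum_subtractf sum_distrib_left mult_ac)
  also have "\<dots> \<ge> n * L * card X * (\<Sum>E0\<in>Pow Ev. J1 E0) - n * L * card X * (\<kappa> / 4 * T)"
    using wr by simp
  finally have "n * L * card X * ((\<Sum>E0\<in>Pow Ev. J1 E0) - \<kappa> / 4 * T)
     \<le> (\<Sum>(E0, j, b, t)\<in>Pow Ev \<times> {..<n} \<times> {..<L} \<times> X. tilt \<kappa> c0 \<tau> \<sigma> L E0 j b t g)"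
    by (simp add: right_diff_distrib)
  moreover have "q * (?M * rate \<kappa> c0 \<tau> \<epsilon> \<epsilon>1 K) \<le> (\<Sum>E0\<in>Pow Ev. J1 E0) - \<kappa> / 4 * T"
  proof -
    have "(\<kappa> + \<tau>) * Ms \<le> (\<kappa> + \<tau>) * (q * (?M * (\<delta> + K * ?k / real n ^ 2)))"
      using Ms_le pos by (intro mult_left_mono) auto
    moreover have "\<kappa> / 4 * (q * (?M * (\<epsilon> - 2 * (?k * \<delta> + K / n))) / (16 * m * n)) \<le> \<kappa> / 4 * T"
    proof (rule mult_left_mono)
      show "q * (?M * (\<epsilon> - 2 * (?k * \<delta> + K / n))) / (16 * m * n) \<le> T"
        using T_ge m0 n0 by (subst pos_divide_le_eq) (auto simp: mult_ac)
    qed (use pos in simp)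
    moreover have "(\<Sum>E0\<in>Pow Ev. J1 E0) - \<kappa> / 4 * T \<ge> \<kappa> / 4 * T - (\<kappa> + \<tau>) * Ms - c0 * (q * ?M)"
      using J1_ge by (simp add: algebra_simps)
    moreover have "q * (?M * rate \<kappa> c0 \<tau> \<epsilon> \<epsilon>1 K)
       = \<kappa> / 4 * (q * (?M * (\<epsilon> - 2 * (?k * \<delta> + K / n))) / (16 * m * n))
         - (\<kappa> + \<tau>) * (q * (?M * (\<delta> + K * ?k / real n ^ 2))) - c0 * (q * ?M)"
      unfolding rate_def \<delta>_def[symmetric] by (simp add: right_diff_distrib mult_ac)
    ultimately show ?thesis by linarith
  qed
  then have "n * L * card X * (q * (?M * rate \<kappa> c0 \<tau> \<epsilon> \<epsilon>1 K))
      \<le> n * L * card X * ((\<Sum>E0\<in>Pow Ev. J1 E0) - \<kappa> / 4 * T)"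
    by (rule mult_left_mono) simp
  moreover have "?M * rate \<kappa> c0 \<tau> \<epsilon> \<epsilon>1 K * card (Pow Ev \<times> {..<n} \<times> {..<L} \<times> X)
      = n * L * card X * (q * (?M * rate \<kappa> c0 \<tau> \<epsilon> \<epsilon>1 K))"
    by (simp add: card_cartesian_product cP mult_ac)
  ultimately show ?thesis by linarith
qed

text \<open>For \<open>g\<close> in \<open>F\<close>, Jensen's inequality turns the average tilt
  into an average of exponentials. Interchanging the sums leaves the tilted sums of
  \<open>tilted_sum_le\<close>, and the difference of the two exponents remains.\<close>

lemma spread_weight_le:
  fixes \<kappa> c0 \<tau> \<sigma> \<epsilon> \<epsilon>1 K :: real
  assumes gain: "\<And>(D :: (nat \<Rightarrow> nat) set) A. finite D \<Longrightarrow> D \<noteq> {} \<Longrightarrow> (\<And>w. w \<in> D \<Longrightarrow> A w \<subseteq> C) \<Longrightarrow>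
       (\<Sum>a\<in>C. lam a * exp (- \<tau> * freq D (\<lambda>w. a \<notin> A w)))
       \<le> exp ((\<Sum>w\<in>D. ln (Lam (A w))) / card D
              - \<kappa> * freq (D \<times> D) (\<lambda>(w, w'). A w \<noteq> A w') + c0)"
    and pos: "\<kappa> \<ge> 0" "c0 \<ge> 0" "\<tau> \<ge> 0" "\<sigma> \<ge> 0" "L > 0" "8 * \<sigma> * m / L \<le> \<kappa> / 4"
    and \<epsilon>1: "\<And>A a. A \<subseteq> C \<Longrightarrow> a \<in> A \<Longrightarrow> share A a \<ge> 2 * \<epsilon>1" "\<epsilon>1 > 0"
    and F: "F \<subseteq> Ev \<rightarrow>\<^sub>E C"
      "\<And>g A. g \<in> F \<Longrightarrow> card {v\<in>Od. g ` nbs m n v = A} \<le> (1 - \<epsilon>) * card Od"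
      "\<And>g. g \<in> F \<Longrightarrow> atyp \<epsilon>1 g \<le> K * card Od / n"
  shows "(\<Sum>g\<in>F. W g) \<le> eta ^ card Od *
     exp (card Od * (2 ^ card C * exp (- \<sigma>) / n + 2 * card C * ln 2 * (1 / 2) ^ (n div L) - rate \<kappa> c0 \<tau> \<epsilon> \<epsilon>1 K))"
proof -
  let ?P = "Pow Ev \<times> {..<n} \<times> {..<L} \<times> X"
  let ?B = "eta ^ card Od * exp (card Od * (2 ^ card C * exp (- \<sigma>) / n + 2 * card C * ln 2 * (1 / 2) ^ (n div L)))"
  let ?s = "card Od * rate \<kappa> c0 \<tau> \<epsilon> \<epsilon>1 K"
  have finP: "finite ?P" using finE finite_torus by auto
  have neP: "?P \<noteq> {}" using n1 pos(5) origin by (auto simp: lessThan_empty_iff)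
  have cP: "real (card ?P) > 0" using finP neP by (simp add: card_gt_0_iff)
  have finF: "finite (Ev \<rightarrow>\<^sub>E C)" using finE finC by (intro finite_PiE) auto
  have "(\<Sum>g\<in>F. W g) * (exp ?s * card ?P) = (\<Sum>g\<in>F. W g * (exp ?s * card ?P))"
    by (rule sum_distrib_right)
  also have "\<dots> \<le> (\<Sum>g\<in>F. W g * (\<Sum>p\<in>?P. exp (case p of (E0, j, b, t) \<Rightarrow> tilt \<kappa> c0 \<tau> \<sigma> L E0 j b t g)))"
  proof (intro sum_mono mult_left_mono)
    fix g assume g: "g \<in> F"
    then have gE: "g \<in> Ev \<rightarrow>\<^sub>E C" using F(1) by auto
    show "exp ?s * card ?P \<le> (\<Sum>p\<in>?P. exp (case p of (E0, j, b, t) \<Rightarrow> tilt \<kappa> c0 \<tau> \<sigma> L E0 j b t g))"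
      using sum_tilt_ge[OF pos \<epsilon>1 gE F(2)[OF g] F(3)[OF g]] by (rule exp_avg_le[OF finP neP])
    show "0 \<le> W g" using gE by (rule W_nonneg)
  qed
  also have "\<dots> \<le> (\<Sum>g\<in>Ev \<rightarrow>\<^sub>E C. W g * (\<Sum>p\<in>?P. exp (case p of (E0, j, b, t) \<Rightarrow> tilt \<kappa> c0 \<tau> \<sigma> L E0 j b t g)))"
    using finF F(1) W_nonneg by (intro sum_mono2 mult_nonneg_nonneg sum_nonneg) auto
  also have "\<dots> = (\<Sum>p\<in>?P. \<Sum>g\<in>Ev \<rightarrow>\<^sub>E C. W g * exp (case p of (E0, j, b, t) \<Rightarrow> tilt \<kappa> c0 \<tau> \<sigma> L E0 j b t g))"
    unfolding sum_distrib_left by (rule sum.swap)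
  also have "\<dots> \<le> (\<Sum>p\<in>?P. ?B)"
  proof (rule sum_mono)
    fix p assume p: "p \<in> ?P"
    obtain E0 j b t where pe: "p = (E0, j, b, t)" by (cases p) auto
    have "(\<Sum>g\<in>Ev \<rightarrow>\<^sub>E C. W g * exp (tilt \<kappa> c0 \<tau> \<sigma> L E0 j b t g)) \<le> ?B"
      using p unfolding pe by (intro tilted_sum_le gain) auto
    then show "(\<Sum>g\<in>Ev \<rightarrow>\<^sub>E C. W g * exp (case p of (E0, j, b, t) \<Rightarrow> tilt \<kappa> c0 \<tau> \<sigma> L E0 j b t g)) \<le> ?B"
      by (simp add: pe)
  qed
  also have "\<dots> = ?B * card ?P" by (simp add: mult.commute)
  finally have "(\<Sum>g\<in>F. W g) * exp ?s * card ?P \<le> ?B * card ?P" by (simp only: mult.assoc)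
  then have "(\<Sum>g\<in>F. W g) * exp ?s \<le> ?B" using cP by (rule mult_right_le_imp_le)
  then have "(\<Sum>g\<in>F. W g) \<le> ?B * exp (- ?s)" by (simp add: exp_minus field_simps)
  also have "\<dots> = eta ^ card Od *
     exp (card Od * (2 ^ card C * exp (- \<sigma>) / n + 2 * card C * ln 2 * (1 / 2) ^ (n div L) - rate \<kappa> c0 \<tau> \<epsilon> \<epsilon>1 K))"
    by (simp add: mult_exp_exp algebra_simps)
  finally show ?thesis .
qed

end


section \<open>Configurations far from every dominant pattern\<close>

context spin_model
begin

definition torus_weight :: "nat \<Rightarrow> nat \<Rightarrow> ((nat \<Rightarrow> nat) \<Rightarrow> 'c) \<Rightarrow> real" where
  "torus_weight m n g =
     (\<Prod>u\<in>even_class m n. lam (g u)) * (\<Prod>v\<in>odd_class m n. nu (g ` nbs m n v))"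

definition near :: "nat \<Rightarrow> nat \<Rightarrow> real \<Rightarrow> 'c set \<Rightarrow> ((nat \<Rightarrow> nat) \<Rightarrow> 'c) \<Rightarrow> bool" where
  "near m n r A g \<longleftrightarrow> (\<forall>a\<in>C. \<bar>freq (even_class m n) (\<lambda>u. g u = a) - share A a\<bar> \<le> r)"

lemma share_bounds: "A \<subseteq> C \<Longrightarrow> 0 \<le> share A a \<and> share A a \<le> 1"
proof (cases "a \<in> A")
  case True
  assume A: "A \<subseteq> C"
  have "lam a \<le> sum lam A"
    using True A lam_pos fin_sub[OF A] by (intro member_le_sum) (auto intro: less_imp_le)
  moreover have "lam a > 0" using True A lam_pos by auto
  ultimately show ?thesis using True by (simp add: share_def)
qed (simp add: share_def)

end

context torus_spin
begin

lemma W_torus: "W g = torus_weight m n g"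
  by (simp add: W_def torus_weight_def)

text \<open>Each even vertex lies in exactly \<open>deg\<close> neighbourhoods of odd vertices, so
  local frequencies average without bias.\<close>

lemma freq_eq_avg:
  "freq Ev (\<lambda>u. g u = a) = (\<Sum>v\<in>Od. freq (nbs m n v) (\<lambda>u. g u = a)) / card Od"
proof -
  let ?X = "{u\<in>Ev. g u = a}"
  have "(\<Sum>u\<in>?X. \<Sum>w\<in>nbs m n u. 1) = (\<Sum>w\<in>Od. \<Sum>u\<in>nbs m n w \<inter> ?X. 1::real)"
    by (rule sum_swap_edges) auto
  then have "real (card ?X) * deg = (\<Sum>w\<in>Od. real (card (nbs m n w \<inter> ?X)))"
    by (simp add: N_E(2))
  also have "\<dots> = (\<Sum>w\<in>Od. deg * freq (nbs m n w) (\<lambda>u. g u = a))"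
  proof (intro sum.cong refl)
    fix w assume w: "w \<in> Od"
    have "nbs m n w \<inter> ?X = {u\<in>nbs m n w. g u = a}" using N_O(1)[OF w] by auto
    then show "real (card (nbs m n w \<inter> ?X)) = deg * freq (nbs m n w) (\<lambda>u. g u = a)"
      using d_pos by (simp add: freq_def N_O(2)[OF w])
  qed
  also have "\<dots> = deg * (\<Sum>w\<in>Od. freq (nbs m n w) (\<lambda>u. g u = a))"
    by (rule sum_distrib_left[symmetric])
  finally have "real (card ?X) = (\<Sum>w\<in>Od. freq (nbs m n w) (\<lambda>u. g u = a))"
    using d_pos by (simp add: mult.commute)
  then show ?thesis by (simp add: freq_def card_Ev)
qed

text \<open>If one set \<open>A\<close> filled more than a fraction \<open>1 - r / 4\<close> of the
  odd vertices, one of them would be typical, making \<open>A\<close> dominant. The frequencies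
  would then be within \<open>3 * r / 4\<close> of its shares: a quarter of \<open>r\<close> each
  for the tolerance at typical vertices, for other colour sets and for atypical vertices.\<close>

lemma far_spread:
  fixes r \<epsilon>1 K :: real
  assumes r: "0 < r" "r \<le> 1" and \<epsilon>1: "\<epsilon>1 \<le> r / 4" and K: "K / n \<le> r / 4"
    and few: "atyp \<epsilon>1 g \<le> K * card Od / n"
    and far: "\<And>A. dominant A \<Longrightarrow> \<not> near m n r A g"
  shows "card {v\<in>Od. g ` nbs m n v = A} \<le> (1 - r / 4) * card Od"
proof (rule ccontr)
  let ?M = "real (card Od)"
  let ?Y = "{v\<in>Od. g ` nbs m n v = A}" and ?Z = "{v\<in>Od. \<not> typical \<epsilon>1 (nbs m n v) g}"
  assume "\<not> card ?Y \<le> (1 - r / 4) * ?M"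
  then have Y: "card ?Y > (1 - r / 4) * ?M" by simp
  have M: "?M > 0" using Od_pos by simp
  have Z: "card ?Z \<le> r / 4 * ?M"
  proof -
    have "card ?Z \<le> K / n * ?M" using few by (simp add: atyp_def)
    also have "\<dots> \<le> r / 4 * ?M" using K by (rule mult_right_mono) simp
    finally show ?thesis .
  qed
  have "\<not> ?Y \<subseteq> ?Z"
  proof
    assume "?Y \<subseteq> ?Z"
    then have "real (card ?Y) \<le> card ?Z" using finO by (intro of_nat_mono card_mono) auto
    then have "(1 - r / 4) * ?M < r / 4 * ?M" using Y Z by linarith
    then show False using r M by simp
  qed
  then obtain v0 where "v0 \<in> Od" "g ` nbs m n v0 = A" "typical \<epsilon>1 (nbs m n v0) g" by blast
  then have dom: "dominant A" by (auto simp: typical_def)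
  then have AC: "A \<subseteq> C" by (simp add: dominant_def)
  have notY: "(\<Sum>v\<in>Od. of_bool (v \<notin> ?Y) :: real) \<le> r / 4 * ?M"
  proof -
    have "(\<Sum>v\<in>Od. of_bool (v \<notin> ?Y) :: real) = (\<Sum>v\<in>Od. 1 - of_bool (g ` nbs m n v = A))"
      by (intro sum.cong) auto
    also have "\<dots> = ?M - card ?Y" using finO by (simp add: sum_subtractf Int_def)
    finally show ?thesis using Y by (simp add: algebra_simps)
  qed
  have "\<bar>freq Ev (\<lambda>u. g u = a) - share A a\<bar> \<le> r" if a: "a \<in> C" for a
  proof -
    let ?f = "\<lambda>v. freq (nbs m n v) (\<lambda>u. g u = a)"
    have "freq Ev (\<lambda>u. g u = a) - share A a = (\<Sum>v\<in>Od. ?f v - share A a) / ?M"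
      using M by (simp add: freq_eq_avg sum_subtractf diff_divide_distrib)
    then have "\<bar>freq Ev (\<lambda>u. g u = a) - share A a\<bar> = \<bar>\<Sum>v\<in>Od. ?f v - share A a\<bar> / ?M" by simp
    also have "\<dots> \<le> (\<Sum>v\<in>Od. \<bar>?f v - share A a\<bar>) / ?M"
      by (intro divide_right_mono sum_abs) auto
    also have "\<dots> \<le> (\<Sum>v\<in>Od. r / 4 + of_bool (v \<notin> ?Y) + of_bool (\<not> typical \<epsilon>1 (nbs m n v) g)) / ?M"
    proof (intro divide_right_mono sum_mono)
      fix v assume v: "v \<in> Od"
      have f01: "0 \<le> ?f v" "?f v \<le> 1" using finN(2)[OF v] by (auto simp: freq_nonneg freq_le_1)
      have s01: "0 \<le> share A a" "share A a \<le> 1" using share_bounds[OF AC] by auto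
      have le1: "\<bar>?f v - share A a\<bar> \<le> 1" using f01 s01 by linarith
      show "\<bar>?f v - share A a\<bar> \<le> r / 4 + of_bool (v \<notin> ?Y) + of_bool (\<not> typical \<epsilon>1 (nbs m n v) g)"
      proof (cases "v \<in> ?Y \<and> typical \<epsilon>1 (nbs m n v) g")
        case True
        have "\<bar>?f v - share A a\<bar> \<le> r / 4"
        proof (cases "a \<in> A")
          case aA: True
          then show ?thesis using True \<epsilon>1 by (auto simp: typical_def)
        next
          case False
          then have "{u\<in>nbs m n v. g u = a} = {}" using True by auto
          then have "?f v = 0" unfolding freq_def by (simp only: card.empty of_nat_0 div_0)
          then show ?thesis using False r by (simp add: share_def)
        qed
        then show ?thesis by (simp add: add_increasing2)
      next
        case False
        then have "1 \<le> of_bool (v \<notin> ?Y) + (of_bool (\<not> typical \<epsilon>1 (nbs m n v) g) :: real)" by auto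
        then show ?thesis using le1 r by linarith
      qed
    qed simp
    also have "\<dots> = (r / 4 * ?M + (\<Sum>v\<in>Od. of_bool (v \<notin> ?Y)) + atyp \<epsilon>1 g) / ?M"
      by (simp add: sum.distrib atyp_eq del: sum_of_bool_eq)
    also have "\<dots> \<le> (r / 4 * ?M + r / 4 * ?M + r / 4 * ?M) / ?M"
      using notY Z by (intro divide_right_mono add_mono) (auto simp: atyp_def)
    also have "\<dots> \<le> r" using M r by simp
    finally show ?thesis .
  qed
  then have "near m n r A g" by (simp add: near_def)
  then show False using far dom by blast
qed

end

lemma half_powr: "(1 / 2 :: real) powr x = exp (- (ln 2 * x))"
  by (simp add: powr_def ln_div)

lemma half_power_div_le:
  assumes "L > 0"
  shows "(1 / 2 :: real) ^ (n div L) \<le> 2 * (1 / 2) powr (1 / real L * real n)"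
proof -
  have "real n / L - 1 \<le> real (n div L)"
  proof -
    have "n < (n div L + 1) * L" using assms by (metis add.commute dividend_less_div_times mult.commute mult_Suc_right plus_1_eq_Suc)
    then have "real n < (real (n div L) + 1) * L"
      by (metis of_nat_1 of_nat_add of_nat_less_iff of_nat_mult)
    then show ?thesis using assms by (simp add: field_simps)
  qed
  then have "(1 / 2 :: real) powr (n div L) \<le> (1 / 2) powr (real n / L - 1)"
    by (intro powr_mono') auto
  also have "\<dots> = 2 * (1 / 2) powr (1 / real L * real n)" by (simp add: powr_diff)
  finally show ?thesis by (simp add: powr_realpow)
qed

context spin_model
begin

text \<open>Many atypical vertices are costly by the exponential moment of
  \<open>atypical_tilt\<close>. With few of them, distance from every pattern forces spread colour
  sets by \<open>far_spread\<close>, and these are costly by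
  \<open>spread_weight_le\<close>.\<close>

lemma far_weight_le:
  fixes r :: real
  assumes m: "even m" "m \<ge> 2" and r: "0 < r" "r \<le> 1"
  shows "\<exists>c>0. \<exists>N\<ge>1. \<forall>n\<ge>N.
     (\<Sum>g | g \<in> even_class m n \<rightarrow>\<^sub>E C \<and> (\<forall>A. dominant A \<longrightarrow> \<not> near m n r A g). torus_weight m n g)
     \<le> eta ^ card (odd_class m n) * exp (- c * (real m ^ n / n))"
proof -
  obtain \<kappa> C0 \<tau>0 where \<kappa>: "\<kappa> > 0" and C0: "C0 \<ge> 0" and gain: "\<And>\<tau> (D :: (nat \<Rightarrow> nat) set) A.
       \<tau> \<ge> \<tau>0 \<Longrightarrow> finite D \<Longrightarrow> D \<noteq> {} \<Longrightarrow> (\<And>w. w \<in> D \<Longrightarrow> A w \<subseteq> C) \<Longrightarrow>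
       (\<Sum>a\<in>C. lam a * exp (- \<tau> * freq D (\<lambda>w. a \<notin> A w)))
       \<le> exp ((\<Sum>w\<in>D. ln (Lam (A w))) / card D
              - \<kappa> * freq (D \<times> D) (\<lambda>(w, w'). A w \<noteq> A w') + C0 * exp (- \<tau> / 2))"
  proof (rule interface_gain[of C lam Lam])
    show "finite C" "C \<noteq> {}" by (fact finC, fact neC)
  qed (use lam_pos Lam_nonempty Lam_empty in \<open>blast+\<close>)
  let ?k = "real (card C)"
  define sh where "sh = Min ((\<lambda>(A, a). share A a) ` Sigma (Pow C) (\<lambda>A. A))"
  have finS: "finite (Sigma (Pow C) (\<lambda>A. A))" using finC fin_sub by (intro finite_SigmaI) auto
  have neS: "Sigma (Pow C) (\<lambda>A. A) \<noteq> {}" using neC by blast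
  have sh: "sh > 0" "\<And>A a. A \<subseteq> C \<Longrightarrow> a \<in> A \<Longrightarrow> share A a \<ge> sh"
  proof -
    have "share A a > 0" if "A \<subseteq> C" "a \<in> A" for A a
      using that lam_pos fin_sub[OF that(1)] by (auto simp: share_def intro!: divide_pos_pos sum_pos)
    then show "sh > 0" unfolding sh_def using finS neS by (subst Min_gr_iff) auto
    show "share A a \<ge> sh" if "A \<subseteq> C" "a \<in> A" for A a
      unfolding sh_def using finS that by (intro Min_le) auto
  qed
  define \<epsilon>1 where "\<epsilon>1 = min (r / 4) (sh / 2)"
  have \<epsilon>1: "\<epsilon>1 > 0" "\<epsilon>1 \<le> r / 4" "\<epsilon>1 \<le> 1" using r sh(1) by (auto simp: \<epsilon>1_def min_def)
  have \<epsilon>1sh: "share A a \<ge> 2 * \<epsilon>1" if "A \<subseteq> C" "a \<in> A" for A a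
  proof -
    have "\<epsilon>1 \<le> sh / 2" unfolding \<epsilon>1_def by (rule min.cobounded2)
    then show ?thesis using sh(2)[OF that] by linarith
  qed
  obtain t K0 :: real where t: "t > 0" and K0: "K0 \<ge> 0" and loc: "\<And>S :: (nat \<Rightarrow> nat) set. finite S \<Longrightarrow> S \<noteq> {} \<Longrightarrow>
       (\<Sum>x | x \<in> S \<rightarrow>\<^sub>E C \<and> \<not> typical \<epsilon>1 S x. (\<Prod>u\<in>S. lam (x u)) * nu (x ` S) ^ card S)
        \<le> eta ^ card S * (K0 * exp (- t * card S))"
    using atypical_weight[OF \<epsilon>1(1,3)] by blast
  \<comment> \<open>Makes \<open>t * K\<close> exceed the constant of \<open>atypical_tilt\<close>
    by one, so Markov's inequality still gains one per \<open>n\<close> odd vertices.\<close>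
  define K where "K = (2 ^ card C + K0 + 1) / t"
  have K: "K \<ge> 0" using t K0 by (simp add: K_def)
  \<comment> \<open>The limit of \<open>n\<close> times \<open>rate\<close>, once all its error
    terms have vanished.\<close>
  define c1 where "c1 = \<kappa> * (r / 4) / (64 * real m)"
  have m0: "real m > 0" using m by simp
  have c1: "c1 > 0" using \<kappa> r m0 by (simp add: c1_def)
  \<comment> \<open>Limits the cost of the free choice of colour sets to a quarter of
    \<open>c1\<close>.\<close>
  define \<sigma> where "\<sigma> = max 0 (ln (2 ^ card C * 4 / c1))"
  have \<sigma>: "\<sigma> \<ge> 0" "2 ^ card C * exp (- \<sigma>) \<le> c1 / 4"
  proof -
    show "\<sigma> \<ge> 0" by (simp add: \<sigma>_def)
    have "exp (- \<sigma>) \<le> exp (- ln (2 ^ card C * 4 / c1))" by (simp add: \<sigma>_def)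
    also have "\<dots> = c1 / (2 ^ card C * 4)" using c1 by (simp add: exp_minus)
    finally show "2 ^ card C * exp (- \<sigma>) \<le> c1 / 4" by (simp add: field_simps)
  qed
  define L where "L = nat \<lceil>32 * \<sigma> * m / \<kappa>\<rceil> + 1"
  have L: "L > 0" "8 * \<sigma> * m / L \<le> \<kappa> / 4"
  proof -
    show L0: "L > 0" by (simp add: L_def)
    have "32 * \<sigma> * m / \<kappa> \<le> L" unfolding L_def by linarith
    then have "32 * \<sigma> * m \<le> L * \<kappa>" using \<kappa> by (simp add: field_simps)
    then show "8 * \<sigma> * m / L \<le> \<kappa> / 4" using L0 by (simp add: field_simps)
  qed
  \<comment> \<open>Logarithmic growth balances two errors: \<open>exp (- \<tau> n / 2)\<close>
    becomes \<open>1 / n ^ 2\<close>, and \<open>\<tau> n\<close> times the frequency of missed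
    colours stays of order \<open>ln n / n ^ 2\<close>. Both are negligible against
    \<open>c1 / n\<close>.\<close>
  define \<tau> where "\<tau> n = 4 * ln (real n)" for n :: nat
  define rt where "rt n = \<kappa> / 4 * (r / 4 - 2 * (?k * (1 / 2) powr (\<epsilon>1 * real n) + K / real n)) / (16 * real m * real n)
     - (\<kappa> + \<tau> n) * ((1 / 2) powr (\<epsilon>1 * real n) + K * ?k / real n ^ 2) - C0 * exp (- \<tau> n / 2)" for n :: nat
  define bd where "bd n = real n * (2 * ?k * ln 2 * (1 / 2) ^ (n div L)) - real n * rt n" for n :: nat
  have lim: "bd \<longlonglongrightarrow> - c1"
  proof -
    have l1: "(\<lambda>n. 2 * ?k * ln 2 * (real n * (1 / 2) ^ (n div L))) \<longlonglongrightarrow> 2 * ?k * ln 2 * 0"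
    proof (intro tendsto_mult tendsto_const)
      define a where "a = ln 2 * (1 / real L)"
      have a: "a > 0" using L(1) by (simp add: a_def)
      have "(\<lambda>n::nat. real n * (2 * exp (- (a * real n)))) \<longlonglongrightarrow> 0" using a by real_asymp
      then have "(\<lambda>n::nat. real n * (2 * (1 / 2) powr (1 / real L * real n))) \<longlonglongrightarrow> 0"
        by (simp only: half_powr a_def mult.assoc)
      then show "(\<lambda>n. real n * (1 / 2) ^ (n div L)) \<longlonglongrightarrow> 0"
      proof (rule tendsto_sandwich[OF _ _ tendsto_const, rotated 2])
        show "\<forall>\<^sub>F n in sequentially. real n * (1 / 2) ^ (n div L) \<le> real n * (2 * (1 / 2) powr (1 / real L * real n))"
          by (intro always_eventually allI mult_left_mono half_power_div_le L) auto
      qed auto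
    qed
    define a where "a = ln 2 * \<epsilon>1"
    have a: "a > 0" using \<epsilon>1(1) by (simp add: a_def)
    have pw: "(1 / 2 :: real) powr (\<epsilon>1 * x) = exp (- (a * x))" for x
      by (simp only: half_powr a_def mult.assoc)
    have l2: "(\<lambda>n::nat. \<kappa> / 4 * (r / 4 - 2 * (?k * (1 / 2) powr (\<epsilon>1 * real n) + K / real n)) / (16 * real m))
        \<longlonglongrightarrow> \<kappa> / 4 * (r / 4 - 2 * (?k * 0 + 0)) / (16 * real m)"
    proof -
      have "(\<lambda>n::nat. (1 / 2 :: real) powr (\<epsilon>1 * real n)) \<longlonglongrightarrow> 0" unfolding pw using a by real_asymp
      moreover have "(\<lambda>n::nat. K / real n) \<longlonglongrightarrow> 0" by real_asymp
      ultimately show ?thesis using m0 by (intro tendsto_intros) auto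
    qed
    have l3: "(\<lambda>n::nat. (\<kappa> + 4 * ln (real n)) * (real n * (1 / 2) powr (\<epsilon>1 * real n)) +
         (\<kappa> + 4 * ln (real n)) / real n * (K * ?k)) \<longlonglongrightarrow> 0 + 0 * (K * ?k)"
    proof (intro tendsto_add tendsto_mult tendsto_const)
      show "(\<lambda>n::nat. (\<kappa> + 4 * ln (real n)) * (real n * (1 / 2) powr (\<epsilon>1 * real n))) \<longlonglongrightarrow> 0"
        unfolding pw using a \<kappa> by real_asymp
      show "(\<lambda>n::nat. (\<kappa> + 4 * ln (real n)) / real n) \<longlonglongrightarrow> 0" using \<kappa> by real_asymp
    qed
    have l4: "(\<lambda>n::nat. C0 * (1 / real n)) \<longlonglongrightarrow> C0 * 0"
      by (intro tendsto_mult tendsto_const) real_asymp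
    have "(\<lambda>n. 2 * ?k * ln 2 * (real n * (1 / 2) ^ (n div L))
        - \<kappa> / 4 * (r / 4 - 2 * (?k * (1 / 2) powr (\<epsilon>1 * real n) + K / real n)) / (16 * real m)
        + ((\<kappa> + 4 * ln (real n)) * (real n * (1 / 2) powr (\<epsilon>1 * real n)) +
         (\<kappa> + 4 * ln (real n)) / real n * (K * ?k)) + C0 * (1 / real n))
       \<longlonglongrightarrow> 2 * ?k * ln 2 * 0 - \<kappa> / 4 * (r / 4 - 2 * (?k * 0 + 0)) / (16 * real m) + (0 + 0 * (K * ?k)) + C0 * 0"
      by (intro tendsto_add tendsto_diff l1 l2 l3 l4)
    also have "2 * ?k * ln 2 * 0 - \<kappa> / 4 * (r / 4 - 2 * (?k * 0 + 0)) / (16 * real m) + (0 + 0 * (K * ?k)) + C0 * 0 = - c1"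
      by (simp add: c1_def)
    finally show ?thesis
    proof (rule Lim_transform_eventually)
      show "\<forall>\<^sub>F n in sequentially. 2 * ?k * ln 2 * (real n * (1 / 2) ^ (n div L))
        - \<kappa> / 4 * (r / 4 - 2 * (?k * (1 / 2) powr (\<epsilon>1 * real n) + K / real n)) / (16 * real m)
        + ((\<kappa> + 4 * ln (real n)) * (real n * (1 / 2) powr (\<epsilon>1 * real n)) +
         (\<kappa> + 4 * ln (real n)) / real n * (K * ?k)) + C0 * (1 / real n) = bd n"
        using eventually_gt_at_top[of 0]
      proof eventually_elim
        case (elim n)
        then have n: "real n > 0" by simp
        have e: "exp (- \<tau> n / 2) = 1 / real n ^ 2"
        proof -
          have "- \<tau> n / 2 = - (2 * ln (real n))" by (simp add: \<tau>_def)
          also have "exp \<dots> = inverse (exp (ln (real n)) ^ 2)" by (simp add: exp_minus exp_double)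
          finally show ?thesis using n by (simp add: inverse_eq_divide)
        qed
        define p where "p = (1 / 2 :: real) powr (\<epsilon>1 * real n)"
        define h where "h = (1 / 2 :: real) ^ (n div L)"
        define l where "l = ln (real n)"
        show ?case
          unfolding bd_def rt_def e unfolding \<tau>_def p_def[symmetric] h_def[symmetric] l_def[symmetric]
          using n m0 by (simp add: field_simps power2_eq_square)
      qed
    qed
  qed
  have ev1: "\<forall>\<^sub>F n in sequentially. bd n < - 3 * c1 / 4"
    by (rule order_tendstoD(2)[OF lim]) (use c1 in simp)
  have ev2: "\<forall>\<^sub>F n in sequentially. \<tau>0 \<le> \<tau> n"
  proof -
    have "filterlim (\<lambda>n::nat. 4 * ln (real n)) at_top sequentially" by real_asymp
    then show ?thesis unfolding \<tau>_def filterlim_at_top by blast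
  qed
  have ev3: "\<forall>\<^sub>F n in sequentially. K / real n < r / 4"
  proof -
    have "(\<lambda>n::nat. K / real n) \<longlonglongrightarrow> 0" by real_asymp
    then show ?thesis by (rule order_tendstoD(2)) (use r in simp)
  qed
  define c2 where "c2 = min 1 (c1 / 2)"
  have c2: "c2 > 0" "c2 \<le> 1" "c2 \<le> c1 / 2" using c1 by (auto simp: c2_def)
  have ev4: "\<forall>\<^sub>F n::nat in sequentially. ln 2 \<le> c2 / 4 * (2 ^ n / real n)"
  proof -
    have "filterlim (\<lambda>n::nat. c2 / 4 * (2 ^ n / real n)) at_top sequentially" using c2(1) by real_asymp
    then show ?thesis by (simp add: filterlim_at_top)
  qed
  obtain N where N: "\<And>n. n \<ge> N \<Longrightarrow> bd n < - 3 * c1 / 4 \<and> \<tau>0 \<le> \<tau> n \<and> K / real n < r / 4 \<and> ln 2 \<le> c2 / 4 * (2 ^ n / real n) \<and> n \<ge> 1"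
    using eventually_conj[OF ev1 eventually_conj[OF ev2 eventually_conj[OF ev3 eventually_conj[OF ev4 eventually_ge_at_top[of 1]]]]]
    unfolding eventually_sequentially by blast
  have main: "(\<Sum>g | g \<in> even_class m n \<rightarrow>\<^sub>E C \<and> (\<forall>A. dominant A \<longrightarrow> \<not> near m n r A g). torus_weight m n g)
     \<le> eta ^ card (odd_class m n) * exp (- (c2 / 4) * (real m ^ n / n))" if n: "n \<ge> N" for n
  proof -
    have n1: "n \<ge> 1" using N[OF n] by simp
    interpret torus_spin C lam nu eta m n
      by unfold_locales (use m n1 in auto)
    let ?M = "real (card Od)"
    have M: "real m ^ n = 2 * ?M" using card_X(2) by (metis of_nat_mult of_nat_numeral of_nat_power)
    define F where "F = {g. g \<in> Ev \<rightarrow>\<^sub>E C \<and> (\<forall>A. dominant A \<longrightarrow> \<not> near m n r A g)}"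
    define F1 where "F1 = {g\<in>F. atyp \<epsilon>1 g > K * ?M / n}"
    define F2 where "F2 = {g\<in>F. \<not> atyp \<epsilon>1 g > K * ?M / n}"
    have finF: "finite (Ev \<rightarrow>\<^sub>E C)" using finE finC by (intro finite_PiE) auto
    have F: "finite F" "F \<subseteq> Ev \<rightarrow>\<^sub>E C" using finF by (auto simp: F_def)
    have s1: "(\<Sum>g\<in>F1. W g) \<le> eta ^ card Od * exp (- (c2 * ?M / n))"
    proof -
      have "(\<Sum>g\<in>F1. W g) \<le> (\<Sum>g\<in>F1. W g * exp (t * (atyp \<epsilon>1 g - K * ?M / n)))"
      proof (rule sum_mono)
        fix g assume g: "g \<in> F1"
        then have "1 \<le> exp (t * (atyp \<epsilon>1 g - K * ?M / n))" using t by (simp add: F1_def)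
        then have "W g * 1 \<le> W g * exp (t * (atyp \<epsilon>1 g - K * ?M / n))"
          using g F by (intro mult_left_mono W_nonneg) (auto simp: F1_def)
        then show "W g \<le> W g * exp (t * (atyp \<epsilon>1 g - K * ?M / n))" by simp
      qed
      also have "\<dots> \<le> (\<Sum>g\<in>Ev \<rightarrow>\<^sub>E C. W g * exp (t * (atyp \<epsilon>1 g - K * ?M / n)))"
        using finF F W_nonneg by (intro sum_mono2) (auto simp: F1_def)
      also have "\<dots> = (\<Sum>g\<in>Ev \<rightarrow>\<^sub>E C. W g * exp (t * atyp \<epsilon>1 g)) * exp (- t * (K * ?M / n))"
        by (simp add: sum_divide_distrib right_diff_distrib exp_diff exp_minus inverse_eq_divide)
      also have "\<dots> \<le> eta ^ card Od * exp ((2 ^ card C + K0) * ?M / deg) * exp (- t * (K * ?M / n))"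
      proof (rule mult_right_mono)
        show "(\<Sum>g\<in>Ev \<rightarrow>\<^sub>E C. W g * exp (t * atyp \<epsilon>1 g)) \<le> eta ^ card Od * exp ((2 ^ card C + K0) * ?M / deg)"
          unfolding atyp_def
        proof (rule atypical_tilt[OF K0])
          fix v assume v: "v \<in> Od"
          show "(\<Sum>x | x \<in> nbs m n v \<rightarrow>\<^sub>E C \<and> \<not> typical \<epsilon>1 (nbs m n v) x.
              (\<Prod>u\<in>nbs m n v. lam (x u)) * nu (x ` nbs m n v) ^ deg) \<le> eta ^ deg * (K0 * exp (- t * deg))"
            using loc[OF finN(2)[OF v] neN(2)[OF v]] by (simp add: N_O(2)[OF v])
        qed
      qed simp
      also have "\<dots> = eta ^ card Od * exp ((2 ^ card C + K0) * ?M / deg - t * (K * ?M / n))"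
        by (simp add: mult_exp_exp mult.assoc)
      also have "\<dots> \<le> eta ^ card Od * exp (- (c2 * ?M / n))"
      proof -
        have "(2 ^ card C + K0) * ?M / deg \<le> (2 ^ card C + K0) * ?M / n"
          using K0 deg_bounds(1) n1 by (intro divide_left_mono mult_nonneg_nonneg mult_pos_pos) auto
        moreover have "t * (K * ?M / n) = (2 ^ card C + K0) * ?M / n + ?M / n"
        proof -
          have "t * K = 2 ^ card C + K0 + 1" using t by (simp add: K_def)
          then have "t * (K * ?M / n) = (2 ^ card C + K0 + 1) * ?M / n" by (simp add: mult.assoc[symmetric])
          then show ?thesis by (simp add: add_divide_distrib distrib_right)
        qed
        moreover have "c2 * ?M / n \<le> ?M / n"
          using c2(2) by (intro divide_right_mono) (auto simp: mult_left_le_one_le c2(1) less_imp_le)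
        ultimately show ?thesis using eta_pos by (intro mult_left_mono) auto
      qed
      finally show ?thesis .
    qed
    have s2: "(\<Sum>g\<in>F2. W g) \<le> eta ^ card Od * exp (- (c2 * ?M / n))"
    proof -
      have "(\<Sum>g\<in>F2. W g) \<le> eta ^ card Od *
         exp (?M * (2 ^ card C * exp (- \<sigma>) / n + 2 * card C * ln 2 * (1 / 2) ^ (n div L)
            - rate \<kappa> (C0 * exp (- \<tau> n / 2)) (\<tau> n) (r / 4) \<epsilon>1 K))"
      proof (rule spread_weight_le[OF gain])
        show "\<tau>0 \<le> \<tau> n" using N[OF n] by simp
        show "\<tau> n \<ge> 0" using n1 by (simp add: \<tau>_def)
        show "F2 \<subseteq> Ev \<rightarrow>\<^sub>E C" using F by (auto simp: F2_def)
        fix g assume g: "g \<in> F2"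
        show few: "atyp \<epsilon>1 g \<le> K * card Od / n" using g by (simp add: F2_def)
        show "card {v\<in>Od. g ` nbs m n v = A} \<le> (1 - r / 4) * card Od" for A
          using g N[OF n] by (intro far_spread[OF r \<epsilon>1(2) _ few]) (auto simp: F2_def F_def)
      qed (use \<kappa> C0 \<sigma> L \<epsilon>1 \<epsilon>1sh in auto)
      also have "\<dots> \<le> eta ^ card Od * exp (- (c2 * ?M / n))"
      proof -
        have rt: "rate \<kappa> (C0 * exp (- \<tau> n / 2)) (\<tau> n) (r / 4) \<epsilon>1 K = rt n"
          by (simp add: rate_def rt_def)
        have n0: "real n > 0" using n1 by simp
        have "n * (2 ^ card C * exp (- \<sigma>) / n + 2 * card C * ln 2 * (1 / 2) ^ (n div L) - rt n)
            = 2 ^ card C * exp (- \<sigma>) + bd n"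
          using n0 by (simp add: bd_def algebra_simps)
        also have "\<dots> \<le> - c2" using \<sigma>(2) N[OF n] c2(3) by linarith
        finally have "n * (2 ^ card C * exp (- \<sigma>) / n + 2 * card C * ln 2 * (1 / 2) ^ (n div L) - rt n) \<le> - c2" .
        then have "2 ^ card C * exp (- \<sigma>) / n + 2 * card C * ln 2 * (1 / 2) ^ (n div L) - rt n \<le> - c2 / n"
          by (subst pos_le_divide_eq[OF n0]) (simp only: mult.commute)
        then have "?M * (2 ^ card C * exp (- \<sigma>) / n + 2 * card C * ln 2 * (1 / 2) ^ (n div L) - rt n) \<le> ?M * (- c2 / n)"
          by (rule mult_left_mono) simp
        then show ?thesis unfolding rt using eta_pos by (intro mult_left_mono) (auto simp: mult.commute)
      qed
      finally show ?thesis .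
    qed
    have "(\<Sum>g\<in>F. W g) = (\<Sum>g\<in>F1. W g) + (\<Sum>g\<in>F2. W g)"
      unfolding F1_def F2_def using F(1) by (subst sum.union_disjoint[symmetric]) (auto intro!: sum.cong)
    also have "\<dots> \<le> eta ^ card Od * (2 * exp (- (c2 * ?M / n)))" using s1 s2 by simp
    \<comment> \<open>Half of the exponent absorbs the factor two, and \<open>?M\<close> is half of
      \<open>m ^ n\<close>; hence \<open>c2 / 4\<close>.\<close>
    also have "\<dots> \<le> eta ^ card Od * exp (- (c2 / 4) * (real m ^ n / n))"
    proof (rule mult_left_mono)
      have "ln 2 \<le> c2 / 4 * (2 ^ n / real n)" using N[OF n] by simp
      also have "\<dots> \<le> c2 / 4 * (real m ^ n / real n)"
        using c2(1) m by (intro mult_left_mono divide_right_mono power_mono) auto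
      also have "\<dots> = c2 / 2 * ?M / n" by (simp add: M)
      finally have "exp (ln 2) \<le> exp (c2 / 2 * ?M / n)" by (subst exp_le_cancel_iff)
      then have "2 * exp (- (c2 * ?M / n)) \<le> exp (c2 / 2 * ?M / n) * exp (- (c2 * ?M / n))"
        by (intro mult_right_mono) auto
      also have "\<dots> = exp (- (c2 / 4) * (real m ^ n / n))"
        by (simp add: mult_exp_exp M)
      finally show "2 * exp (- (c2 * ?M / n)) \<le> exp (- (c2 / 4) * (real m ^ n / n))" .
    qed (use eta_pos in simp)
    finally show ?thesis by (simp add: F_def W_torus)
  qed
  show ?thesis
    using main c2(1) by (intro exI[of _ "c2 / 4"] conjI exI[of _ "max N 1"]) auto
qed

end

section \<open>Homomorphisms\<close>

definition common_nbs :: "'a set set \<Rightarrow> 'a set \<Rightarrow> 'a set \<Rightarrow> 'a set" where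
  "common_nbs E B A = {b\<in>B. \<forall>a\<in>A. {a, b} \<in> E}"

text \<open>One family for all three state spaces: \<open>C = B = V\<close> gives all homomorphisms,
  and the two orders of the vertex classes give the plus and minus ones.\<close>

definition Homs_into :: "nat \<Rightarrow> nat \<Rightarrow> 'a set \<Rightarrow> 'a set set \<Rightarrow> 'a set \<Rightarrow> 'a set \<Rightarrow> ((nat \<Rightarrow> nat) \<Rightarrow> 'a) set" where
  "Homs_into m n V E C B = {f \<in> Homs m n V E. f ` even_class m n \<subseteq> C \<and> f ` odd_class m n \<subseteq> B}"

lemma Homs_eq_into: "Homs m n V E = Homs_into m n V E V V"
  by (auto simp: Homs_into_def Homs_def even_class_def odd_class_def PiE_iff)

lemma Homs_plus_eq_into: "Homs_plus m n V E Vp Vm = Homs_into m n V E Vm Vp"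
  by (auto simp: Homs_into_def Homs_plus_def)

lemma Homs_minus_eq_into: "Homs_minus m n V E Vp Vm = Homs_into m n V E Vp Vm"
  by (auto simp: Homs_into_def Homs_minus_def)

text \<open>Odd vertices are never adjacent to each other, so given the colours on the even class
  each of them independently takes any common neighbour of the colours around it.\<close>

lemma sum_Homs_into:
  assumes m: "even m" "m \<ge> 2" and fin: "finite V" and sub: "C \<subseteq> V" "B \<subseteq> V"
    and P: "\<And>f. P (restrict f (even_class m n)) \<longleftrightarrow> P f"
  shows "(\<Sum>f | f \<in> Homs_into m n V E C B \<and> P f. hom_weight m n lam f) =
     (\<Sum>g | g \<in> even_class m n \<rightarrow>\<^sub>E C \<and> P g.
        (\<Prod>u\<in>even_class m n. lam (g u)) * (\<Prod>v\<in>odd_class m n. sum lam (common_nbs E B (g ` nbs m n v))))"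
proof -
  let ?Ev = "even_class m n" and ?Od = "odd_class m n" and ?X = "torus m n"
  let ?H = "\<lambda>g. \<Pi>\<^sub>E v\<in>?Od. common_nbs E B (g ` nbs m n v)"
  let ?mg = "\<lambda>g h x. if x \<in> ?Ev then g x else h x"
  have finB: "finite B" "finite C" using fin sub by (auto intro: finite_subset)
  have finE: "finite ?Ev" and finO: "finite ?Od"
    using finite_torus[of m n] by (simp_all add: even_class_def odd_class_def)
  have cl: "?X = ?Ev \<union> ?Od" "?Ev \<inter> ?Od = {}" by (rule classes)+
  have "(\<Sum>f | f \<in> Homs_into m n V E C B \<and> P f. hom_weight m n lam f)
      = (\<Sum>(g, h)\<in>Sigma {g. g \<in> ?Ev \<rightarrow>\<^sub>E C \<and> P g} ?H. (\<Prod>u\<in>?Ev. lam (g u)) * (\<Prod>v\<in>?Od. lam (h v)))"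
  proof (rule sum.reindex_bij_witness[where i = "\<lambda>(g, h). ?mg g h" and j = "\<lambda>f. (restrict f ?Ev, restrict f ?Od)"], goal_cases)
    case (1 f)
    then have "f \<in> extensional ?X" by (auto simp: Homs_into_def Homs_def PiE_iff)
    then show ?case using cl by (auto simp: fun_eq_iff extensional_def)
  next
    case (2 f)
    then have f: "f \<in> Homs m n V E" "f ` ?Ev \<subseteq> C" "f ` ?Od \<subseteq> B" "P f" by (auto simp: Homs_into_def)
    have "restrict f ?Od v \<in> common_nbs E B (restrict f ?Ev ` nbs m n v)" if v: "v \<in> ?Od" for v
    proof -
      have vX: "v \<in> ?X" using v cl by auto
      have "{f u, f v} \<in> E" if u: "u \<in> nbs m n v" for u
      proof -
        have uX: "u \<in> ?X" "torus_adj m n v u" using u by (auto simp: nbs_def)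
        then have "{f v, f u} \<in> E" using f(1) vX by (auto simp: Homs_def)
        then show ?thesis by (simp add: insert_commute)
      qed
      then show ?thesis using v f(3) nbs_classes(2)[OF m v] by (auto simp: common_nbs_def)
    qed
    then show ?case using f P[of f] by auto
  next
    case (3 p)
    then show ?case using cl(2) by (auto simp: fun_eq_iff PiE_iff extensional_def)
  next
    case (4 p)
    then obtain g h where p: "p = (g, h)" and g: "g \<in> ?Ev \<rightarrow>\<^sub>E C" "P g" and h: "h \<in> ?H g" by auto
    have hB: "h v \<in> B" if "v \<in> ?Od" for v using h that by (auto simp: PiE_iff common_nbs_def)
    have edge: "{g u, h v} \<in> E" if "v \<in> ?Od" "u \<in> nbs m n v" for u v
      using h that by (auto simp: PiE_iff common_nbs_def)
    have gC: "g u \<in> C" if "u \<in> ?Ev" for u using g that by (auto simp: PiE_iff)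
    have ext: "?mg g h x = undefined" if "x \<notin> ?X" for x
      using g h that cl(1) by (auto simp: PiE_iff extensional_def)
    have V: "?mg g h \<in> ?X \<rightarrow>\<^sub>E V"
      using gC hB sub cl ext by (auto simp: PiE_iff extensional_def)
    have "{?mg g h x, ?mg g h y} \<in> E" if x: "x \<in> ?X" and y: "y \<in> ?X" and a: "torus_adj m n x y" for x y
    proof (cases "x \<in> ?Ev")
      case True
      have yN: "y \<in> nbs m n x" using y a by (simp add: nbs_def)
      then have yO: "y \<in> ?Od" using nbs_classes(1)[OF m True] by auto
      have "x \<in> nbs m n y" using nbs_sym[OF m(2) x y] yN by simp
      then have "{g x, h y} \<in> E" by (rule edge[OF yO])
      then show ?thesis using True yO cl(2) by auto
    next
      case False
      then have xO: "x \<in> ?Od" using x cl by auto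
      have yN: "y \<in> nbs m n x" using y a by (simp add: nbs_def)
      then have yE: "y \<in> ?Ev" using nbs_classes(2)[OF m xO] by auto
      have "{g y, h x} \<in> E" by (rule edge[OF xO yN])
      then show ?thesis using False yE by (simp add: insert_commute)
    qed
    then have "?mg g h \<in> Homs m n V E" using V by (auto simp: Homs_def)
    moreover have "?mg g h ` ?Ev \<subseteq> C" "?mg g h ` ?Od \<subseteq> B" using gC hB cl(2) by auto
    moreover have "P (?mg g h)"
    proof -
      have "restrict (?mg g h) ?Ev = g" using g(1) by (auto simp: fun_eq_iff PiE_iff extensional_def)
      then show ?thesis using P[of "?mg g h"] g(2) by simp
    qed
    ultimately show ?case by (simp add: p Homs_into_def)
  next
    case (5 f)
    have "hom_weight m n lam f = (\<Prod>u\<in>?Ev. lam (f u)) * (\<Prod>v\<in>?Od. lam (f v))"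
      unfolding hom_weight_def cl(1) using finE finO cl(2) by (rule prod.union_disjoint)
    then show ?case by simp
  qed
  also have "\<dots> = (\<Sum>g | g \<in> ?Ev \<rightarrow>\<^sub>E C \<and> P g. \<Sum>h\<in>?H g. (\<Prod>u\<in>?Ev. lam (g u)) * (\<Prod>v\<in>?Od. lam (h v)))"
  proof (rule sum.Sigma[symmetric])
    show "finite {g. g \<in> ?Ev \<rightarrow>\<^sub>E C \<and> P g}"
      by (rule finite_subset[OF _ finite_PiE[of ?Ev "\<lambda>_. C"]]) (use finE finB in auto)
    show "\<forall>g\<in>{g. g \<in> ?Ev \<rightarrow>\<^sub>E C \<and> P g}. finite (?H g)"
      using finO finB by (intro ballI finite_PiE) (auto simp: common_nbs_def)
  qed
  also have "\<dots> = (\<Sum>g | g \<in> ?Ev \<rightarrow>\<^sub>E C \<and> P g.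
        (\<Prod>u\<in>?Ev. lam (g u)) * (\<Prod>v\<in>?Od. sum lam (common_nbs E B (g ` nbs m n v))))"
    unfolding sum_distrib_left[symmetric]
    using finO finB by (intro sum.cong refl arg_cong2[where f = "(*)"] prod_sum_PiE[symmetric])
      (auto simp: common_nbs_def)
  finally show ?thesis .
qed

section \<open>From colour frequencies to a bottleneck\<close>

lemma freq_diff_le:
  assumes "finite D"
  shows "\<bar>freq D (\<lambda>u. f u = a) - freq D (\<lambda>u. g u = a)\<bar> \<le> card {u\<in>D. f u \<noteq> g u} / card D"
proof -
  have "\<bar>(\<Sum>u\<in>D. of_bool (f u = a)) - (\<Sum>u\<in>D. of_bool (g u = a))\<bar> \<le> (\<Sum>u\<in>D. \<bar>of_bool (f u = a) - of_bool (g u = a)\<bar> :: real)"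
    by (simp only: sum_subtractf[symmetric] sum_abs)
  also have "\<dots> \<le> (\<Sum>u\<in>D. of_bool (f u \<noteq> g u))" by (intro sum_mono) auto
  also have "\<dots> = card {u\<in>D. f u \<noteq> g u}" using assms by (simp add: Int_def)
  finally show ?thesis
    using assms by (simp add: freq_eq_sum diff_divide_distrib[symmetric] divide_right_mono del: sum_of_bool_eq)
qed

context spin_model
begin

lemma near_restrict: "near m n r A (restrict f (even_class m n)) \<longleftrightarrow> near m n r A f"
proof -
  have "{u\<in>even_class m n. restrict f (even_class m n) u = a} = {u\<in>even_class m n. f u = a}" for a by auto
  then show ?thesis by (simp add: near_def freq_def)
qed

text \<open>Distinct dominant sets have share vectors with different supports, and finitely many
  values leave a positive gap. The distance \<open>4 * r\<close> makes the balls of radius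
  \<open>2 * r\<close> around two patterns disjoint.\<close>

lemma shares_separated:
  obtains r :: real where "0 < r" "r \<le> 1 / 2"
    "\<And>A A'. dominant A \<Longrightarrow> dominant A' \<Longrightarrow> A \<noteq> A' \<Longrightarrow> \<exists>a\<in>C. \<bar>share A a - share A' a\<bar> > 4 * r"
proof -
  define Y where "Y = (\<lambda>(A, A', a). \<bar>share A a - share A' a\<bar>) ` (Pow C \<times> Pow C \<times> C)"
  define Z where "Z = {y\<in>Y. y > 0}"
  have finZ: "finite Z" using finC by (simp add: Z_def Y_def)
  \<comment> \<open>Five instead of four makes the separation strict; the inserted \<open>1\<close>
    keeps \<open>r\<close> small.\<close>
  define r where "r = Min (insert 1 Z) / 5"
  have M: "Min (insert 1 Z) > 0" using finZ by (subst Min_gr_iff) (auto simp: Z_def)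
  have M1: "Min (insert 1 Z) \<le> 1" using finZ by (intro Min_le) auto
  show ?thesis
  proof (rule that)
    show "0 < r" using M by (simp add: r_def)
    show "r \<le> 1 / 2" using M1 by (simp add: r_def)
    fix A A' assume d: "dominant A" "dominant A'" "A \<noteq> A'"
    then have AC: "A \<subseteq> C" "A' \<subseteq> C" by (auto simp: dominant_def)
    have pos: "share A a > 0" if "A \<subseteq> C" "a \<in> A" for A a
      using that lam_pos fin_sub[OF that(1)] by (auto simp: share_def intro!: divide_pos_pos sum_pos)
    have zero: "share A a = 0" if "a \<notin> A" for A a using that by (simp add: share_def)
    obtain a where a: "a \<in> C" "share A a \<noteq> share A' a"
    proof -
      from d(3) consider x where "x \<in> A" "x \<notin> A'" | x where "x \<in> A'" "x \<notin> A" by blast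
      then show ?thesis
      proof cases
        case 1
        then show ?thesis using that[of x] pos[OF AC(1) 1(1)] zero[OF 1(2)] AC by auto
      next
        case 2
        then show ?thesis using that[of x] pos[OF AC(2) 2(1)] zero[OF 2(2)] AC by auto
      qed
    qed
    have "\<bar>share A a - share A' a\<bar> \<in> Y"
      unfolding Y_def by (rule image_eqI[of _ _ "(A, A', a)"]) (use a AC in auto)
    then have "\<bar>share A a - share A' a\<bar> \<in> Z" using a(2) by (simp add: Z_def)
    then have "Min (insert 1 Z) \<le> \<bar>share A a - share A' a\<bar>" using finZ by (intro Min_le) auto
    then show "\<exists>a\<in>C. \<bar>share A a - share A' a\<bar> > 4 * r" using a(1) M by (intro bexI[of _ a]) (auto simp: r_def)
  qed
qed

end

text \<open>\<open>S\<close> consists of the states within \<open>2 * r\<close> of one pattern, and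
  \<open>D\<close> of those farther than \<open>r\<close> from every pattern. With
  \<open>\<beta> = r / 4\<close> a step recolours at most a fraction \<open>r / 2\<close> of the
  even class, too little to cross from radius \<open>r\<close> to radius \<open>2 * r\<close>.
  Fixing \<open>p\<close> only through its weights admits both \<open>mu\<close> and its conditioned
  versions.\<close>

lemma slow_mixing_Homs_into:
  fixes V :: "'a set" and E :: "'a set set" and lam :: "'a \<Rightarrow> real"
  assumes fin: "finite V" and lam: "\<And>v. v \<in> V \<Longrightarrow> lam v > 0" and sub: "C \<subseteq> V" "B \<subseteq> V"
    and h: "h > 0" and max: "\<And>A. A \<subseteq> C \<Longrightarrow> sum lam A * sum lam (common_nbs E B A) \<le> h"
    and A1: "A1 \<subseteq> C" "sum lam A1 * sum lam (common_nbs E B A1) = h"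
    and A2: "A2 \<subseteq> C" "sum lam A2 * sum lam (common_nbs E B A2) = h" and A12: "A1 \<noteq> A2"
  shows "\<exists>\<beta>::real. \<beta> > 0 \<and> (\<forall>m::nat. even m \<and> m \<ge> 2 \<longrightarrow>
        (\<exists>c::real. c > 0 \<and> (\<exists>N::nat. \<forall>n\<ge>N. \<forall>K p.
          ergodic_chain (Homs_into m n V E C B) K \<and>
          stationary (Homs_into m n V E C B) K p \<and>
          (\<forall>f\<in>Homs_into m n V E C B. pmf p f =
             hom_weight m n lam f / (\<Sum>g\<in>Homs_into m n V E C B. hom_weight m n lam g)) \<and>
          local_chain \<beta> m n (Homs_into m n V E C B) K \<longrightarrow>
          real (mixing_time (Homs_into m n V E C B) K p) \<ge> exp (c * (real m ^ n / real n ^ 2)))))"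
proof -
  define nu where "nu A = sum lam (common_nbs E B A)" for A
  have nbB: "common_nbs E B A \<subseteq> V" for A using sub(2) by (auto simp: common_nbs_def)
  have finB: "finite (common_nbs E B A)" for A using nbB fin by (rule finite_subset)
  interpret spin_model C lam nu h
  proof
    show "finite C" using sub(1) fin by (rule finite_subset)
    show "C \<noteq> {}" using A1 A2 A12 by blast
    show "0 < lam c" if "c \<in> C" for c using that sub lam by auto
    show "0 \<le> nu A" for A unfolding nu_def using nbB lam by (intro sum_nonneg) (auto intro: less_imp_le)
    show "nu B' \<le> nu A" if "A \<subseteq> B'" for A B'
      unfolding nu_def
    proof (rule sum_mono2[OF finB])
      show "common_nbs E B B' \<subseteq> common_nbs E B A" using that by (auto simp: common_nbs_def)
      show "0 \<le> lam b" if "b \<in> common_nbs E B A - common_nbs E B B'" for b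
        using that nbB lam by (meson DiffD1 less_imp_le subsetD)
    qed
    show "0 < h" by (rule h)
    show "sum lam A * nu A \<le> h" if "A \<subseteq> C" for A using max[OF that] by (simp add: nu_def)
  qed
  have dom: "dominant A1" "dominant A2" using A1 A2 by (auto simp: dominant_def nu_def)
  obtain r :: real where r: "0 < r" "r \<le> 1 / 2"
    and sep: "\<And>A A'. dominant A \<Longrightarrow> dominant A' \<Longrightarrow> A \<noteq> A' \<Longrightarrow> \<exists>a\<in>C. \<bar>share A a - share A' a\<bar> > 4 * r"
    using shares_separated by blast
  have main: "\<exists>c::real. c > 0 \<and> (\<exists>N::nat. \<forall>n\<ge>N. \<forall>K p.
          ergodic_chain (Homs_into m n V E C B) K \<and>
          stationary (Homs_into m n V E C B) K p \<and>
          (\<forall>f\<in>Homs_into m n V E C B. pmf p f =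
             hom_weight m n lam f / (\<Sum>g\<in>Homs_into m n V E C B. hom_weight m n lam g)) \<and>
          local_chain (r / 4) m n (Homs_into m n V E C B) K \<longrightarrow>
          real (mixing_time (Homs_into m n V E C B) K p) \<ge> exp (c * (real m ^ n / real n ^ 2)))"
    if m: "even m" "m \<ge> 2" for m
  proof -
    have r1: "r \<le> 1" using r by simp
    obtain c N0 where c: "c > 0" and N0: "N0 \<ge> 1" and far: "\<And>n. n \<ge> N0 \<Longrightarrow>
       (\<Sum>g | g \<in> even_class m n \<rightarrow>\<^sub>E C \<and> (\<forall>A. dominant A \<longrightarrow> \<not> near m n r A g). torus_weight m n g)
         \<le> h ^ card (odd_class m n) * exp (- c * (real m ^ n / n))"
      using far_weight_le[OF m r(1) r1] by blast
    have "(\<lambda>n::nat. 2 * real (card C) * exp (- (r\<^sup>2 * (2 ^ n / 2)))) \<longlonglongrightarrow> 2 * real (card C) * 0"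
    proof (intro tendsto_mult tendsto_const)
      have "r\<^sup>2 > 0" using r by simp
      then show "(\<lambda>n::nat. exp (- (r\<^sup>2 * (2 ^ n / 2)))) \<longlonglongrightarrow> 0" by real_asymp
    qed
    then have ev1: "\<forall>\<^sub>F n in sequentially. 2 * real (card C) * exp (- (r\<^sup>2 * (2 ^ n / 2))) < 1 / 2"
      by (rule order_tendstoD(2)) simp
    have "filterlim (\<lambda>n::nat. c / 2 * (2 ^ n / real n)) at_top sequentially" using c by real_asymp
    then have ev2: "\<forall>\<^sub>F n::nat in sequentially. ln 40 \<le> c / 2 * (2 ^ n / real n)"
      by (simp add: filterlim_at_top)
    obtain N1 where N1: "\<And>n. n \<ge> N1 \<Longrightarrow> 2 * real (card C) * exp (- (r\<^sup>2 * (2 ^ n / 2))) < 1 / 2 \<and> ln 40 \<le> c / 2 * (2 ^ n / real n)"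
      using eventually_conj[OF ev1 ev2] unfolding eventually_sequentially by blast
    have "real (mixing_time (Homs_into m n V E C B) K p) \<ge> exp (c / 2 * (real m ^ n / real n ^ 2))"
      if n: "n \<ge> max N0 N1" and erg: "ergodic_chain (Homs_into m n V E C B) K"
        and st: "stationary (Homs_into m n V E C B) K p"
        and pm: "\<forall>f\<in>Homs_into m n V E C B. pmf p f =
             hom_weight m n lam f / (\<Sum>g\<in>Homs_into m n V E C B. hom_weight m n lam g)"
        and loc: "local_chain (r / 4) m n (Homs_into m n V E C B) K" for n K p
    proof -
      let ?\<Omega> = "Homs_into m n V E C B"
      let ?P = "measure_pmf.prob p"
      have n1: "n \<ge> 1" using n N0 by simp
      interpret torus_spin C lam nu h m n
        by unfold_locales (use m n1 in auto)
      define M where "M = card Od"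
      define Zt where "Zt = (\<Sum>g\<in>?\<Omega>. hom_weight m n lam g)"
      have M2: "real m ^ n = 2 * real M" using card_X(2) unfolding M_def by (metis of_nat_mult of_nat_numeral of_nat_power)
      have mc: "markov_chain_on ?\<Omega> K" using erg by (simp add: ergodic_chain_def)
      have fO: "finite ?\<Omega>" "?\<Omega> \<noteq> {}" using mc by (auto simp: markov_chain_on_def)
      have wpos: "hom_weight m n lam f > 0" if "f \<in> ?\<Omega>" for f
        unfolding hom_weight_def using that lam by (intro prod_pos) (auto simp: Homs_into_def Homs_def PiE_iff)
      have Zt: "Zt > 0" unfolding Zt_def using fO wpos by (intro sum_pos) auto
      have prob: "?P {f. f \<in> ?\<Omega> \<and> Q f} = (\<Sum>g | g \<in> Ev \<rightarrow>\<^sub>E C \<and> Q g. torus_weight m n g) / Zt"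
        if Q: "\<And>f. Q (restrict f Ev) \<longleftrightarrow> Q f" for Q
      proof -
        have "?P {f. f \<in> ?\<Omega> \<and> Q f} = (\<Sum>f | f \<in> ?\<Omega> \<and> Q f. pmf p f)"
          using fO by (intro measure_measure_pmf_finite) auto
        also have "\<dots> = (\<Sum>f | f \<in> ?\<Omega> \<and> Q f. hom_weight m n lam f) / Zt"
          using pm by (simp add: sum_divide_distrib Zt_def)
        also have "(\<Sum>f | f \<in> ?\<Omega> \<and> Q f. hom_weight m n lam f) = (\<Sum>g | g \<in> Ev \<rightarrow>\<^sub>E C \<and> Q g. torus_weight m n g)"
          unfolding sum_Homs_into[OF m fin sub, of Q, OF Q] torus_weight_def nu_def by (rule refl)
        finally show ?thesis .
      qed
      define S where "S A = {f. f \<in> ?\<Omega> \<and> near m n (2 * r) A f}" for A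
      define D where "D = {f. f \<in> ?\<Omega> \<and> (\<forall>A. dominant A \<longrightarrow> \<not> near m n r A f)}"
      have PD: "?P D \<le> h ^ M * exp (- c * (real m ^ n / n)) / Zt"
      proof -
        have "?P D = (\<Sum>g | g \<in> Ev \<rightarrow>\<^sub>E C \<and> (\<forall>A. dominant A \<longrightarrow> \<not> near m n r A g). torus_weight m n g) / Zt"
          unfolding D_def by (rule prob) (simp add: near_restrict)
        then show ?thesis using far[of n] n Zt unfolding M_def by (simp add: divide_right_mono)
      qed
      \<comment> \<open>\<open>phase_weight_ge\<close> applies at radius \<open>2 * r\<close> since
        \<open>r \<le> 1 / 2\<close>; for large \<open>n\<close> its error term is below one
        half.\<close>
      have PS: "?P (S A) \<ge> h ^ M * (1 / 2) / Zt" if "dominant A" for A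
      proof -
        let ?U = "\<Sum>g | g \<in> Ev \<rightarrow>\<^sub>E C \<and> near m n (2 * r) A g. torus_weight m n g"
        have eq: "?P (S A) = ?U / Zt"
          unfolding S_def by (rule prob) (simp add: near_restrict)
        have lo: "h ^ M * (1 - 2 * card C * exp (- (2 * r)\<^sup>2 / 4 * M))
           \<le> ?U"
          using phase_weight_ge[OF that, of "2 * r"] r even_class_nonempty[of m n] m
          by (simp add: near_def W_torus M_def)
        have "h ^ M * (1 / 2) \<le> h ^ M * (1 - 2 * card C * exp (- (2 * r)\<^sup>2 / 4 * M))"
        proof (rule mult_left_mono)
          have "(2::real) ^ n / 2 \<le> M" using M2 power_mono[of 2 "real m" n] m by simp
          then have "r\<^sup>2 * (2 ^ n / 2) \<le> r\<^sup>2 * M" by (intro mult_left_mono) auto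
          then have "2 * real (card C) * exp (- (2 * r)\<^sup>2 / 4 * M) \<le> 2 * real (card C) * exp (- (r\<^sup>2 * (2 ^ n / 2)))"
            by (intro mult_left_mono) (auto simp: power_mult_distrib)
          then show "1 / 2 \<le> 1 - 2 * card C * exp (- (2 * r)\<^sup>2 / 4 * M)"
            using N1[of n] n by simp
        qed (use h in simp)
        then have "h ^ M * (1 / 2) \<le> ?U" using lo by linarith
        then show ?thesis unfolding eq using Zt by (intro divide_right_mono) auto
      qed
      have disj: "S A1 \<inter> S A2 = {}"
      proof (rule ccontr)
        assume "S A1 \<inter> S A2 \<noteq> {}"
        then obtain f where f: "near m n (2 * r) A1 f" "near m n (2 * r) A2 f" by (auto simp: S_def)
        obtain a where a: "a \<in> C" "\<bar>share A1 a - share A2 a\<bar> > 4 * r" using sep[OF dom A12] by blast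
        have "\<bar>freq Ev (\<lambda>u. f u = a) - share A1 a\<bar> \<le> 2 * r" "\<bar>freq Ev (\<lambda>u. f u = a) - share A2 a\<bar> \<le> 2 * r"
          using f a(1) by (auto simp: near_def)
        then show False using a(2) by linarith
      qed
      obtain A where A: "dominant A" "?P (S A) \<le> 1 / 2"
      proof -
        have "?P (S A1) + ?P (S A2) = ?P (S A1 \<union> S A2)"
          using disj by (intro measure_pmf.finite_measure_Union[symmetric]) auto
        also have "\<dots> \<le> 1" by (rule measure_pmf.prob_le_1)
        finally have "?P (S A1) \<le> 1 / 2 \<or> ?P (S A2) \<le> 1 / 2" by linarith
        then show ?thesis using that dom by blast
      qed
      have PSpos: "?P (S A) > 0"
      proof -
        have "0 < h ^ M * (1 / 2) / Zt" using h Zt by simp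
        then show ?thesis using PS[OF A(1)] by linarith
      qed
      have bd: "set_pmf (K x) \<subseteq> S A" if x: "x \<in> S A" "x \<notin> D" for x
      proof
        fix y assume y: "y \<in> set_pmf (K x)"
        have xO: "x \<in> ?\<Omega>" using x by (simp add: S_def)
        then have yO: "y \<in> ?\<Omega>" using y mc by (auto simp: markov_chain_on_def)
        have "pmf (K x) y \<noteq> 0" using y by (simp add: set_pmf_iff)
        then have cX: "real (card {v \<in> X. x v \<noteq> y v}) \<le> r / 4 * real m ^ n"
          using loc xO yO by (auto simp: local_chain_def)
        have "real (card {u \<in> Ev. x u \<noteq> y u}) \<le> card {v \<in> X. x v \<noteq> y v}"
          using finite_torus[of m n] EvX by (intro of_nat_mono card_mono) auto
        then have cE: "card {u \<in> Ev. x u \<noteq> y u} / card Ev \<le> r / 2"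
          using cX M2 Od_pos by (simp add: card_Ev M_def[symmetric] field_simps)
        have cl: "\<bar>freq Ev (\<lambda>u. x u = a) - freq Ev (\<lambda>u. y u = a)\<bar> \<le> r / 2" for a
          using freq_diff_le[OF finE, of x a y] cE by linarith
        show "y \<in> S A"
        proof (rule ccontr)
          assume "y \<notin> S A"
          then obtain a where a: "a \<in> C" "\<bar>freq Ev (\<lambda>u. y u = a) - share A a\<bar> > 2 * r"
            using yO by (auto simp: S_def near_def not_le)
          have nx: "near m n (2 * r) A x" using x by (simp add: S_def)
          \<comment> \<open>In the colour \<open>a\<close> where \<open>y\<close> escapes,
            \<open>x\<close> is still more than \<open>3 / 2 * r\<close> away from \<open>A\<close>.
            Being within \<open>2 * r\<close> of \<open>A\<close>, it is more than
            \<open>2 * r\<close> away from any other pattern.\<close>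
          have "\<not> near m n r A' x" if A': "dominant A'" for A'
          proof (cases "A' = A")
            case True
            have "\<bar>freq Ev (\<lambda>u. x u = a) - share A a\<bar> > r" using a(2) cl[of a] r by linarith
            then show ?thesis using a(1) True by (auto simp: near_def not_le)
          next
            case False
            then obtain b where b: "b \<in> C" "\<bar>share A' b - share A b\<bar> > 4 * r"
              using sep[OF A' A(1)] by blast
            have "\<bar>freq Ev (\<lambda>u. x u = b) - share A b\<bar> \<le> 2 * r" using nx b(1) by (simp add: near_def)
            then have "\<bar>freq Ev (\<lambda>u. x u = b) - share A' b\<bar> > r" using b(2) r by linarith
            then show ?thesis using b(1) by (auto simp: near_def not_le)
          qed
          then have "x \<in> D" using xO by (simp add: D_def)
          then show False using x by simp
        qed
      qed
      define T where "T = real (mixing_time ?\<Omega> K p)"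
      define y where "y = real m ^ n / n"
      have "(1 / 2 - 1 / exp 1) * ?P (S A) \<le> (T + 1) * ?P D"
      proof -
        have "S A \<subseteq> ?\<Omega>" by (auto simp: S_def)
        from mixing_time_bottleneck[where D = D, OF erg st this PSpos A(2) bd] show ?thesis
          by (simp add: T_def add.commute)
      qed
      moreover have "(1 / 10 :: real) \<le> 1 / 2 - 1 / exp 1"
      proof -
        have "5 / 2 \<le> exp (1::real)" using exp_lower_Taylor_quadratic[of "1::real"] by simp
        then have "1 / exp 1 \<le> 1 / (5 / 2 :: real)" by (intro divide_left_mono) auto
        then show ?thesis by simp
      qed
      then have "1 / 10 * ?P (S A) \<le> (1 / 2 - 1 / exp 1) * ?P (S A)" by (rule mult_right_mono) simp
      moreover have "1 / 10 * (h ^ M * (1 / 2) / Zt) \<le> 1 / 10 * ?P (S A)" using PS[OF A(1)] by simp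
      moreover have "(T + 1) * ?P D \<le> (T + 1) * (h ^ M * exp (- c * y) / Zt)"
        using PD by (intro mult_left_mono) (auto simp: T_def y_def)
      ultimately have "1 / 10 * (h ^ M * (1 / 2) / Zt) \<le> (T + 1) * (h ^ M * exp (- c * y) / Zt)" by linarith
      then have "(h ^ M / Zt) * (1 / 20) \<le> (h ^ M / Zt) * ((T + 1) * exp (- c * y))" by (simp add: mult_ac)
      then have "1 / 20 \<le> (T + 1) * exp (- c * y)" using h Zt by (subst (asm) mult_le_cancel_left_pos) auto
      then have T1: "exp (c * y) / 20 \<le> T + 1" by (simp add: exp_minus field_simps)
      \<comment> \<open>Half of the exponent is given up to absorb the constants: for
        \<open>z \<ge> 40\<close> one has \<open>z * z / 20 - 1 \<ge> z\<close>.\<close>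
      define z where "z = exp (c / 2 * y)"
      have zz: "exp (c * y) = z * z" by (simp add: z_def mult_exp_exp)
      have "ln 40 \<le> c / 2 * (2 ^ n / real n)" using N1[of n] n by simp
      also have "\<dots> \<le> c / 2 * y"
        unfolding y_def using c m by (intro mult_left_mono divide_right_mono power_mono) auto
      finally have "exp (ln 40) \<le> z" unfolding z_def by (subst exp_le_cancel_iff)
      then have z40: "z \<ge> 40" by simp
      have "z * 40 \<le> z * z" using z40 by (intro mult_left_mono) auto
      then have "z \<le> T" using T1 z40 unfolding zz by linarith
      \<comment> \<open>Only here is the exponent weakened from \<open>m ^ n / n\<close> to
        \<open>m ^ n / n ^ 2\<close>.\<close>
      moreover have "exp (c / 2 * (real m ^ n / real n ^ 2)) \<le> z"
      proof -
        have "real m ^ n / real n ^ 2 \<le> y"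
          unfolding y_def using n1 by (intro divide_left_mono) (auto simp: power2_eq_square)
        then have "c / 2 * (real m ^ n / real n ^ 2) \<le> c / 2 * y" using c by (intro mult_left_mono) auto
        then show ?thesis unfolding z_def by (subst exp_le_cancel_iff)
      qed
      ultimately show ?thesis by (simp add: T_def)
    qed
    then show ?thesis using c by (intro exI[of _ "c / 2"] conjI exI[of _ "max N0 N1"]) auto
  qed
  show ?thesis using main r(1) by (intro exI[of _ "r / 4"]) auto
qed


section \<open>Weighted graphs and their dominant patterns\<close>

lemma pmf_cond_mu:
  assumes wg: "weighted_graph V E lam" and m: "even m" and S: "S \<subseteq> Homs m n V E" "f \<in> S"
  shows "pmf (cond_pmf (mu m n V E lam) S) f = hom_weight m n lam f / (\<Sum>g\<in>S. hom_weight m n lam g)"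
proof -
  let ?w = "hom_weight m n lam"
  let ?Z = "\<Sum>g\<in>Homs m n V E. ?w g"
  have fin: "finite (Homs m n V E)" using wg by (intro finite_Homs) (simp add: weighted_graph_def)
  have Z: "?Z > 0"
    using fin Homs_nonempty[OF wg m] hom_weight_pos[OF wg] by (intro sum_pos) auto
  have ne: "set_pmf (mu m n V E lam) \<inter> S \<noteq> {}" using S by (auto simp: set_pmf_mu[OF wg m])
  have "measure_pmf.prob (mu m n V E lam) S = (\<Sum>g\<in>S. pmf (mu m n V E lam) g)"
    using finite_subset[OF S(1) fin] by (simp add: measure_measure_pmf_finite)
  also have "\<dots> = (\<Sum>g\<in>S. ?w g) / ?Z"
    using S(1) by (auto simp: pmf_mu[OF wg m] sum_divide_distrib intro!: sum.cong)
  finally show ?thesis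
    using S Z by (auto simp: pmf_cond[OF ne] pmf_mu[OF wg m])
qed

context
  fixes V :: "'a set" and E :: "'a set set" and lam :: "'a \<Rightarrow> real"
  assumes wg: "weighted_graph V E lam"
begin

lemma wg_facts: "finite V" "v \<in> V \<Longrightarrow> lam v > 0"
  using wg by (auto simp: weighted_graph_def)

lemma finite_patterns:
  "finite {sum lam A * sum lam B | A B. A \<subseteq> V \<and> B \<subseteq> V \<and> complete_between E A B}"
  by (rule finite_subset[of _ "(\<lambda>(A, B). sum lam A * sum lam B) ` (Pow V \<times> Pow V)"])
     (use wg_facts in auto)

lemma pattern_le_eta: "A \<subseteq> V \<Longrightarrow> B \<subseteq> V \<Longrightarrow> complete_between E A B \<Longrightarrow> sum lam A * sum lam B \<le> eta V E lam"
  unfolding eta_def using finite_patterns by (intro Max_ge) auto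

lemma eta_positive: "eta V E lam > 0"
proof -
  obtain u v where uv: "u \<in> V" "v \<in> V" "{u, v} \<in> E"
    using wg unfolding weighted_graph_def by (metis ex_in_conv)
  have "0 < sum lam {u} * sum lam {v}" using uv wg_facts by simp
  also have "\<dots> \<le> eta V E lam" using uv by (intro pattern_le_eta) (auto simp: complete_between_def)
  finally show ?thesis .
qed

lemma dominant_patterns_nonempty: "dominant_patterns V E lam \<noteq> {}"
proof -
  have "eta V E lam \<in> {sum lam A * sum lam B | A B. A \<subseteq> V \<and> B \<subseteq> V \<and> complete_between E A B}"
    unfolding eta_def using finite_patterns by (intro Max_in) (auto simp: complete_between_def)
  then show ?thesis by (force simp: dominant_patterns_def)
qed

lemma finite_dominant_patterns: "finite (dominant_patterns V E lam)"
  by (rule finite_subset[of _ "Pow V \<times> Pow V"]) (use wg_facts in \<open>auto simp: dominant_patterns_def\<close>)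

lemma pattern_nonempty: "(A, B) \<in> dominant_patterns V E lam \<Longrightarrow> A \<noteq> {} \<and> B \<noteq> {}"
  using eta_positive by (auto simp: dominant_patterns_def)

text \<open>Weights are positive, so enlarging the second side would increase the product; it must
  already contain every common neighbour. A dominant pattern is thus determined by its first
  side.\<close>

lemma pattern_maximal:
  assumes p: "(A, B') \<in> dominant_patterns V E lam" and B: "B' \<subseteq> B" "B \<subseteq> V"
  shows "B' = common_nbs E B A" "sum lam A * sum lam (common_nbs E B A) = eta V E lam"
proof -
  have A: "A \<subseteq> V" "A \<noteq> {}" and cb: "complete_between E A B'" and eq: "sum lam A * sum lam B' = eta V E lam"
    using p pattern_nonempty[OF p] by (auto simp: dominant_patterns_def)
  let ?N = "common_nbs E B A"
  have N: "?N \<subseteq> V" "complete_between E A ?N" "B' \<subseteq> ?N"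
    using B cb by (auto simp: common_nbs_def complete_between_def)
  have finN: "finite ?N" using N(1) wg_facts(1) by (rule finite_subset)
  have Apos: "sum lam A > 0"
    using A wg_facts finite_subset[OF A(1)] by (intro sum_pos) auto
  have le: "sum lam A * sum lam ?N \<le> sum lam A * sum lam B'"
    using pattern_le_eta[OF A(1) N(1,2)] eq by simp
  show "B' = ?N"
  proof (rule ccontr)
    assume "B' \<noteq> ?N"
    then obtain b where b: "b \<in> ?N" "b \<notin> B'" using N(3) by blast
    have "sum lam B' < sum lam ?N"
      using finN N b wg_facts(2) by (intro sum_strict_mono2[of ?N B' b]) (auto intro: less_imp_le)
    then show False using le Apos by simp
  qed
  then show "sum lam A * sum lam ?N = eta V E lam" using eq by simp
qed

text \<open>Two patterns inside the same pair \<open>(C, B)\<close> are phases of the same state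
  space. Their first sides differ by \<open>pattern_maximal\<close>, so the colours of the even
  class tell them apart.\<close>

lemma two_patterns_slow:
  assumes sub: "C \<subseteq> V" "B \<subseteq> V"
    and p1: "(A1, B1) \<in> dominant_patterns V E lam" "A1 \<subseteq> C" "B1 \<subseteq> B"
    and p2: "(A2, B2) \<in> dominant_patterns V E lam" "A2 \<subseteq> C" "B2 \<subseteq> B"
    and ne: "(A1, B1) \<noteq> (A2, B2)"
    and p: "\<And>m n f. even m \<Longrightarrow> f \<in> Homs_into m n V E C B \<Longrightarrow> pmf (p m n) f =
       hom_weight m n lam f / (\<Sum>g\<in>Homs_into m n V E C B. hom_weight m n lam g)"
  shows "\<exists>\<beta>::real. \<beta> > 0 \<and> (\<forall>m::nat. even m \<and> m \<ge> 2 \<longrightarrow>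
        (\<exists>c::real. c > 0 \<and> (\<exists>N::nat. \<forall>n\<ge>N. \<forall>K.
          ergodic_chain (Homs_into m n V E C B) K \<and>
          stationary (Homs_into m n V E C B) K (p m n) \<and>
          local_chain \<beta> m n (Homs_into m n V E C B) K \<longrightarrow>
          real (mixing_time (Homs_into m n V E C B) K (p m n)) \<ge> exp (c * (real m ^ n / real n ^ 2)))))"
proof -
  note e1 = pattern_maximal[OF p1(1,3) sub(2)] and e2 = pattern_maximal[OF p2(1,3) sub(2)]
  have A12: "A1 \<noteq> A2" using e1(1) e2(1) ne by auto
  have max: "sum lam A * sum lam (common_nbs E B A) \<le> eta V E lam" if "A \<subseteq> C" for A
    using that sub by (intro pattern_le_eta) (auto simp: common_nbs_def complete_between_def)
  from slow_mixing_Homs_into[OF wg_facts sub eta_positive max p1(2) e1(2) p2(2) e2(2) A12]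
  obtain \<beta> :: real where \<beta>: "\<beta> > 0" "\<And>m. even m \<and> m \<ge> 2 \<Longrightarrow>
        (\<exists>c::real. c > 0 \<and> (\<exists>N::nat. \<forall>n\<ge>N. \<forall>K p.
          ergodic_chain (Homs_into m n V E C B) K \<and>
          stationary (Homs_into m n V E C B) K p \<and>
          (\<forall>f\<in>Homs_into m n V E C B. pmf p f =
             hom_weight m n lam f / (\<Sum>g\<in>Homs_into m n V E C B. hom_weight m n lam g)) \<and>
          local_chain \<beta> m n (Homs_into m n V E C B) K \<longrightarrow>
          real (mixing_time (Homs_into m n V E C B) K p) \<ge> exp (c * (real m ^ n / real n ^ 2))))"
    by auto
  show ?thesis
  proof (rule exI[of _ \<beta>], intro conjI allI impI)
    show "\<beta> > 0" by (rule \<beta>(1))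
    fix m :: nat assume m: "even m \<and> 2 \<le> m"
    obtain c :: real and N :: nat where c: "c > 0" and N: "\<forall>n\<ge>N. \<forall>K p.
          ergodic_chain (Homs_into m n V E C B) K \<and>
          stationary (Homs_into m n V E C B) K p \<and>
          (\<forall>f\<in>Homs_into m n V E C B. pmf p f =
             hom_weight m n lam f / (\<Sum>g\<in>Homs_into m n V E C B. hom_weight m n lam g)) \<and>
          local_chain \<beta> m n (Homs_into m n V E C B) K \<longrightarrow>
          real (mixing_time (Homs_into m n V E C B) K p) \<ge> exp (c * (real m ^ n / real n ^ 2))"
      using \<beta>(2)[OF m] by blast
    show "\<exists>c>0. \<exists>N. \<forall>n\<ge>N. \<forall>K. ergodic_chain (Homs_into m n V E C B) K \<and>
          stationary (Homs_into m n V E C B) K (p m n) \<and> local_chain \<beta> m n (Homs_into m n V E C B) K \<longrightarrow>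
          exp (c * (real m ^ n / real n ^ 2)) \<le> real (mixing_time (Homs_into m n V E C B) K (p m n))"
    proof (rule exI[of _ c], rule conjI[OF c], rule exI[of _ N], intro allI impI)
      fix n K
      assume "N \<le> n" and "ergodic_chain (Homs_into m n V E C B) K \<and>
          stationary (Homs_into m n V E C B) K (p m n) \<and> local_chain \<beta> m n (Homs_into m n V E C B) K"
      then show "exp (c * (real m ^ n / real n ^ 2)) \<le> real (mixing_time (Homs_into m n V E C B) K (p m n))"
        using m p by (intro N[rule_format]) auto
    qed
  qed
qed

lemma edge_sides:
  assumes "bipartition V E Vp Vm" "{a, b} \<in> E"
  shows "a \<in> Vp \<and> b \<in> Vm \<or> a \<in> Vm \<and> b \<in> Vp"
proof -
  obtain u v where "u \<in> Vp" "v \<in> Vm" "{a, b} = {u, v}" using assms by (auto simp: bipartition_def)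
  then show ?thesis by (auto simp: doubleton_eq_iff)
qed

text \<open>Both sides of a pattern are nonempty, so one vertex on each fixes the class of all
  vertices opposite to it.\<close>

lemma pattern_sides:
  assumes bp: "bipartition V E Vp Vm" and p: "(A, B) \<in> dominant_patterns V E lam"
  shows "A \<subseteq> Vm \<and> B \<subseteq> Vp \<or> A \<subseteq> Vp \<and> B \<subseteq> Vm"
proof -
  have disj: "Vp \<inter> Vm = {}" using bp by (simp add: bipartition_def)
  obtain a b where ab: "a \<in> A" "b \<in> B" using pattern_nonempty[OF p] by blast
  have side: "x \<in> Vp \<and> y \<in> Vm \<or> x \<in> Vm \<and> y \<in> Vp" if "x \<in> A" "y \<in> B" for x y
    using p that by (intro edge_sides[OF bp]) (auto simp: dominant_patterns_def complete_between_def)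
  from side[OF ab] show ?thesis
  proof
    assume "a \<in> Vp \<and> b \<in> Vm"
    then have "A \<subseteq> Vp" "B \<subseteq> Vm" using side[OF ab(1)] side[OF _ ab(2)] disj by blast+
    then show ?thesis by simp
  next
    assume "a \<in> Vm \<and> b \<in> Vp"
    then have "A \<subseteq> Vm" "B \<subseteq> Vp" using side[OF ab(1)] side[OF _ ab(2)] disj by blast+
    then show ?thesis by simp
  qed
qed

lemma pattern_swap: "(A, B) \<in> dominant_patterns V E lam \<Longrightarrow> (B, A) \<in> dominant_patterns V E lam"
proof -
  assume p: "(A, B) \<in> dominant_patterns V E lam"
  have "{b, a} \<in> E" if "b \<in> B" "a \<in> A" for a b
    using p that by (subst insert_commute) (auto simp: dominant_patterns_def complete_between_def)
  then show ?thesis using p by (auto simp: dominant_patterns_def complete_between_def mult.commute)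
qed

text \<open>Swapping the sides pairs up the dominant patterns without fixed points, so each
  orientation holds exactly half of them. A nonzero total other than two therefore leaves at least
  two patterns of the same orientation.\<close>

lemma two_bipartite_patterns:
  assumes bp: "bipartition V E Vp Vm" and nt: "\<not> trivial_graph V E lam"
  obtains A1 B1 A2 B2 where "(A1, B1) \<in> dominant_patterns V E lam" "A1 \<subseteq> Vm" "B1 \<subseteq> Vp"
    "(A2, B2) \<in> dominant_patterns V E lam" "A2 \<subseteq> Vm" "B2 \<subseteq> Vp" "(A1, B1) \<noteq> (A2, B2)"
proof -
  let ?D = "dominant_patterns V E lam"
  define D1 where "D1 = {(A, B) \<in> ?D. A \<subseteq> Vm \<and> B \<subseteq> Vp}"
  have disj: "Vp \<inter> Vm = {}" using bp by (simp add: bipartition_def)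
  have sw: "prod.swap p \<in> ?D" if "p \<in> ?D" for p using that pattern_swap by (cases p) auto
  have un: "?D = D1 \<union> prod.swap ` D1"
  proof (intro equalityI subsetI)
    fix p assume p: "p \<in> ?D"
    obtain A B where pe: "p = (A, B)" by (cases p)
    from pattern_sides[OF bp p[unfolded pe]] show "p \<in> D1 \<union> prod.swap ` D1"
    proof
      assume "A \<subseteq> Vm \<and> B \<subseteq> Vp"
      then show ?thesis using p by (simp add: D1_def pe)
    next
      assume "A \<subseteq> Vp \<and> B \<subseteq> Vm"
      then have "(B, A) \<in> D1" using pattern_swap p by (simp add: D1_def pe)
      then show ?thesis by (auto simp: pe intro!: image_eqI[of _ _ "(B, A)"])
    qed
  qed (use sw in \<open>auto simp: D1_def\<close>)
  have fin: "finite D1" using finite_dominant_patterns by (rule finite_subset[rotated]) (auto simp: D1_def)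
  have dj: "D1 \<inter> prod.swap ` D1 = {}"
  proof (rule ccontr)
    assume "D1 \<inter> prod.swap ` D1 \<noteq> {}"
    then obtain A B where "(A, B) \<in> ?D" "A \<subseteq> Vm" "A \<subseteq> Vp" by (auto simp: D1_def)
    then show False using pattern_nonempty disj by blast
  qed
  have "card ?D = card D1 + card (prod.swap ` D1)"
    unfolding un using fin dj by (intro card_Un_disjoint) auto
  also have "card (prod.swap ` D1) = card D1" by (rule card_image) simp
  finally have "card D1 \<noteq> 1"
    using nt bp by (auto simp: trivial_graph_def bipartite_def split: if_splits)
  moreover have "D1 \<noteq> {}" using un dominant_patterns_nonempty by auto
  ultimately obtain p1 p2 where "p1 \<in> D1" "p2 \<in> D1" "p1 \<noteq> p2"
    using fin by (metis card_1_singleton_iff One_nat_def ex_in_conv insertI1 is_singletonI' is_singleton_altdef)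
  then show ?thesis using that by (cases p1; cases p2) (auto simp: D1_def)
qed

end

theorem theorem1p11:
  fixes V :: "'a set" and E :: "'a set set" and lam :: "'a \<Rightarrow> real"
  assumes "weighted_graph V E lam"
    and "\<not> trivial_graph V E lam"
  shows "(\<not> bipartite V E \<longrightarrow>
      (\<exists>\<beta>::real. \<beta> > 0 \<and> (\<forall>m::nat. even m \<and> m \<ge> 2 \<longrightarrow>
        (\<exists>c::real. c > 0 \<and> (\<exists>N::nat. \<forall>n\<ge>N. \<forall>K.
          ergodic_chain (Homs m n V E) K \<and>
          stationary (Homs m n V E) K (mu m n V E lam) \<and>
          local_chain \<beta> m n (Homs m n V E) K \<longrightarrow>
          real (mixing_time (Homs m n V E) K (mu m n V E lam))
            \<ge> exp (c * (real m ^ n / real n ^ 2)))))))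
    \<and> (\<forall>Vp Vm. graph_connected V E \<and> bipartition V E Vp Vm \<longrightarrow>
      (\<exists>\<beta>::real. \<beta> > 0 \<and> (\<forall>m::nat. even m \<and> m \<ge> 2 \<longrightarrow>
        (\<exists>c::real. c > 0 \<and> (\<exists>N::nat. \<forall>n\<ge>N. \<forall>K.
          ergodic_chain (Homs_plus m n V E Vp Vm) K \<and>
          stationary (Homs_plus m n V E Vp Vm) K (mu_plus m n V E lam Vp Vm) \<and>
          local_chain \<beta> m n (Homs_plus m n V E Vp Vm) K \<longrightarrow>
          real (mixing_time (Homs_plus m n V E Vp Vm) K (mu_plus m n V E lam Vp Vm))
            \<ge> exp (c * (real m ^ n / real n ^ 2))))))
      \<and>
      (\<exists>\<beta>::real. \<beta> > 0 \<and> (\<forall>m::nat. even m \<and> m \<ge> 2 \<longrightarrow>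
        (\<exists>c::real. c > 0 \<and> (\<exists>N::nat. \<forall>n\<ge>N. \<forall>K.
          ergodic_chain (Homs_minus m n V E Vp Vm) K \<and>
          stationary (Homs_minus m n V E Vp Vm) K (mu_minus m n V E lam Vp Vm) \<and>
          local_chain \<beta> m n (Homs_minus m n V E Vp Vm) K \<longrightarrow>
          real (mixing_time (Homs_minus m n V E Vp Vm) K (mu_minus m n V E lam Vp Vm))
            \<ge> exp (c * (real m ^ n / real n ^ 2)))))))"
  (is "(_ \<longrightarrow> ?nonbip) \<and> (\<forall>Vp Vm. _ \<longrightarrow> ?plus Vp Vm \<and> ?minus Vp Vm)")
proof (intro conjI impI allI)
  note wg = assms(1) and nt = assms(2)
  have into: "Homs_into m n V E C B \<subseteq> Homs m n V E" for m n C B by (auto simp: Homs_into_def)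
  {
    assume nb: "\<not> bipartite V E"
    let ?D = "dominant_patterns V E lam"
    have "card ?D \<noteq> 1" using nt nb by (simp add: trivial_graph_def)
    then obtain p1 p2 where p: "p1 \<in> ?D" "p2 \<in> ?D" "p1 \<noteq> p2"
      using dominant_patterns_nonempty[OF wg]
      by (metis is_singletonI' is_singleton_altdef)
    obtain A1 B1 A2 B2 where pe: "p1 = (A1, B1)" "p2 = (A2, B2)" by (cases p1; cases p2)
    have sub: "A1 \<subseteq> V" "B1 \<subseteq> V" "A2 \<subseteq> V" "B2 \<subseteq> V"
      using p by (auto simp: pe dominant_patterns_def)
    show ?nonbip
      unfolding Homs_eq_into
      by (rule two_patterns_slow[OF wg order.refl order.refl p(1)[unfolded pe] sub(1,2)
            p(2)[unfolded pe] sub(3,4) p(3)[unfolded pe], where p = "\<lambda>m n. mu m n V E lam"])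
         (simp add: pmf_mu[OF wg] Homs_eq_into[symmetric])
  next
    fix Vp Vm assume "graph_connected V E \<and> bipartition V E Vp Vm"
    then have bp: "bipartition V E Vp Vm" by simp
    have sub: "Vp \<subseteq> V" "Vm \<subseteq> V" using bp by (auto simp: bipartition_def)
    \<comment> \<open>In the plus space the even class takes colours in \<open>Vm\<close>, so the
      first sides are chosen there; the swapped patterns serve the minus space.\<close>
    obtain A1 B1 A2 B2 where p: "(A1, B1) \<in> dominant_patterns V E lam" "A1 \<subseteq> Vm" "B1 \<subseteq> Vp"
      "(A2, B2) \<in> dominant_patterns V E lam" "A2 \<subseteq> Vm" "B2 \<subseteq> Vp" "(A1, B1) \<noteq> (A2, B2)"
      using two_bipartite_patterns[OF wg bp nt] by blast
    show "?plus Vp Vm"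
      unfolding Homs_plus_eq_into
      by (rule two_patterns_slow[OF wg sub(2,1) p, where p = "\<lambda>m n. mu_plus m n V E lam Vp Vm"])
         (simp add: mu_plus_def Homs_plus_eq_into pmf_cond_mu[OF wg _ into])
    have ne: "(B1, A1) \<noteq> (B2, A2)" using p(7) by auto
    show "?minus Vp Vm"
      unfolding Homs_minus_eq_into
      by (rule two_patterns_slow[OF wg sub pattern_swap[OF wg p(1)] p(3,2) pattern_swap[OF wg p(4)] p(6,5) ne,
            where p = "\<lambda>m n. mu_minus m n V E lam Vp Vm"])
         (simp add: mu_minus_def Homs_minus_eq_into pmf_cond_mu[OF wg _ into])
  }
qed

end
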